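(* Let $G$ be a compact Vilenkin group, with sequence of compact open subgroups $\mathscr{G}=\{G_n\}_{n\in\mathbb{N}_0}$, satisfying Condition (A). Let $0<\alpha\le1$ and $f\in L^2(\mu_G)$. Then $f\in Lip_{\mathscr{G}}(\alpha;2)$ if and only if $$\sum_{[\xi]\in\widehat G:\ \langle\xi\rangle_{\mathscr{G}}>|G/G_k|}d_\xi\|\widehat f(\xi)\|_{HS}^2=\mathcal{O}\big(|G/G_k|^{-2\alpha}\big)\quad\text{as }k\to\infty.$$
   Context: **Compact Vilenkin group.** A profinite group $G$ endowed with a strictly decreasing sequence $\mathscr{G}=\{G_n\}_{n\in\mathbb{N}_0}$ of compact open subgroups such that (i) $2\le|G_n/G_{n+1}|<\infty$ for every $n\in\mathbb{N}_0$; (ii) $G=\bigcup_n G_n$ (so $G_0=G$) and $\bigcap_n G_n=\{e\}$; (iii) $\{G_n\}$ is a basis of neighbourhoods at $e$. Here $|H/K|$ denotes the index of $K$ in $H$, $\mu_G$ is the normalized Haar measure and $|G_n|=\mu_G(G_n)=|G/G_n|^{-1}$. Put $|e|_{\mathscr{G}}=0$ and $|x|_{\mathscr{G}}=|G_n|$ if $x\in G_n\setminus G_{n+1}$. **Representations.** $Rep(G)$ is the collection of (classes of) continuous finite-dimensional unitary representations and $\widehat G$ the irreducible ones; $d_\xi$ is the dimension of $\xi$. For $n\in\mathbb{N}_0$ let $G_n^\perp=\{[\pi]\in Rep(G):\pi|_{G_n}=I_{d_\pi}\}$ and, for $n\ge1$, $Rep_n(G)=G_n^\perp\setminus G_{n-1}^\perp$.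 Put $\langle\pi\rangle_{\mathscr{G}}=1$ if $\pi$ is the identity (trivial) representation and $\langle\pi\rangle_{\mathscr{G}}=|G/G_n|$ if $[\pi]\in Rep_n(G)$, $n\ge1$. The Fourier coefficient is $\widehat f(\xi)=\int_G f(x)\xi(x)^*\,d\mu_G(x)\in\mathbb{C}^{d_\xi\times d_\xi}$; $\|\cdot\|_{HS}$ is the Hilbert–Schmidt norm. **Condition (A).** There is a natural number $N$ such that for all $k\in\mathbb{N}_0$ there are $N$ points $h_1,\dots,h_N\in G$ with $|h_1|_{\mathscr{G}}=\dots=|h_N|_{\mathscr{G}}=|G/G_k|^{-1}$ and, for every $1\le q<\infty$, $$|G/G_k|^q\langle\xi\rangle_{\mathscr{G}}^{-q}\|A\|_{HS}^q\lesssim\sum_{i=1}^{N}\|A(\xi(h_i)-I_{d_\xi})\|_{HS}^q$$ for every $[\xi]\in\widehat G$ non-trivial on $G_k\setminus G_{k+1}$ and every matrix $A=\widehat f(\xi)\in\mathbb{C}^{d_\xi\times d_\xi}$, with implied constant independent of $k$, $\xi$ and $A$. **Lipschitz space.** $Lip_{\mathscr{G}}(\alpha;2)=\{f\in L^2(\mu_G):\|f(h\,\cdot)-f(\cdot)\|_{L^2(\mu_G)}=\mathcal{O}(|h|_{\mathscr{G}}^\alpha)\text{ as }|h|_{\mathscr{G}}\to0\}$. *)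

theory Defs
  imports
    "HOL-Analysis.Analysis"
    "HOL-Probability.Probability"
    "HOL-Algebra.Coset"
    "HOL-Library.Landau_Symbols"
    "Jordan_Normal_Form.Schur_Decomposition"
    "Jordan_Normal_Form.VS_Connect"
begin

section \<open>Compact Vilenkin groups\<close>

locale topological_group = group G for G (structure) +
  fixes T :: "'a topology"
  assumes topspace_eq: "topspace T = carrier G"
    and continuous_mult: "continuous_map (prod_topology T T) T (\<lambda>(x, y). x \<otimes> y)"
    and continuous_inv: "continuous_map T T (\<lambda>x. inv x)"

locale profinite_group = topological_group +
  assumes compact: "compact_space T"
    and Hausdorff: "Hausdorff_space T"
    and totally_disconnected: "\<And>x. x \<in> topspace T \<Longrightarrow> connected_component_of_set T x = {x}"

definition subgroup_index :: "('a, 'b) monoid_scheme \<Rightarrow> 'a set \<Rightarrow> 'a set \<Rightarrow> nat" where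
  "subgroup_index G H K = card (rcosets\<^bsub>G\<lparr>carrier := H\<rparr>\<^esub> K)"

text \<open>The subgroups are not assumed to be normal, so quotients are coset spaces throughout.\<close>

locale compact_vilenkin_group = profinite_group +
  fixes S :: "nat \<Rightarrow> 'a set"
  assumes subgroup_S: "\<And>n. subgroup (S n) G"
    and compact_S: "\<And>n. compactin T (S n)"
    and open_S: "\<And>n. openin T (S n)"
    and strictly_decreasing: "\<And>n. S (Suc n) \<subset> S n"
    and finite_quotient: "\<And>n. finite (rcosets\<^bsub>G\<lparr>carrier := S n\<rparr>\<^esub> S (Suc n))"
    and index_ge_2: "\<And>n. 2 \<le> subgroup_index G (S n) (S (Suc n))"
    and Union_S: "(\<Union>n. S n) = carrier G"
    and Inter_S: "(\<Inter>n. S n) = {\<one>}"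
    and basis_S: "\<And>U. openin T U \<Longrightarrow> \<one> \<in> U \<Longrightarrow> \<exists>n. S n \<subseteq> U"

text \<open>The normalized Haar measure is unique, so it is characterized here by its properties;
  on a compact metrizable group regularity is automatic.\<close>

definition normalized_haar_measure ::
    "('a, 'b) monoid_scheme \<Rightarrow> 'a topology \<Rightarrow> 'a measure \<Rightarrow> bool" where
  "normalized_haar_measure G T \<mu> \<longleftrightarrow>
     prob_space \<mu> \<and>
     space \<mu> = carrier G \<and>
     sets \<mu> = sigma_sets (carrier G) {U. openin T U} \<and>
     (\<forall>x\<in>carrier G. \<forall>A\<in>sets \<mu>. emeasure \<mu> ((\<lambda>y. x \<otimes>\<^bsub>G\<^esub> y) ` A) = emeasure \<mu> A)"

abbreviation vindex :: "('a, 'b) monoid_scheme \<Rightarrow> (nat \<Rightarrow> 'a set) \<Rightarrow> nat \<Rightarrow> real" where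
  "vindex G S n \<equiv> real (subgroup_index G (carrier G) (S n))"

definition vabs ::
    "('a, 'b) monoid_scheme \<Rightarrow> (nat \<Rightarrow> 'a set) \<Rightarrow> 'a measure \<Rightarrow> 'a \<Rightarrow> real" where
  "vabs G S \<mu> x =
     (if x = \<one>\<^bsub>G\<^esub> then 0 else measure \<mu> (S (THE n. x \<in> S n - S (Suc n))))"


section \<open>Unitary representations\<close>

definition unitary_mat :: "nat \<Rightarrow> complex mat \<Rightarrow> bool" where
  "unitary_mat d U \<longleftrightarrow> U \<in> carrier_mat d d \<and> mat_adjoint U * U = 1\<^sub>m d"

definition rep_dim :: "('a, 'b) monoid_scheme \<Rightarrow> ('a \<Rightarrow> complex mat) \<Rightarrow> nat" where
  "rep_dim G \<pi> = dim_row (\<pi> \<one>\<^bsub>G\<^esub>)"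

definition unitary_reps ::
    "('a, 'b) monoid_scheme \<Rightarrow> 'a topology \<Rightarrow> ('a \<Rightarrow> complex mat) set" where
  "unitary_reps G T = {\<pi>.
     (\<forall>x\<in>carrier G. unitary_mat (rep_dim G \<pi>) (\<pi> x)) \<and>
     (\<forall>x\<in>carrier G. \<forall>y\<in>carrier G. \<pi> (x \<otimes>\<^bsub>G\<^esub> y) = \<pi> x * \<pi> y) \<and>
     (\<forall>i<rep_dim G \<pi>. \<forall>j<rep_dim G \<pi>. continuous_map T euclidean (\<lambda>x. \<pi> x $$ (i, j)))}"

definition irreducible_reps ::
    "('a, 'b) monoid_scheme \<Rightarrow> 'a topology \<Rightarrow> ('a \<Rightarrow> complex mat) set" where
  "irreducible_reps G T = {\<pi> \<in> unitary_reps G T.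
     rep_dim G \<pi> > 0 \<and>
     (\<forall>W. VectorSpace.subspace class_ring W (module_vec TYPE(complex) (rep_dim G \<pi>)) \<and>
          (\<forall>x\<in>carrier G. \<forall>w\<in>W. \<pi> x *\<^sub>v w \<in> W) \<longrightarrow>
          W = {0\<^sub>v (rep_dim G \<pi>)} \<or> W = carrier_vec (rep_dim G \<pi>))}"

definition rep_equiv :: "('a, 'b) monoid_scheme \<Rightarrow> 'a topology \<Rightarrow>
    (('a \<Rightarrow> complex mat) \<times> ('a \<Rightarrow> complex mat)) set" where
  "rep_equiv G T = {(\<pi>, \<rho>). \<pi> \<in> irreducible_reps G T \<and> \<rho> \<in> irreducible_reps G T \<and>
     rep_dim G \<pi> = rep_dim G \<rho> \<and>
     (\<exists>U. unitary_mat (rep_dim G \<pi>) U \<and> (\<forall>x\<in>carrier G. U * \<pi> x = \<rho> x * U))}"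

definition unitary_dual ::
    "('a, 'b) monoid_scheme \<Rightarrow> 'a topology \<Rightarrow> ('a \<Rightarrow> complex mat) set set" where
  "unitary_dual G T = irreducible_reps G T // rep_equiv G T"

text \<open>Everything evaluated below at a chosen representative of a class depends only on the
  class.\<close>

definition representative :: "('a \<Rightarrow> complex mat) set \<Rightarrow> 'a \<Rightarrow> complex mat" where
  "representative c = (SOME \<xi>. \<xi> \<in> c)"

definition annihilator ::
    "('a, 'b) monoid_scheme \<Rightarrow> 'a topology \<Rightarrow> 'a set \<Rightarrow> ('a \<Rightarrow> complex mat) set" where
  "annihilator G T H = {\<pi> \<in> unitary_reps G T. \<forall>x\<in>H. \<pi> x = 1\<^sub>m (rep_dim G \<pi>)}"

definition Rep_level :: "('a, 'b) monoid_scheme \<Rightarrow> 'a topology \<Rightarrow> (nat \<Rightarrow> 'a set) \<Rightarrow>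
    nat \<Rightarrow> ('a \<Rightarrow> complex mat) set" where
  "Rep_level G T S n = annihilator G T (S n) - annihilator G T (S (n - 1))"

definition rep_weight :: "('a, 'b) monoid_scheme \<Rightarrow> 'a topology \<Rightarrow> (nat \<Rightarrow> 'a set) \<Rightarrow>
    ('a \<Rightarrow> complex mat) \<Rightarrow> real" where
  "rep_weight G T S \<pi> =
     (if \<pi> \<in> annihilator G T (carrier G) then 1
      else vindex G S (THE n. 1 \<le> n \<and> \<pi> \<in> Rep_level G T S n))"


section \<open>Fourier coefficients and Condition (A)\<close>

definition L2 :: "'a measure \<Rightarrow> ('a \<Rightarrow> complex) set" where
  "L2 \<mu> = {f \<in> borel_measurable \<mu>. integrable \<mu> (\<lambda>x. (cmod (f x))\<^sup>2)}"

definition L2_norm_fun :: "'a measure \<Rightarrow> ('a \<Rightarrow> complex) \<Rightarrow> real" where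
  "L2_norm_fun \<mu> f = sqrt (\<integral>x. (cmod (f x))\<^sup>2 \<partial>\<mu>)"

definition fourier_coeff :: "('a, 'b) monoid_scheme \<Rightarrow> 'a measure \<Rightarrow> ('a \<Rightarrow> complex) \<Rightarrow>
    ('a \<Rightarrow> complex mat) \<Rightarrow> complex mat" where
  "fourier_coeff G \<mu> f \<xi> =
     Matrix.mat (rep_dim G \<xi>) (rep_dim G \<xi>)
       (\<lambda>(i, j). \<integral>x. f x * mat_adjoint (\<xi> x) $$ (i, j) \<partial>\<mu>)"

definition HS_norm :: "complex mat \<Rightarrow> real" where
  "HS_norm A = sqrt (\<Sum>i<dim_row A. \<Sum>j<dim_col A. (cmod (A $$ (i, j)))\<^sup>2)"

text \<open>The points \<open>h k 0, \<dots>, h k (N - 1)\<close> do not depend on \<open>q\<close>; the constant may depend on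
  \<open>q\<close> but not on \<open>k\<close>, \<open>\<xi>\<close>, \<open>A\<close>.\<close>

definition condition_A :: "('a, 'b) monoid_scheme \<Rightarrow> 'a topology \<Rightarrow> (nat \<Rightarrow> 'a set) \<Rightarrow>
    'a measure \<Rightarrow> bool" where
  "condition_A G T S \<mu> \<longleftrightarrow>
     (\<exists>N::nat. N \<ge> 1 \<and> (\<exists>h :: nat \<Rightarrow> nat \<Rightarrow> 'a.
        (\<forall>k. \<forall>i<N. h k i \<in> carrier G \<and> vabs G S \<mu> (h k i) = 1 / vindex G S k) \<and>
        (\<forall>q::real. 1 \<le> q \<longrightarrow> (\<exists>C>0. \<forall>k. \<forall>\<xi>\<in>irreducible_reps G T.
           (\<exists>x \<in> S k - S (Suc k). \<xi> x \<noteq> 1\<^sub>m (rep_dim G \<xi>)) \<longrightarrow>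
           (\<forall>A \<in> {fourier_coeff G \<mu> f \<xi> | f. f \<in> L2 \<mu>}.
              vindex G S k powr q * rep_weight G T S \<xi> powr (- q) * HS_norm A powr q
              \<le> C * (\<Sum>i<N. HS_norm (A * (\<xi> (h k i) - 1\<^sub>m (rep_dim G \<xi>))) powr q))))))"


section \<open>Lipschitz spaces and Fourier tails\<close>

definition vabs_to_0 ::
    "('a, 'b) monoid_scheme \<Rightarrow> (nat \<Rightarrow> 'a set) \<Rightarrow> 'a measure \<Rightarrow> 'a filter" where
  "vabs_to_0 G S \<mu> = inf (filtercomap (vabs G S \<mu>) (nhds 0)) (principal (carrier G))"

definition Lip2 :: "('a, 'b) monoid_scheme \<Rightarrow> (nat \<Rightarrow> 'a set) \<Rightarrow> 'a measure \<Rightarrow> real \<Rightarrow>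
    ('a \<Rightarrow> complex) set" where
  "Lip2 G S \<mu> \<alpha> = {f \<in> L2 \<mu>.
     (\<lambda>h. L2_norm_fun \<mu> (\<lambda>x. f (h \<otimes>\<^bsub>G\<^esub> x) - f x))
       \<in> O[vabs_to_0 G S \<mu>](\<lambda>h. vabs G S \<mu> h powr \<alpha>)}"

text \<open>The sum is taken in \<open>[0, \<infinity>]\<close>, so that a divergent tail has value \<open>\<infinity>\<close>.\<close>

definition fourier_tail :: "('a, 'b) monoid_scheme \<Rightarrow> 'a topology \<Rightarrow> (nat \<Rightarrow> 'a set) \<Rightarrow>
    'a measure \<Rightarrow> ('a \<Rightarrow> complex) \<Rightarrow> nat \<Rightarrow> ennreal" where
  "fourier_tail G T S \<mu> f k =
     (\<Sum>\<^sub>\<infinity>c \<in> {c \<in> unitary_dual G T. rep_weight G T S (representative c) > vindex G S k}.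
        ennreal (real (rep_dim G (representative c)) *
                 (HS_norm (fourier_coeff G \<mu> f (representative c)))\<^sup>2))"

end

theory Submission
  imports Defs
begin

text \<open>
  Let \<open>m\<^sub>k\<close> be the index of \<open>G\<^sub>k\<close>. For an irreducible \<open>\<xi>\<close> the operator \<open>\<integral>\<^bsub>G\<^sub>k\<^esub> \<xi>\<close> is a multiple of
  the projection onto the \<open>G\<^sub>k\<close>-invariant vectors. The Fourier coefficient of the indicator of
  \<open>G\<^sub>k\<close> is its adjoint and is fixed by right multiplication with \<open>\<xi> h\<close> for \<open>h \<in> G\<^sub>k\<close>; hence
  Condition (A) forces it to vanish unless \<open>\<xi>\<close> is trivial on \<open>G\<^sub>k\<close>. Nothing else is
  drawn from Condition (A).

  It follows that \<open>\<Sum> d\<^sub>\<xi> \<chi>\<^sub>\<xi> = m\<^sub>n 1\<^bsub>G\<^sub>n\<^esub>\<close>, summed over the irreducibles trivial on \<open>G\<^sub>n\<close>: the difference of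
  the two sides is constant on the left cosets of \<open>G\<^sub>n\<close> and orthogonal to every irreducible, hence
  to the permutation representation on these cosets. Expanding the squared norms gives
  \<open>\<Sum> d\<^sub>\<xi> \<parallel>\<hat>u(\<xi>)\<parallel>\<^sup>2 = m\<^sub>n \<Sum>\<^sub>C |\<integral>\<^sub>C u|\<^sup>2\<close>, with \<open>C\<close> ranging over the cosets, which is at most \<open>\<parallel>u\<parallel>\<^sup>2\<close> and,
  by density of step functions, tends to \<open>\<parallel>u\<parallel>\<^sup>2\<close>.

  For \<open>h \<in> G\<^sub>k\<close> and \<open>u = f(h \<cdot>) - f\<close> one has \<open>\<hat>u(\<xi>) = \<hat>f(\<xi>) (\<xi> h - 1)\<close>, which vanishes if \<open>\<xi>\<close> is trivial
  on \<open>G\<^sub>k\<close> and has at most twice the norm of \<open>\<hat>f(\<xi>)\<close> otherwise, so the tail controls \<open>\<parallel>u\<parallel>\<close>. Conversely,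
  integrating \<open>\<parallel>\<hat>f(\<xi>) (\<xi> h - 1)\<parallel>\<^sup>2\<close> over \<open>h \<in> G\<^sub>k\<close> kills the cross term and leaves
  \<open>2 \<parallel>\<hat>f(\<xi>)\<parallel>\<^sup>2 / m\<^sub>k\<close>, so a bound on \<open>\<parallel>u\<parallel>\<close> for all \<open>h \<in> G\<^sub>k\<close> bounds the tail.
\<close>

section \<open>Complex matrices and isometries\<close>

unbundle no vec_syntax

text \<open>The obstacle is that the \<open>S n\<close> are not assumed normal. The coset space then
  has no dual of its own, and an irreducible \<xi> could have nonzero \<open>S n\<close>-invariant
  vectors without being trivial on \<open>S n\<close>. Such a \<xi> would contribute to the
  indicator of \<open>S n\<close> while being absent from the sum over representations trivial on
  \<open>S n\<close>, so the character identity would fail; excluding this is the task of Condition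
  (A). Its left side being a class function, the identity then shows that every \<open>S n\<close>
  is in fact normal.

  Since every irreducible becomes trivial on some \<open>S n\<close>, a finite set of classes always
  fits into one level. Hence only two limits occur: the tail is a supremum of finite sums, and the
  norm is approximated by energies on finite levels.

  The converse averages over all of \<open>S k\<close> instead of using the points of Condition (A):
  a lower bound is obtained for the mean over \<open>h\<close> only, and no single shift has to be
  large. This is why the Lipschitz bound is used uniformly on \<open>S k\<close>, where
  \<open>vabs\<close> is at most \<open>1 / index k\<close>.\<close>

lemma mat_adjoint_carrier [simp, intro]:
  "A \<in> carrier_mat n m \<Longrightarrow> mat_adjoint A \<in> carrier_mat m n"
  unfolding mat_adjoint_def by auto

lemma mat_adjoint_dim [simp]:
  "dim_row (mat_adjoint A) = dim_col A" "dim_col (mat_adjoint A) = dim_row A"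
  unfolding mat_adjoint_def by auto

lemma mat_adjoint_index [simp]:
  fixes A :: "complex mat"
  shows "i < dim_col A \<Longrightarrow> j < dim_row A \<Longrightarrow> mat_adjoint A $$ (i, j) = cnj (A $$ (j, i))"
  unfolding mat_adjoint_def by (simp add: mat_of_rows_index)

lemma mat_assoc: "dim_col A = dim_row B \<Longrightarrow> dim_col B = dim_row C \<Longrightarrow> A * B * C = A * (B * C)"
  for A :: "'a :: semiring_0 mat"
  by (rule assoc_mult_mat) auto

lemma mat_vec_assoc: "dim_col A = dim_row B \<Longrightarrow> dim_col B = dim_vec v \<Longrightarrow> A * B *\<^sub>v v = A *\<^sub>v (B *\<^sub>v v)"
  for A :: "'a :: comm_semiring_0 mat"
  by (rule assoc_mult_mat_vec) auto

lemma mat_vec_zero: "A \<in> carrier_mat n m \<Longrightarrow> A *\<^sub>v 0\<^sub>v m = 0\<^sub>v n"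
  for A :: "'a :: comm_semiring_0 mat"
  by (rule eq_vecI) (auto simp: scalar_prod_def)

lemma zero_mat_vec: "v \<in> carrier_vec m \<Longrightarrow> 0\<^sub>m n m *\<^sub>v v = 0\<^sub>v n"
  for v :: "'a :: comm_semiring_0 Matrix.vec"
  by (rule eq_vecI) (auto simp: scalar_prod_def)

lemma mat_smult_left: "dim_col A = dim_row B \<Longrightarrow> c \<cdot>\<^sub>m A * B = c \<cdot>\<^sub>m (A * B)"
  for A :: "'a :: comm_semiring_0 mat"
  by (rule mult_smult_assoc_mat) auto

lemma mat_smult_right: "dim_col A = dim_row B \<Longrightarrow> A * (c \<cdot>\<^sub>m B) = c \<cdot>\<^sub>m (A * B)"
  for A :: "'a :: comm_semiring_0 mat"
  by (rule mult_smult_distrib) auto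

lemma mat_mult_index:
  assumes "A \<in> carrier_mat n m" "B \<in> carrier_mat m p" "i < n" "j < p"
  shows "(A * B) $$ (i, j) = (\<Sum>k<m. A $$ (i, k) * B $$ (k, j))"
  using assms by (auto simp: scalar_prod_def lessThan_atLeast0 intro!: sum.cong)

lemma mat_mult_vec_index:
  assumes "A \<in> carrier_mat n m" "v \<in> carrier_vec m" "i < n"
  shows "(A *\<^sub>v v) $ i = (\<Sum>k<m. A $$ (i, k) * v $ k)"
  using assms by (auto simp: scalar_prod_def lessThan_atLeast0 intro!: sum.cong)

lemma mat_eq_vecI:
  fixes A B :: "complex mat"
  assumes A: "A \<in> carrier_mat n m" and B: "B \<in> carrier_mat n m"
    and eq: "\<And>u. u \<in> carrier_vec m \<Longrightarrow> A *\<^sub>v u = B *\<^sub>v u"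
  shows "A = B"
proof (rule eq_matI)
  fix i j assume "i < dim_row B" "j < dim_col B"
  then have ij: "i < n" "j < m" using B by auto
  have col: "(C *\<^sub>v unit_vec m j) $ i = C $$ (i, j)" if C: "C \<in> carrier_mat n m" for C :: "complex mat"
  proof -
    have "(C *\<^sub>v unit_vec m j) $ i = (\<Sum>k<m. C $$ (i, k) * unit_vec m j $ k)"
      using C ij by (intro mat_mult_vec_index) auto
    also have "\<dots> = (\<Sum>k<m. if k = j then C $$ (i, k) else 0)"
      using ij by (intro sum.cong) (auto simp: unit_vec_def)
    finally show ?thesis using ij by simp
  qed
  show "A $$ (i, j) = B $$ (i, j)"
    using col[OF A] col[OF B] eq[of "unit_vec m j"] by simp
qed (use A B in auto)

lemma mat_triple_index:
  fixes A B C :: "complex mat"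
  assumes "A \<in> carrier_mat n m" "B \<in> carrier_mat m p" "C \<in> carrier_mat q p" "i < n" "j < q"
  shows "(A * B * mat_adjoint C) $$ (i, j)
    = (\<Sum>a<m. \<Sum>b<p. A $$ (i, a) * B $$ (a, b) * cnj (C $$ (j, b)))"
proof -
  have "(A * B * mat_adjoint C) $$ (i, j) = (\<Sum>b<p. (A * B) $$ (i, b) * mat_adjoint C $$ (b, j))"
    using assms by (intro mat_mult_index) auto
  also have "\<dots> = (\<Sum>b<p. (\<Sum>a<m. A $$ (i, a) * B $$ (a, b)) * cnj (C $$ (j, b)))"
    using assms by (intro sum.cong) (simp_all del: index_mult_mat add: mat_mult_index)
  also have "\<dots> = (\<Sum>a<m. \<Sum>b<p. A $$ (i, a) * B $$ (a, b) * cnj (C $$ (j, b)))"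
    unfolding sum_distrib_right by (rule sum.swap)
  finally show ?thesis .
qed

lemma mat_adjoint_mult:
  fixes A B :: "complex mat"
  assumes "A \<in> carrier_mat n m" "B \<in> carrier_mat m p"
  shows "mat_adjoint (A * B) = mat_adjoint B * mat_adjoint A"
  by (rule eq_matI) (use assms in \<open>auto simp: scalar_prod_def mult.commute intro!: sum.cong\<close>)

lemma mat_adjoint_adjoint [simp]:
  fixes A :: "complex mat"
  shows "mat_adjoint (mat_adjoint A) = A"
  by (rule eq_matI) auto

lemma mat_adjoint_one [simp]: "mat_adjoint (1\<^sub>m n :: complex mat) = 1\<^sub>m n"
  by (rule eq_matI) auto

lemma unitary_mat_carrier: "unitary_mat d U \<Longrightarrow> U \<in> carrier_mat d d"
  by (simp add: unitary_mat_def)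

lemma unitary_mat_right: "unitary_mat d U \<Longrightarrow> U * mat_adjoint U = 1\<^sub>m d"
  unfolding unitary_mat_def
  by (meson mat_adjoint_carrier mat_mult_left_right_inverse)

lemma unitary_mat_adjoint: "unitary_mat d U \<Longrightarrow> unitary_mat d (mat_adjoint U)"
  using unitary_mat_right by (auto simp: unitary_mat_def)

lemma unitary_mat_mult:
  assumes "unitary_mat d U" "unitary_mat d V"
  shows "unitary_mat d (U * V)"
proof -
  have U: "U \<in> carrier_mat d d" "mat_adjoint U * U = 1\<^sub>m d"
    and V: "V \<in> carrier_mat d d" "mat_adjoint V * V = 1\<^sub>m d"
    using assms by (auto simp: unitary_mat_def)
  have "mat_adjoint V * mat_adjoint U * (U * V) = mat_adjoint V * (mat_adjoint U * U) * V"
    using U(1) V(1) by (smt (verit) assoc_mult_mat mat_adjoint_carrier mult_carrier_mat)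
  then show ?thesis
    using U V by (simp add: unitary_mat_def mat_adjoint_mult[OF U(1) V(1)])
qed

lemma unitary_mat_columns:
  assumes "unitary_mat d U" "i < d" "j < d"
  shows "(\<Sum>k<d. cnj (U $$ (k, i)) * U $$ (k, j)) = (if i = j then 1 else 0)"
proof -
  have U: "U \<in> carrier_mat d d" "mat_adjoint U * U = 1\<^sub>m d"
    using assms by (auto simp: unitary_mat_def)
  have "(mat_adjoint U * U) $$ (i, j) = (\<Sum>k<d. mat_adjoint U $$ (i, k) * U $$ (k, j))"
    using U assms by (intro mat_mult_index) auto
  then show ?thesis
    using U assms by simp
qed

lemma unitary_mat_rows:
  assumes "unitary_mat d U" "i < d" "j < d"
  shows "(\<Sum>k<d. U $$ (i, k) * cnj (U $$ (j, k))) = (if i = j then 1 else 0)"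
  using unitary_mat_columns[OF unitary_mat_adjoint[OF assms(1)] assms(2,3)]
    unitary_mat_carrier[OF assms(1)] assms(2,3) by (simp add: mult.commute)

lemma unitary_mat_entry_le_1:
  assumes "unitary_mat d U" "i < d" "j < d"
  shows "cmod (U $$ (i, j)) \<le> 1"
proof -
  have "complex_of_real (\<Sum>k<d. (cmod (U $$ (k, j)))\<^sup>2) = 1"
    using unitary_mat_columns[OF assms(1,3,3)] 
    by (simp add: complex_norm_square mult.commute del: of_real_power)
  then have "(\<Sum>k<d. (cmod (U $$ (k, j)))\<^sup>2) = 1"
    using of_real_eq_1_iff by blast
  moreover have "(cmod (U $$ (i, j)))\<^sup>2 \<le> (\<Sum>k<d. (cmod (U $$ (k, j)))\<^sup>2)"
    using assms by (intro member_le_sum) auto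
  ultimately show ?thesis
    by (simp add: power_le_one_iff abs_square_le_1)
qed

section \<open>Subspaces and orthonormal frames\<close>

lemma subspace_vecI:
  assumes "W \<subseteq> carrier_vec d" "0\<^sub>v d \<in> W" "\<And>v w. v \<in> W \<Longrightarrow> w \<in> W \<Longrightarrow> v + w \<in> W"
    "\<And>c v. v \<in> W \<Longrightarrow> c \<cdot>\<^sub>v v \<in> W"
  shows "VectorSpace.subspace class_ring W (module_vec TYPE(complex) d)"
proof -
  interpret vec_space "TYPE(complex)" d .
  show ?thesis
    using assms
    by (unfold_locales) (auto simp: module_vec_simps class_ring_simps subspace_def intro!: submodule.intro)
qed

lemma subspace_vecD:
  assumes "VectorSpace.subspace class_ring W (module_vec TYPE(complex) d)"
  shows "W \<subseteq> carrier_vec d" "0\<^sub>v d \<in> W" "\<And>v w. v \<in> W \<Longrightarrow> w \<in> W \<Longrightarrow> v + w \<in> W"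
    "\<And>c v. v \<in> W \<Longrightarrow> c \<cdot>\<^sub>v v \<in> W"
proof -
  interpret W: submodule class_ring W "module_vec TYPE(complex) d"
    using assms by (simp add: VectorSpace.subspace_def)
  show "W \<subseteq> carrier_vec d" "0\<^sub>v d \<in> W" "\<And>v w. v \<in> W \<Longrightarrow> w \<in> W \<Longrightarrow> v + w \<in> W"
    "\<And>c v. v \<in> W \<Longrightarrow> c \<cdot>\<^sub>v v \<in> W"
    using W.subset W.zero_closed W.m_closed W.smult_closed
    by (auto simp: module_vec_simps class_ring_simps)
qed

text \<open>If \<open>e\<close> exceeded \<open>d\<close>, padding \<open>E\<close> with zero rows
  would give a square matrix with orthonormal columns. A one-sided inverse of a square matrix is
  two-sided, so its rows would be orthonormal too, yet row \<open>d\<close> is zero.\<close>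

lemma isometry_dim_le:
  fixes E :: "complex mat"
  assumes E: "E \<in> carrier_mat d e" and iso: "mat_adjoint E * E = 1\<^sub>m e"
  shows "e \<le> d"
proof (rule ccontr)
  assume "\<not> e \<le> d"
  then have de: "d < e" by simp
  define F where "F = Matrix.mat e e (\<lambda>(i, j). if i < d then E $$ (i, j) else 0)"
  have F: "F \<in> carrier_mat e e" by (simp add: F_def)
  have "mat_adjoint F * F = 1\<^sub>m e"
  proof (rule eq_matI)
    fix i j assume "i < dim_row (1\<^sub>m e :: complex mat)" "j < dim_col (1\<^sub>m e :: complex mat)"
    then have ij: "i < e" "j < e" by auto
    have "(mat_adjoint F * F) $$ (i, j) = (\<Sum>k<e. mat_adjoint F $$ (i, k) * F $$ (k, j))"
      using F ij by (intro mat_mult_index) auto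
    also have "\<dots> = (\<Sum>k<e. if k < d then cnj (E $$ (k, i)) * E $$ (k, j) else 0)"
      using ij E de by (intro sum.cong) (auto simp: F_def)
    also have "\<dots> = (\<Sum>k<d. cnj (E $$ (k, i)) * E $$ (k, j))"
      using de by (intro sum.mono_neutral_cong_right) auto
    also have "\<dots> = (\<Sum>k<d. mat_adjoint E $$ (i, k) * E $$ (k, j))"
      using ij E by (intro sum.cong) auto
    also have "\<dots> = (mat_adjoint E * E) $$ (i, j)"
      using E ij by (intro mat_mult_index[symmetric]) auto
    finally show "(mat_adjoint F * F) $$ (i, j) = 1\<^sub>m e $$ (i, j)"
      by (simp add: iso)
  qed (use F in auto)
  then have "F * mat_adjoint F = 1\<^sub>m e"
    using F mat_mult_left_right_inverse mat_adjoint_carrier by blast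
  moreover have "(F * mat_adjoint F) $$ (d, d) = (\<Sum>k<e. F $$ (d, k) * mat_adjoint F $$ (k, d))"
    using F de by (intro mat_mult_index) auto
  moreover have "\<dots> = 0"
    using de by (intro sum.neutral) (auto simp: F_def)
  ultimately show False
    using de by simp
qed

text \<open>One Gram-Schmidt step: \<open>w\<close>, orthogonal to the columns of \<open>E\<close>,
  becomes a further column after division by its length. The last conclusion keeps the new range
  inside any subspace that contains \<open>w\<close> and the old range.\<close>

lemma isometry_append:
  fixes E :: "complex mat"
  assumes E: "E \<in> carrier_mat d e" and iso: "mat_adjoint E * E = 1\<^sub>m e"
    and w: "w \<in> carrier_vec d" and orth: "mat_adjoint E *\<^sub>v w = 0\<^sub>v e" and nz: "w \<noteq> 0\<^sub>v d"
  obtains F where "F \<in> carrier_mat d (Suc e)" "mat_adjoint F * F = 1\<^sub>m (Suc e)"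
    "\<And>u. u \<in> carrier_vec (Suc e) \<Longrightarrow> \<exists>v\<in>carrier_vec e. \<exists>c. F *\<^sub>v u = E *\<^sub>v v + c \<cdot>\<^sub>v w"
proof -
  define r where "r = (\<Sum>k<d. (cmod (w $ k))\<^sup>2)"
  have "\<exists>k<d. w $ k \<noteq> 0"
    using nz w by (metis carrier_vecD eq_vecI index_zero_vec(1) index_zero_vec(2))
  then have r: "r > 0"
    unfolding r_def by (auto intro!: sum_pos2 simp: )
  have orth_sum: "(\<Sum>k<d. cnj (E $$ (k, i)) * w $ k) = 0" if "i < e" for i
  proof -
    have "(mat_adjoint E *\<^sub>v w) $ i = (\<Sum>k<d. mat_adjoint E $$ (i, k) * w $ k)"
      using E w that by (intro mat_mult_vec_index) auto
    then show ?thesis using orth that E by simp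
  qed
  have iso_sum: "(\<Sum>k<d. cnj (E $$ (k, i)) * E $$ (k, j)) = (if i = j then 1 else 0)"
    if "i < e" "j < e" for i j
  proof -
    have "(mat_adjoint E * E) $$ (i, j) = (\<Sum>k<d. mat_adjoint E $$ (i, k) * E $$ (k, j))"
      using E that by (intro mat_mult_index) auto
    then show ?thesis using iso that E by simp
  qed
  have orth_sum': "(\<Sum>k<d. cnj (w $ k) * E $$ (k, i)) = 0" if "i < e" for i
    using arg_cong[OF orth_sum[OF that], of cnj] by (simp add: mult.commute)
  have w_sum: "(\<Sum>k<d. cnj (w $ k) * w $ k) = of_real r"
    unfolding r_def by (simp add: complex_norm_square mult.commute del: of_real_power)
  define c where "c = complex_of_real (1 / sqrt r)"
  have c: "cnj c = c" "c * c * of_real r = 1"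
    using r by (simp_all add: c_def flip: of_real_mult)
  define F where "F = Matrix.mat d (Suc e) (\<lambda>(i, j). if j < e then E $$ (i, j) else c * w $ i)"
  have F: "F \<in> carrier_mat d (Suc e)" by (simp add: F_def)
  show ?thesis
  proof
    show "mat_adjoint F * F = 1\<^sub>m (Suc e)"
    proof (rule eq_matI)
      fix i j assume "i < dim_row (1\<^sub>m (Suc e) :: complex mat)" "j < dim_col (1\<^sub>m (Suc e) :: complex mat)"
      then have ij: "i < Suc e" "j < Suc e" by auto
      have "(mat_adjoint F * F) $$ (i, j) = (\<Sum>k<d. mat_adjoint F $$ (i, k) * F $$ (k, j))"
        using F ij by (intro mat_mult_index) auto
      also have "\<dots> = (\<Sum>k<d. cnj (F $$ (k, i)) * F $$ (k, j))"
        using F ij by (intro sum.cong) auto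
      also have "\<dots> = (if i < e then if j < e then (\<Sum>k<d. cnj (E $$ (k, i)) * E $$ (k, j))
          else c * (\<Sum>k<d. cnj (E $$ (k, i)) * w $ k) else if j < e then
          c * (\<Sum>k<d. cnj (w $ k) * E $$ (k, j)) else c * c * (\<Sum>k<d. cnj (w $ k) * w $ k))"
        unfolding sum_distrib_left
        using ij by (auto simp: F_def c(1) algebra_simps intro!: sum.cong)
      also have "\<dots> = (if i = j then 1 else 0)"
        using ij c(2) by (auto simp: orth_sum orth_sum' iso_sum w_sum)
      finally show "(mat_adjoint F * F) $$ (i, j) = 1\<^sub>m (Suc e) $$ (i, j)"
        using ij by simp
    qed (use F in auto)
    fix u :: "complex Matrix.vec" assume u: "u \<in> carrier_vec (Suc e)"
    define v where "v = vec e (\<lambda>i. u $ i)"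
    have v: "v \<in> carrier_vec e" by (simp add: v_def)
    have "F *\<^sub>v u = E *\<^sub>v v + (u $ e * c) \<cdot>\<^sub>v w"
    proof (rule eq_vecI)
      fix i assume "i < dim_vec (E *\<^sub>v v + (u $ e * c) \<cdot>\<^sub>v w)"
      then have i: "i < d" using w by simp
      have "(F *\<^sub>v u) $ i = (\<Sum>k<Suc e. F $$ (i, k) * u $ k)"
        using F u i by (intro mat_mult_vec_index) auto
      also have "\<dots> = (\<Sum>k<e. E $$ (i, k) * v $ k) + u $ e * c * w $ i"
        using i by (simp add: F_def v_def)
      also have "(\<Sum>k<e. E $$ (i, k) * v $ k) = (E *\<^sub>v v) $ i"
        using E v i by (intro mat_mult_vec_index[symmetric]) auto
      finally show "(F *\<^sub>v u) $ i = (E *\<^sub>v v + (u $ e * c) \<cdot>\<^sub>v w) $ i"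
        using i w E by simp
    qed (use F E w in auto)
    then show "\<exists>v\<in>carrier_vec e. \<exists>c. F *\<^sub>v u = E *\<^sub>v v + c \<cdot>\<^sub>v w"
      using v by blast
  qed (fact F)
qed

text \<open>The columns of \<open>E\<close> are an orthonormal basis of \<open>W\<close>, found as
  an orthonormal frame in \<open>W\<close> of maximal size; \<open>isometry_dim_le\<close> bounds
  the size. Encoding a subspace by an isometry turns invariance and orthogonality into matrix
  identities.\<close>

lemma subspace_isometry:
  assumes W: "VectorSpace.subspace class_ring W (module_vec TYPE(complex) d)"
  obtains e E where "e \<le> d" "E \<in> carrier_mat d e" "mat_adjoint E * E = 1\<^sub>m e"
    "\<And>u. u \<in> carrier_vec e \<Longrightarrow> E *\<^sub>v u \<in> W"
    "\<And>w. w \<in> W \<Longrightarrow> E *\<^sub>v (mat_adjoint E *\<^sub>v w) = w"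
proof -
  note WD = subspace_vecD[OF W]
  define Q where "Q e \<longleftrightarrow> (\<exists>E. E \<in> carrier_mat d e \<and> mat_adjoint E * E = (1\<^sub>m e :: complex mat) \<and>
    (\<forall>u\<in>carrier_vec e. E *\<^sub>v u \<in> W))" for e
  \<comment> \<open>The empty frame, a matrix without columns, starts the search for the largest
    one.\<close>
  have "Q 0"
    unfolding Q_def
  proof (intro exI conjI ballI)
    show "0\<^sub>m d 0 \<in> carrier_mat d 0" by simp
    show "mat_adjoint (0\<^sub>m d 0) * 0\<^sub>m d 0 = (1\<^sub>m 0 :: complex mat)"
      by (rule eq_matI) auto
    fix u :: "complex Matrix.vec" assume "u \<in> carrier_vec 0"
    then have "0\<^sub>m d 0 *\<^sub>v u = 0\<^sub>v d" by (intro eq_vecI) (auto simp: scalar_prod_def)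
    then show "0\<^sub>m d 0 *\<^sub>v u \<in> W" using WD(2) by simp
  qed
  moreover have bound: "\<forall>e. Q e \<longrightarrow> e \<le> d"
    unfolding Q_def using isometry_dim_le by blast
  ultimately have Qm: "Q (Greatest Q)" and max: "\<And>e. Q e \<Longrightarrow> e \<le> Greatest Q"
    by (metis GreatestI_nat, metis Greatest_le_nat bound)
  define e where "e = Greatest Q"
  obtain E where E: "E \<in> carrier_mat d e" "mat_adjoint E * E = 1\<^sub>m e"
      "\<And>u. u \<in> carrier_vec e \<Longrightarrow> E *\<^sub>v u \<in> W"
    using Qm unfolding Q_def e_def by blast
  have "E *\<^sub>v (mat_adjoint E *\<^sub>v w) = w" if w: "w \<in> W" for w
  proof (rule ccontr)
    assume neq: "E *\<^sub>v (mat_adjoint E *\<^sub>v w) \<noteq> w"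
    have wc: "w \<in> carrier_vec d" using w WD(1) by auto
    have Ew: "mat_adjoint E *\<^sub>v w \<in> carrier_vec e"
      using mult_mat_vec_carrier[OF mat_adjoint_carrier[OF E(1)] wc] .
    \<comment> \<open>The component of \<open>w\<close> orthogonal to the range of \<open>E\<close>.
      It lies in \<open>W\<close>, so if it were nonzero it would extend the maximal frame.\<close>
    define z where "z = w + (-1) \<cdot>\<^sub>v (E *\<^sub>v (mat_adjoint E *\<^sub>v w))"
    have EEw: "E *\<^sub>v (mat_adjoint E *\<^sub>v w) \<in> carrier_vec d"
      using E(1) Ew by simp
    have zW: "z \<in> W"
      unfolding z_def using w E(3)[OF Ew] WD(3,4) by blast
    then have zc: "z \<in> carrier_vec d" using WD(1) by blast
    have znz: "z \<noteq> 0\<^sub>v d"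
    proof
      assume "z = 0\<^sub>v d"
      then have "\<And>i. i < d \<Longrightarrow> z $ i = 0" by simp
      then have "\<And>i. i < d \<Longrightarrow> w $ i = (E *\<^sub>v (mat_adjoint E *\<^sub>v w)) $ i"
        using wc EEw E(1) unfolding z_def by (simp add: )
      then have "E *\<^sub>v (mat_adjoint E *\<^sub>v w) = w"
        using wc EEw E(1) by (intro eq_vecI) auto
      then show False using neq by simp
    qed
    have "mat_adjoint E *\<^sub>v (E *\<^sub>v (mat_adjoint E *\<^sub>v w)) = mat_adjoint E * E *\<^sub>v (mat_adjoint E *\<^sub>v w)"
      using E(1) Ew by (intro assoc_mult_mat_vec[symmetric]) auto
    also have "\<dots> = mat_adjoint E *\<^sub>v w" using E(2) Ew by simp
    finally have "mat_adjoint E *\<^sub>v z = mat_adjoint E *\<^sub>v w + (-1) \<cdot>\<^sub>v (mat_adjoint E *\<^sub>v w)"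
      unfolding z_def using wc EEw E(1)
      by (simp add: mult_add_distrib_mat_vec[of _ e d] mult_mat_vec[of _ e d])
    also have "\<dots> = 0\<^sub>v e"
    proof (rule eq_vecI)
      fix i assume "i < dim_vec (0\<^sub>v e :: complex Matrix.vec)"
      then show "(mat_adjoint E *\<^sub>v w + - 1 \<cdot>\<^sub>v (mat_adjoint E *\<^sub>v w)) $ i = 0\<^sub>v e $ i"
        using carrier_vecD[OF Ew] carrier_matD[OF E(1)] by simp
    qed (use E(1) in simp)
    finally have orth: "mat_adjoint E *\<^sub>v z = 0\<^sub>v e" .
    obtain F where F: "F \<in> carrier_mat d (Suc e)" "mat_adjoint F * F = 1\<^sub>m (Suc e)"
      and Fr: "\<And>u. u \<in> carrier_vec (Suc e) \<Longrightarrow> \<exists>v\<in>carrier_vec e. \<exists>c. F *\<^sub>v u = E *\<^sub>v v + c \<cdot>\<^sub>v z"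
      using isometry_append[OF E(1,2) zc orth znz] by metis
    have "Q (Suc e)"
      unfolding Q_def using F Fr E(3) zW WD(3,4) by metis
    then show False using max[of "Suc e"] by (simp add: e_def)
  qed
  then show ?thesis
    using that[OF isometry_dim_le[OF E(1,2)] E] by blast
qed

section \<open>Unitary representations and Schur orthogonality\<close>

lemma borel_measurable_cnj [measurable]:
  "f \<in> borel_measurable M \<Longrightarrow> (\<lambda>x. cnj (f x)) \<in> borel_measurable M"
  by (rule borel_measurable_continuous_on[where f = cnj]) (auto intro: continuous_intros)

section \<open>Haar integration and translation invariance\<close>

locale haar_group = topological_group +
  fixes \<mu> :: "'a measure"
  assumes haar: "normalized_haar_measure G T \<mu>"

sublocale haar_group \<subseteq> prob_space \<mu>
  using haar by (simp add: normalized_haar_measure_def)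

context haar_group
begin

lemma space_haar [simp]: "space \<mu> = carrier G"
  using haar by (simp add: normalized_haar_measure_def)

lemma sets_haar: "sets \<mu> = sigma_sets (carrier G) {U. openin T U}"
  using haar by (simp add: normalized_haar_measure_def)

lemma openin_subset_carrier: "openin T U \<Longrightarrow> U \<subseteq> carrier G"
  using openin_subset topspace_eq by blast

lemma openin_sets: "openin T U \<Longrightarrow> U \<in> sets \<mu>"
  by (auto simp: sets_haar)

lemma continuous_map_borel_measurable:
  fixes f :: "'a \<Rightarrow> 'd :: topological_space"
  assumes "continuous_map T euclidean f"
  shows "f \<in> borel_measurable \<mu>"
proof (rule borel_measurableI)
  fix U :: "'d set" assume "open U"
  then have "openin T {x \<in> topspace T. f x \<in> U}"
    using assms by (simp add: continuous_map_def)
  moreover have "f -` U \<inter> space \<mu> = {x \<in> topspace T. f x \<in> U}"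
    by (auto simp: topspace_eq)
  ultimately show "f -` U \<inter> space \<mu> \<in> sets \<mu>"
    using openin_sets by simp
qed

lemma continuous_map_mult2:
  assumes "continuous_map X T f" "continuous_map X T g"
  shows "continuous_map X T (\<lambda>x. f x \<otimes> g x)"
proof -
  have "continuous_map X (prod_topology T T) (\<lambda>x. (f x, g x))"
    using assms by (simp add: continuous_map_paired)
  from continuous_map_compose[OF this continuous_mult] show ?thesis
    by (simp add: o_def)
qed

lemma continuous_map_translate:
  assumes "a \<in> carrier G" "b \<in> carrier G"
  shows "continuous_map T T (\<lambda>x. a \<otimes> x \<otimes> b)"
  using assms by (intro continuous_map_mult2) (auto simp: topspace_eq)

lemma continuous_map_left_translate:
  assumes "a \<in> carrier G"
  shows "continuous_map T T (\<lambda>x. a \<otimes> x)"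
  using assms by (intro continuous_map_mult2) (auto simp: topspace_eq)

lemma translate_measurable [measurable]:
  assumes "a \<in> carrier G"
  shows "(\<lambda>x. a \<otimes> x) \<in> measurable \<mu> \<mu>"
proof (rule measurable_sigma_sets[OF sets_haar])
  show "{U. openin T U} \<subseteq> Pow (carrier G)"
    using openin_subset_carrier by auto
  show "(\<lambda>x. a \<otimes> x) \<in> space \<mu> \<rightarrow> carrier G"
    using assms by auto
  fix U assume "U \<in> {U. openin T U}"
  then have "openin T {x \<in> topspace T. a \<otimes> x \<in> U}"
    using continuous_map_left_translate[OF assms] by (simp add: continuous_map_def)
  moreover have "(\<lambda>x. a \<otimes> x) -` U \<inter> space \<mu> = {x \<in> topspace T. a \<otimes> x \<in> U}"
    by (auto simp: topspace_eq)
  ultimately show "(\<lambda>x. a \<otimes> x) -` U \<inter> space \<mu> \<in> sets \<mu>"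
    using openin_sets by simp
qed

lemma distr_translate:
  assumes a: "a \<in> carrier G"
  shows "distr \<mu> \<mu> (\<lambda>x. a \<otimes> x) = \<mu>"
proof (rule measure_eqI)
  fix A assume "A \<in> sets (distr \<mu> \<mu> (\<lambda>x. a \<otimes> x))"
  then have A: "A \<in> sets \<mu>" by simp
  then have Ac: "A \<subseteq> carrier G" using sets.sets_into_space by force
  have "(\<lambda>x. a \<otimes> x) -` A \<inter> space \<mu> = (\<lambda>x. inv a \<otimes> x) ` A"
  proof (intro equalityI subsetI)
    fix x assume "x \<in> (\<lambda>x. a \<otimes> x) -` A \<inter> space \<mu>"
    then show "x \<in> (\<lambda>x. inv a \<otimes> x) ` A"
      using a by (intro image_eqI[of _ _ "a \<otimes> x"]) (auto simp: m_assoc[symmetric])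
  next
    fix y assume "y \<in> (\<lambda>x. inv a \<otimes> x) ` A"
    then show "y \<in> (\<lambda>x. a \<otimes> x) -` A \<inter> space \<mu>"
      using a Ac by (auto simp: m_assoc[symmetric])
  qed
  then show "emeasure (distr \<mu> \<mu> (\<lambda>x. a \<otimes> x)) A = emeasure \<mu> A"
    using a A haar by (simp add: emeasure_distr normalized_haar_measure_def)
qed simp

lemma integral_translate:
  fixes f :: "'a \<Rightarrow> 'd :: {banach, second_countable_topology}"
  assumes "a \<in> carrier G" "f \<in> borel_measurable \<mu>"
  shows "(\<integral>x. f (a \<otimes> x) \<partial>\<mu>) = (\<integral>x. f x \<partial>\<mu>)"
  using integral_distr[OF translate_measurable[OF assms(1)] assms(2)]
  by (simp add: distr_translate[OF assms(1)])

lemma integrable_translate: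
  fixes f :: "'a \<Rightarrow> 'd :: {banach, second_countable_topology}"
  assumes "a \<in> carrier G" "integrable \<mu> f"
  shows "integrable \<mu> (\<lambda>x. f (a \<otimes> x))"
  using integrable_distr[OF translate_measurable[OF assms(1)], of f] assms
  by (simp add: distr_translate)

text \<open>The total mass is one, so \<open>1 + (cmod (f x))\<^sup>2\<close> is an integrable
  majorant of \<open>cmod (f x)\<close>, by \<open>0 \<le> (cmod (f x) - 1)\<^sup>2\<close>.\<close>

lemma L2_integrable:
  assumes "f \<in> L2 \<mu>"
  shows "integrable \<mu> f"
proof (rule Bochner_Integration.integrable_bound)
  show "integrable \<mu> (\<lambda>x. 1 + (cmod (f x))\<^sup>2)"
    using assms by (simp add: L2_def)
  show "f \<in> borel_measurable \<mu>"
    using assms by (simp add: L2_def)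
  show "AE x in \<mu>. norm (f x) \<le> norm (1 + (cmod (f x))\<^sup>2)"
  proof (rule AE_I2)
    fix x
    have "0 \<le> (cmod (f x) - 1)\<^sup>2" by simp
    then have "2 * cmod (f x) \<le> 1 + (cmod (f x))\<^sup>2"
      by (simp add: power2_eq_square algebra_simps)
    then show "norm (f x) \<le> norm (1 + (cmod (f x))\<^sup>2)"
      by (simp add: abs_of_nonneg add_nonneg_nonneg) (smt (verit) norm_ge_zero)
  qed
qed

lemma L2_measurable [measurable_dest]: "f \<in> L2 \<mu> \<Longrightarrow> f \<in> borel_measurable \<mu>"
  by (simp add: L2_def)

lemma integrable_times_bounded:
  fixes f g :: "'a \<Rightarrow> complex"
  assumes "integrable \<mu> f" "g \<in> borel_measurable \<mu>" "\<And>x. x \<in> carrier G \<Longrightarrow> cmod (g x) \<le> B"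
  shows "integrable \<mu> (\<lambda>x. f x * g x)"
proof (rule Bochner_Integration.integrable_bound)
  show "integrable \<mu> (\<lambda>x. B * norm (f x))"
    using assms by auto
  show "(\<lambda>x. f x * g x) \<in> borel_measurable \<mu>"
    using assms by measurable
  have "norm (f x * g x) \<le> norm (B * norm (f x))" if "x \<in> carrier G" for x
    using mult_right_mono[OF assms(3)[OF that], of "norm (f x)"]
    by (simp add: norm_mult abs_mult mult.commute) (smt (verit) mult_right_mono norm_ge_zero)
  then show "AE x in \<mu>. norm (f x * g x) \<le> norm (B * norm (f x))"
    by (intro AE_I2) simp
qed

lemma bounded_L2:
  assumes [measurable]: "g \<in> borel_measurable \<mu>" and "\<And>x. x \<in> carrier G \<Longrightarrow> cmod (g x) \<le> B"
  shows "g \<in> L2 \<mu>"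
proof -
  have "integrable \<mu> (\<lambda>x. (cmod (g x))\<^sup>2)"
  proof (rule integrable_const_bound[where B = "B\<^sup>2"])
    show "AE x in \<mu>. norm ((cmod (g x))\<^sup>2) \<le> B\<^sup>2"
      using assms(2) by (intro AE_I2) (auto simp: power_mono)
  qed measurable
  then show ?thesis by (simp add: L2_def)
qed

section \<open>Unitary representations and their matrix coefficients\<close>

lemma unitary_rep_unitary: "\<pi> \<in> unitary_reps G T \<Longrightarrow> x \<in> carrier G \<Longrightarrow> unitary_mat (rep_dim G \<pi>) (\<pi> x)"
  by (simp add: unitary_reps_def)

lemma unitary_rep_carrier:
  "\<pi> \<in> unitary_reps G T \<Longrightarrow> x \<in> carrier G \<Longrightarrow> \<pi> x \<in> carrier_mat (rep_dim G \<pi>) (rep_dim G \<pi>)"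
  using unitary_rep_unitary unitary_mat_carrier by blast

lemma unitary_rep_mult:
  "\<pi> \<in> unitary_reps G T \<Longrightarrow> x \<in> carrier G \<Longrightarrow> y \<in> carrier G \<Longrightarrow> \<pi> (x \<otimes> y) = \<pi> x * \<pi> y"
  by (simp add: unitary_reps_def)

text \<open>Multiplicativity makes the value at \<open>\<one>\<close> idempotent, and cancelling one
  factor with its adjoint leaves the identity matrix.\<close>

lemma unitary_rep_one:
  assumes "\<pi> \<in> unitary_reps G T"
  shows "\<pi> \<one> = 1\<^sub>m (rep_dim G \<pi>)"
proof -
  have c: "\<pi> \<one> \<in> carrier_mat (rep_dim G \<pi>) (rep_dim G \<pi>)"
    using unitary_rep_carrier[OF assms] by simp
  have u: "mat_adjoint (\<pi> \<one>) * \<pi> \<one> = 1\<^sub>m (rep_dim G \<pi>)"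
    using unitary_rep_unitary[OF assms] by (simp add: unitary_mat_def)
  have "\<pi> \<one> = mat_adjoint (\<pi> \<one>) * \<pi> \<one> * \<pi> \<one>"
    unfolding u using c by simp
  also have "\<dots> = mat_adjoint (\<pi> \<one>) * (\<pi> \<one> * \<pi> \<one>)"
    using c by (meson assoc_mult_mat mat_adjoint_carrier)
  also have "\<pi> \<one> * \<pi> \<one> = \<pi> \<one>"
    using unitary_rep_mult[OF assms, of \<one> \<one>] by simp
  finally show ?thesis using u by simp
qed

lemma unitary_rep_inv:
  assumes "\<pi> \<in> unitary_reps G T" and x: "x \<in> carrier G"
  shows "\<pi> (inv x) = mat_adjoint (\<pi> x)"
proof -
  let ?d = "rep_dim G \<pi>"
  have c: "\<pi> x \<in> carrier_mat ?d ?d" "\<pi> (inv x) \<in> carrier_mat ?d ?d"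
    using unitary_rep_carrier[OF assms(1)] x by auto
  have u: "mat_adjoint (\<pi> x) * \<pi> x = 1\<^sub>m ?d"
    using unitary_rep_unitary[OF assms(1) x] by (simp add: unitary_mat_def)
  have "\<pi> (inv x) = mat_adjoint (\<pi> x) * \<pi> x * \<pi> (inv x)"
    unfolding u using c by simp
  also have "\<dots> = mat_adjoint (\<pi> x) * (\<pi> x * \<pi> (inv x))"
    using c by (meson assoc_mult_mat mat_adjoint_carrier)
  also have "\<pi> x * \<pi> (inv x) = 1\<^sub>m ?d"
    using unitary_rep_mult[OF assms(1), of x "inv x"] x unitary_rep_one[OF assms(1)] by simp
  also have "mat_adjoint (\<pi> x) * 1\<^sub>m ?d = mat_adjoint (\<pi> x)"
    using c by (meson right_mult_one_mat mat_adjoint_carrier)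
  finally show ?thesis .
qed

lemma unitary_rep_mult_index:
  assumes "\<pi> \<in> unitary_reps G T" "x \<in> carrier G" "y \<in> carrier G" "i < rep_dim G \<pi>" "j < rep_dim G \<pi>"
  shows "\<pi> (x \<otimes> y) $$ (i, j) = (\<Sum>k<rep_dim G \<pi>. \<pi> x $$ (i, k) * \<pi> y $$ (k, j))"
  using assms by (simp only: unitary_rep_mult)
    (intro mat_mult_index, auto intro: unitary_rep_carrier)

lemma unitary_rep_inv_index:
  assumes "\<pi> \<in> unitary_reps G T" "x \<in> carrier G" "i < rep_dim G \<pi>" "j < rep_dim G \<pi>"
  shows "\<pi> (inv x) $$ (i, j) = cnj (\<pi> x $$ (j, i))"
  using assms unitary_rep_carrier[OF assms(1,2)] by (simp add: unitary_rep_inv)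

lemma unitary_rep_entry_le_1:
  "\<pi> \<in> unitary_reps G T \<Longrightarrow> x \<in> carrier G \<Longrightarrow> i < rep_dim G \<pi> \<Longrightarrow> j < rep_dim G \<pi> \<Longrightarrow>
    cmod (\<pi> x $$ (i, j)) \<le> 1"
  using unitary_rep_unitary unitary_mat_entry_le_1 by blast

lemma unitary_rep_measurable [measurable]:
  "\<pi> \<in> unitary_reps G T \<Longrightarrow> i < rep_dim G \<pi> \<Longrightarrow> j < rep_dim G \<pi> \<Longrightarrow>
    (\<lambda>x. \<pi> x $$ (i, j)) \<in> borel_measurable \<mu>"
  by (rule continuous_map_borel_measurable) (simp add: unitary_reps_def)

lemma unitary_rep_L2:
  "\<pi> \<in> unitary_reps G T \<Longrightarrow> i < rep_dim G \<pi> \<Longrightarrow> j < rep_dim G \<pi> \<Longrightarrow> (\<lambda>x. \<pi> x $$ (i, j)) \<in> L2 \<mu>"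
  using unitary_rep_entry_le_1 by (intro bounded_L2[where B = 1]) auto

lemma integrable_times_rep:
  assumes "integrable \<mu> f" "\<pi> \<in> unitary_reps G T" "i < rep_dim G \<pi>" "j < rep_dim G \<pi>"
  shows "integrable \<mu> (\<lambda>x. f x * cnj (\<pi> x $$ (i, j)))"
  using assms unitary_rep_entry_le_1[OF assms(2)]
  by (intro integrable_times_bounded[where B = 1]) auto

lemma integrable_rep_entries:
  assumes "\<pi> \<in> unitary_reps G T" "i < rep_dim G \<pi>" "j < rep_dim G \<pi>"
    "\<sigma> \<in> unitary_reps G T" "a < rep_dim G \<sigma>" "b < rep_dim G \<sigma>"
  shows "integrable \<mu> (\<lambda>x. \<sigma> x $$ (a, b) * cnj (\<pi> x $$ (i, j)))"
  using assms by (intro integrable_times_rep L2_integrable unitary_rep_L2)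

lemma fourier_coeff_index:
  assumes "\<pi> \<in> unitary_reps G T" "i < rep_dim G \<pi>" "j < rep_dim G \<pi>"
  shows "fourier_coeff G \<mu> f \<pi> $$ (i, j) = (\<integral>x. f x * cnj (\<pi> x $$ (j, i)) \<partial>\<mu>)"
proof -
  have "mat_adjoint (\<pi> x) $$ (i, j) = cnj (\<pi> x $$ (j, i))" if "x \<in> carrier G" for x
    using unitary_rep_carrier[OF assms(1) that] assms by simp
  then show ?thesis
    using assms by (auto simp: fourier_coeff_def intro!: Bochner_Integration.integral_cong)
qed

section \<open>Schur's lemma\<close>

lemma irreducible_unitary: "\<xi> \<in> irreducible_reps G T \<Longrightarrow> \<xi> \<in> unitary_reps G T"
  and irreducible_dim_pos: "\<xi> \<in> irreducible_reps G T \<Longrightarrow> rep_dim G \<xi> > 0"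
  by (simp_all add: irreducible_reps_def)

text \<open>Over the complex numbers \<open>B\<close> has an eigenvalue. Its eigenspace is invariant
  because \<open>B\<close> commutes with the representation, and it is not zero, so by
  irreducibility it is the whole space.\<close>

lemma schur_scalar:
  assumes xi: "\<xi> \<in> irreducible_reps G T" and B: "B \<in> carrier_mat (rep_dim G \<xi>) (rep_dim G \<xi>)"
    and comm: "\<And>x. x \<in> carrier G \<Longrightarrow> \<xi> x * B = B * \<xi> x"
  obtains c where "B = c \<cdot>\<^sub>m 1\<^sub>m (rep_dim G \<xi>)"
proof -
  let ?d = "rep_dim G \<xi>"
  note u = irreducible_unitary[OF xi]
  have "degree (char_poly B) = ?d" using degree_monic_char_poly[OF B] by simp
  then have "\<not> constant (poly (char_poly B))"
    using irreducible_dim_pos[OF xi] by (simp add: constant_degree)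
  then obtain c where "poly (char_poly B) c = 0"
    using fundamental_theorem_of_algebra by blast
  then have "eigenvalue B c" using eigenvalue_root_char_poly[OF B] by simp
  then obtain v where v: "v \<in> carrier_vec ?d" "v \<noteq> 0\<^sub>v ?d" "B *\<^sub>v v = c \<cdot>\<^sub>v v"
    using B by (auto simp: eigenvalue_def eigenvector_def)
  define W where "W = {w \<in> carrier_vec ?d. B *\<^sub>v w = c \<cdot>\<^sub>v w}"
  have "VectorSpace.subspace class_ring W (module_vec TYPE(complex) ?d)"
  proof (rule subspace_vecI)
    show "0\<^sub>v ?d \<in> W"
      using B by (auto simp: W_def intro!: eq_vecI)
  next
    fix v w assume "v \<in> W" "w \<in> W"
    then show "v + w \<in> W"
      using B by (auto simp: W_def mult_add_distrib_mat_vec smult_add_distrib_vec)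
  next
    fix k v assume "v \<in> W"
    then show "k \<cdot>\<^sub>v v \<in> W"
      using B by (auto simp: W_def mult_mat_vec smult_smult_assoc mult.commute)
  qed (auto simp: W_def)
  moreover have "\<xi> x *\<^sub>v w \<in> W" if x: "x \<in> carrier G" and w: "w \<in> W" for x w
  proof -
    have xc: "\<xi> x \<in> carrier_mat ?d ?d" by (rule unitary_rep_carrier[OF u x])
    have wc: "w \<in> carrier_vec ?d" "B *\<^sub>v w = c \<cdot>\<^sub>v w" using w by (auto simp: W_def)
    have "B *\<^sub>v (\<xi> x *\<^sub>v w) = B * \<xi> x *\<^sub>v w" using B xc wc by simp
    also have "\<dots> = \<xi> x * B *\<^sub>v w" using comm[OF x] by simp
    also have "\<dots> = \<xi> x *\<^sub>v (c \<cdot>\<^sub>v w)" using B xc wc by simp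
    also have "\<dots> = c \<cdot>\<^sub>v (\<xi> x *\<^sub>v w)" using xc wc by (simp add: mult_mat_vec)
    finally show ?thesis using xc wc by (simp add: W_def)
  qed
  ultimately have "W = {0\<^sub>v ?d} \<or> W = carrier_vec ?d"
    using xi by (simp add: irreducible_reps_def)
  then have W: "W = carrier_vec ?d" using v by (auto simp: W_def)
  have "B = c \<cdot>\<^sub>m 1\<^sub>m ?d"
  proof (rule mat_eq_vecI[OF B])
    fix u :: "complex Matrix.vec" assume u: "u \<in> carrier_vec ?d"
    then have "B *\<^sub>v u = c \<cdot>\<^sub>v u" using W by (auto simp: W_def)
    also have "\<dots> = (c \<cdot>\<^sub>m 1\<^sub>m ?d) *\<^sub>v u"
      using u by (intro eq_vecI) (auto simp: scalar_prod_smult_left)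
    finally show "B *\<^sub>v u = (c \<cdot>\<^sub>m 1\<^sub>m ?d) *\<^sub>v u" .
  qed simp
  then show ?thesis using that by blast
qed

text \<open>Instead of studying kernel and image of \<open>A\<close>, both products of
  \<open>A\<close> with its adjoint are shown to be scalar by \<open>schur_scalar\<close>. The
  scalars agree and are positive, the traces force equal dimensions, and \<open>A\<close> divided by
  the square root of the scalar is the required unitary matrix.\<close>

lemma schur_intertwiner:
  assumes xi: "\<xi> \<in> irreducible_reps G T" and si: "\<sigma> \<in> irreducible_reps G T"
    and A: "A \<in> carrier_mat (rep_dim G \<xi>) (rep_dim G \<sigma>)"
    and inter: "\<And>x. x \<in> carrier G \<Longrightarrow> \<xi> x * A = A * \<sigma> x"
    and nz: "A \<noteq> 0\<^sub>m (rep_dim G \<xi>) (rep_dim G \<sigma>)"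
  shows "(\<sigma>, \<xi>) \<in> rep_equiv G T"
proof -
  let ?d = "rep_dim G \<xi>" and ?e = "rep_dim G \<sigma>" and ?A = "mat_adjoint A"
  note xu = irreducible_unitary[OF xi] and su = irreducible_unitary[OF si]
  have A': "?A \<in> carrier_mat ?e ?d" using A by simp
  have inter': "?A * \<xi> x = \<sigma> x * ?A" if x: "x \<in> carrier G" for x
  proof -
    have c: "\<xi> (inv x) \<in> carrier_mat ?d ?d" "\<sigma> (inv x) \<in> carrier_mat ?e ?e"
      using x xu su by (auto intro: unitary_rep_carrier)
    have "?A * \<xi> x = mat_adjoint (\<xi> (inv x) * A)"
      using mat_adjoint_mult[OF c(1) A] unitary_rep_inv[OF xu, of "inv x"] x by simp
    also have "\<dots> = mat_adjoint (A * \<sigma> (inv x))" using inter[of "inv x"] x by simp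
    also have "\<dots> = \<sigma> x * ?A"
      using mat_adjoint_mult[OF A c(2)] unitary_rep_inv[OF su, of "inv x"] x by simp
    finally show ?thesis .
  qed
  have comm: "\<sigma> x * (?A * A) = (?A * A) * \<sigma> x" if x: "x \<in> carrier G" for x
  proof -
    note c = unitary_rep_carrier[OF xu x] unitary_rep_carrier[OF su x]
    have "\<sigma> x * (?A * A) = (\<sigma> x * ?A) * A" by (rule assoc_mult_mat[OF c(2) A' A, symmetric])
    also have "\<dots> = ?A * (\<xi> x * A)"
      unfolding inter'[OF x, symmetric] by (rule assoc_mult_mat[OF A' c(1) A])
    also have "\<dots> = (?A * A) * \<sigma> x"
      unfolding inter[OF x] by (rule assoc_mult_mat[OF A' A c(2), symmetric])
    finally show ?thesis .
  qed
  obtain c where c: "?A * A = c \<cdot>\<^sub>m 1\<^sub>m ?e"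
    by (rule schur_scalar[OF si mult_carrier_mat[OF A' A] comm])
  have comm': "\<xi> x * (A * ?A) = (A * ?A) * \<xi> x" if x: "x \<in> carrier G" for x
  proof -
    note c = unitary_rep_carrier[OF xu x] unitary_rep_carrier[OF su x]
    have "\<xi> x * (A * ?A) = (\<xi> x * A) * ?A" by (rule assoc_mult_mat[OF c(1) A A', symmetric])
    also have "\<dots> = A * (\<sigma> x * ?A)"
      unfolding inter[OF x] by (rule assoc_mult_mat[OF A c(2) A'])
    also have "\<dots> = (A * ?A) * \<xi> x"
      unfolding inter'[OF x, symmetric] by (rule assoc_mult_mat[OF A A' c(1), symmetric])
    finally show ?thesis .
  qed
  obtain c' where c': "A * ?A = c' \<cdot>\<^sub>m 1\<^sub>m ?d"
    by (rule schur_scalar[OF xi mult_carrier_mat[OF A A'] comm'])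
  obtain i0 j0 where ij0: "i0 < ?d" "j0 < ?e" "A $$ (i0, j0) \<noteq> 0"
    using nz A by (auto simp: mat_eq_iff)
  \<comment> \<open>Computing the triple product \<open>A * ?A * A\<close> with either bracketing
    identifies the two scalars, since \<open>A\<close> has a nonzero entry.\<close>
  have "c \<cdot>\<^sub>m A = A * (?A * A)" unfolding c using A by (simp add: mat_smult_right)
  also have "\<dots> = (A * ?A) * A" using A by (simp add: mat_assoc)
  also have "\<dots> = c' \<cdot>\<^sub>m A" unfolding c' using A by (simp add: mat_smult_left)
  finally have "(c \<cdot>\<^sub>m A) $$ (i0, j0) = (c' \<cdot>\<^sub>m A) $$ (i0, j0)" by simp
  then have cc: "c' = c" using ij0 A by simp
  have colsum: "complex_of_real (\<Sum>i<?d. (cmod (A $$ (i, j)))\<^sup>2) = c" if j: "j < ?e" for j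
  proof -
    have "(?A * A) $$ (j, j) = (\<Sum>i<?d. ?A $$ (j, i) * A $$ (i, j))"
      using A A' j by (intro mat_mult_index) auto
    also have "\<dots> = of_real (\<Sum>i<?d. (cmod (A $$ (i, j)))\<^sup>2)"
      using A j by (simp add: complex_norm_square mult.commute del: of_real_power)
    finally show ?thesis using j by (simp add: c)
  qed
  define r where "r = (\<Sum>i<?d. (cmod (A $$ (i, j0)))\<^sup>2)"
  have r: "r > 0" "c = of_real r"
    unfolding r_def using ij0 colsum[OF ij0(2)] by (auto intro!: sum_pos2[of _ i0])
  have rowsum: "(\<Sum>j<?e. A $$ (i, j) * cnj (A $$ (i, j))) = c" if i: "i < ?d" for i
  proof -
    have "(A * ?A) $$ (i, i) = (\<Sum>j<?e. A $$ (i, j) * ?A $$ (j, i))"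
      using A A' i by (intro mat_mult_index) auto
    then show ?thesis using i A by (simp add: c' cc)
  qed
  \<comment> \<open>Both sides are the sum of all squared entries of \<open>A\<close>, taken once by
    columns and once by rows.\<close>
  have "of_nat ?e * c = (\<Sum>j<?e. \<Sum>i<?d. A $$ (i, j) * cnj (A $$ (i, j)))"
    using colsum by (simp add: complex_norm_square del: of_real_power)
  also have "\<dots> = (\<Sum>i<?d. \<Sum>j<?e. A $$ (i, j) * cnj (A $$ (i, j)))"
    by (rule sum.swap)
  also have "\<dots> = of_nat ?d * c"
    using rowsum by simp
  finally have ed: "?e = ?d" using r by simp
  define U where "U = complex_of_real (1 / sqrt r) \<cdot>\<^sub>m A"
  have U: "U \<in> carrier_mat ?d ?d" using A ed by (simp add: U_def)
  have adjU: "mat_adjoint U = complex_of_real (1 / sqrt r) \<cdot>\<^sub>m ?A"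
    using A by (intro eq_matI) (auto simp: U_def)
  have "mat_adjoint U * U = (complex_of_real (1 / sqrt r) * complex_of_real (1 / sqrt r)) \<cdot>\<^sub>m (?A * A)"
    unfolding adjU unfolding U_def using A
    by (simp add: mat_smult_left mat_smult_right) (intro eq_matI; simp)
  also have "\<dots> = 1\<^sub>m ?d"
    using r by (simp add: c ed flip: of_real_mult) (intro eq_matI; simp)
  finally have "unitary_mat ?e U" using U ed by (simp add: unitary_mat_def)
  moreover have "U * \<sigma> x = \<xi> x * U" if x: "x \<in> carrier G" for x
    using inter[OF x] A unitary_rep_carrier[OF xu x] unitary_rep_carrier[OF su x]
    by (simp add: U_def mat_smult_left mat_smult_right)
  ultimately show ?thesis
    using xi si ed by (auto simp: rep_equiv_def)
qed

section \<open>Equivalence classes and chosen representatives\<close>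

lemma rep_equiv_refl:
  assumes "\<xi> \<in> irreducible_reps G T"
  shows "(\<xi>, \<xi>) \<in> rep_equiv G T"
proof -
  have "unitary_mat (rep_dim G \<xi>) (1\<^sub>m (rep_dim G \<xi>))" by (simp add: unitary_mat_def)
  moreover have "1\<^sub>m (rep_dim G \<xi>) * \<xi> x = \<xi> x * 1\<^sub>m (rep_dim G \<xi>)" if "x \<in> carrier G" for x
    using unitary_rep_carrier[OF irreducible_unitary[OF assms] that] by simp
  ultimately show ?thesis using assms by (auto simp: rep_equiv_def)
qed

lemma rep_equiv_conj:
  assumes "(\<pi>, \<rho>) \<in> rep_equiv G T"
  obtains U where "unitary_mat (rep_dim G \<pi>) U"
    "\<And>x. x \<in> carrier G \<Longrightarrow> \<rho> x = U * \<pi> x * mat_adjoint U"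
proof -
  obtain U where U: "unitary_mat (rep_dim G \<pi>) U" "\<And>x. x \<in> carrier G \<Longrightarrow> U * \<pi> x = \<rho> x * U"
    and d: "rep_dim G \<pi> = rep_dim G \<rho>" and r: "\<rho> \<in> irreducible_reps G T"
    using assms unfolding rep_equiv_def by blast
  have "\<rho> x = U * \<pi> x * mat_adjoint U" if x: "x \<in> carrier G" for x
  proof -
    have r: "\<rho> x \<in> carrier_mat (rep_dim G \<pi>) (rep_dim G \<pi>)"
      using unitary_rep_carrier[OF irreducible_unitary[OF r] x] d by simp
    have "\<rho> x = \<rho> x * (U * mat_adjoint U)"
      unfolding unitary_mat_right[OF U(1)] using r by simp
    also have "\<dots> = U * \<pi> x * mat_adjoint U"
      unfolding U(2)[OF x] using r unitary_mat_carrier[OF U(1)] by (simp add: mat_assoc)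
    finally show ?thesis .
  qed
  then show ?thesis using that U by blast
qed

lemma rep_equiv_sym:
  assumes "(\<pi>, \<rho>) \<in> rep_equiv G T"
  shows "(\<rho>, \<pi>) \<in> rep_equiv G T"
proof -
  let ?d = "rep_dim G \<pi>"
  have i: "\<pi> \<in> irreducible_reps G T" "\<rho> \<in> irreducible_reps G T" "rep_dim G \<rho> = ?d"
    using assms by (auto simp: rep_equiv_def)
  obtain U where U: "unitary_mat ?d U" "\<And>x. x \<in> carrier G \<Longrightarrow> \<rho> x = U * \<pi> x * mat_adjoint U"
    using rep_equiv_conj[OF assms] by blast
  have Uc: "U \<in> carrier_mat ?d ?d" "mat_adjoint U \<in> carrier_mat ?d ?d" "mat_adjoint U * U = 1\<^sub>m ?d"
    using U(1) by (auto simp: unitary_mat_def)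
  have "mat_adjoint U * \<rho> x = \<pi> x * mat_adjoint U" if x: "x \<in> carrier G" for x
  proof -
    have p: "\<pi> x \<in> carrier_mat ?d ?d" using unitary_rep_carrier[OF irreducible_unitary[OF i(1)] x] .
    have "mat_adjoint U * \<rho> x = mat_adjoint U * (U * (\<pi> x * mat_adjoint U))"
      unfolding U(2)[OF x] using Uc p by (simp add: mat_assoc)
    also have "\<dots> = (mat_adjoint U * U) * (\<pi> x * mat_adjoint U)"
      using Uc(1,2) p by (simp add: mat_assoc)
    also have "\<dots> = \<pi> x * mat_adjoint U" using Uc p by simp
    finally show ?thesis .
  qed
  then show ?thesis
    using i unitary_mat_adjoint[OF U(1)] by (auto simp: rep_equiv_def)
qed

lemma rep_equiv_trans:
  assumes "(\<pi>, \<rho>) \<in> rep_equiv G T" "(\<rho>, \<tau>) \<in> rep_equiv G T"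
  shows "(\<pi>, \<tau>) \<in> rep_equiv G T"
proof -
  let ?d = "rep_dim G \<pi>"
  have i: "\<pi> \<in> irreducible_reps G T" "\<rho> \<in> irreducible_reps G T" "\<tau> \<in> irreducible_reps G T"
      "rep_dim G \<rho> = ?d" "rep_dim G \<tau> = ?d"
    using assms by (auto simp: rep_equiv_def)
  obtain U where U: "unitary_mat ?d U" "\<And>x. x \<in> carrier G \<Longrightarrow> U * \<pi> x = \<rho> x * U"
    using assms(1) unfolding rep_equiv_def by blast
  obtain V where V: "unitary_mat ?d V" "\<And>x. x \<in> carrier G \<Longrightarrow> V * \<rho> x = \<tau> x * V"
    using assms(2) i(4) unfolding rep_equiv_def by auto
  have "V * U * \<pi> x = \<tau> x * (V * U)" if x: "x \<in> carrier G" for x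
  proof -
    have c: "\<pi> x \<in> carrier_mat ?d ?d" "\<rho> x \<in> carrier_mat ?d ?d" "\<tau> x \<in> carrier_mat ?d ?d"
      using unitary_rep_carrier[OF irreducible_unitary _] x i by metis+
    note cc = c unitary_mat_carrier[OF U(1)] unitary_mat_carrier[OF V(1)]
    have "V * U * \<pi> x = V * (U * \<pi> x)" using cc by (simp add: mat_assoc)
    also have "\<dots> = V * \<rho> x * U"
      unfolding U(2)[OF x] using cc by (simp add: mat_assoc)
    also have "\<dots> = \<tau> x * (V * U)"
      unfolding V(2)[OF x] using cc by (simp add: mat_assoc)
    finally show ?thesis .
  qed
  then show ?thesis
    using i unitary_mat_mult[OF V(1) U(1)] by (auto simp: rep_equiv_def)
qed

lemma equiv_rep_equiv: "equiv (irreducible_reps G T) (rep_equiv G T)"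
proof (rule equivI)
  show "rep_equiv G T \<subseteq> irreducible_reps G T \<times> irreducible_reps G T"
    by (auto simp: rep_equiv_def)
  show "refl_on (irreducible_reps G T) (rep_equiv G T)"
    using rep_equiv_refl by (auto simp: refl_on_def rep_equiv_def)
  show "sym (rep_equiv G T)" using rep_equiv_sym by (auto intro: symI)
  show "trans (rep_equiv G T)" using rep_equiv_trans by (auto intro: transI)
qed

lemma representative_in: "c \<in> unitary_dual G T \<Longrightarrow> representative c \<in> c"
  unfolding unitary_dual_def representative_def
  using in_quotient_imp_non_empty[OF equiv_rep_equiv] by (simp add: some_in_eq)

lemma representative_irreducible: "c \<in> unitary_dual G T \<Longrightarrow> representative c \<in> irreducible_reps G T"
  using representative_in in_quotient_imp_subset[OF equiv_rep_equiv]
  by (auto simp: unitary_dual_def)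

lemma representative_eqI:
  assumes "c \<in> unitary_dual G T" "c' \<in> unitary_dual G T"
    "(representative c, representative c') \<in> rep_equiv G T"
  shows "c = c'"
  using quotient_eqI[OF equiv_rep_equiv _ _ representative_in representative_in] assms
  by (auto simp: unitary_dual_def)

lemma irreducible_representative:
  assumes "\<xi> \<in> irreducible_reps G T"
  obtains c where "c \<in> unitary_dual G T" "(representative c, \<xi>) \<in> rep_equiv G T"
proof
  let ?c = "rep_equiv G T `` {\<xi>}"
  show c: "?c \<in> unitary_dual G T"
    using assms by (auto simp: unitary_dual_def intro: quotientI)
  show "(representative ?c, \<xi>) \<in> rep_equiv G T"
    using representative_in[OF c] rep_equiv_sym by auto
qed

text \<open>\<open>A\<close> is the Haar average of
  \<open>\<xi> x * M * mat_adjoint (\<sigma> x)\<close>, where \<open>M\<close> is the matrix unit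
  with its single \<open>1\<close> at \<open>(a, b)\<close>. Left invariance of the average is the
  intertwining relation.\<close>

lemma matrix_coefficient_intertwiner:
  assumes xi: "\<xi> \<in> unitary_reps G T" and si: "\<sigma> \<in> unitary_reps G T"
    and ab: "a < rep_dim G \<xi>" "b < rep_dim G \<sigma>" and y: "y \<in> carrier G"
  defines "A \<equiv> Matrix.mat (rep_dim G \<xi>) (rep_dim G \<sigma>)
    (\<lambda>(i, j). \<integral>x. \<xi> x $$ (i, a) * cnj (\<sigma> x $$ (j, b)) \<partial>\<mu>)"
  shows "\<xi> y * A = A * \<sigma> y"
proof -
  let ?d = "rep_dim G \<xi>" and ?e = "rep_dim G \<sigma>"
  have A: "A \<in> carrier_mat ?d ?e" by (simp add: A_def)
  have c: "\<xi> y \<in> carrier_mat ?d ?d" "\<sigma> y \<in> carrier_mat ?e ?e"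
    using unitary_rep_carrier xi si y by auto
  show ?thesis
  proof (rule eq_matI)
    fix i j assume "i < dim_row (A * \<sigma> y)" "j < dim_col (A * \<sigma> y)"
    then have ij: "i < ?d" "j < ?e" using A c by auto
    have "(\<xi> y * A) $$ (i, j) = (\<Sum>k<?d. \<xi> y $$ (i, k) * A $$ (k, j))"
      using A c ij by (intro mat_mult_index) auto
    also have "\<dots> = (\<Sum>k<?d. \<integral>x. \<xi> y $$ (i, k) * (\<xi> x $$ (k, a) * cnj (\<sigma> x $$ (j, b))) \<partial>\<mu>)"
      using ij by (simp add: A_def)
    also have "\<dots> = (\<integral>x. (\<Sum>k<?d. \<xi> y $$ (i, k) * (\<xi> x $$ (k, a) * cnj (\<sigma> x $$ (j, b)))) \<partial>\<mu>)"
      using ij ab xi si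
      by (intro Bochner_Integration.integral_sum[symmetric] integrable_mult_right integrable_rep_entries) auto
    also have "\<dots> = (\<integral>x. \<xi> (y \<otimes> x) $$ (i, a) * cnj (\<sigma> x $$ (j, b)) \<partial>\<mu>)"
      using y ij ab xi by (intro Bochner_Integration.integral_cong)
        (auto simp: unitary_rep_mult_index sum_distrib_right mult.assoc)
    \<comment> \<open>Substituting \<open>inv y \<otimes> x\<close> for \<open>x\<close> moves
      \<open>y\<close> from \<xi> to \<sigma>, where unitarity turns the inverse into an adjoint and
      thus produces a factor on the right of \<open>A\<close>.\<close>
    also have "\<dots> = (\<integral>x. \<xi> (y \<otimes> (inv y \<otimes> x)) $$ (i, a) * cnj (\<sigma> (inv y \<otimes> x) $$ (j, b)) \<partial>\<mu>)"
    proof (rule integral_translate[symmetric])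
      have [measurable]: "(\<lambda>x. \<xi> (y \<otimes> x) $$ (i, a)) \<in> borel_measurable \<mu>"
        using measurable_compose[OF translate_measurable unitary_rep_measurable] y xi ij ab by auto
      show "(\<lambda>x. \<xi> (y \<otimes> x) $$ (i, a) * cnj (\<sigma> x $$ (j, b))) \<in> borel_measurable \<mu>"
        using si ij ab by measurable
    qed (use y in auto)
    also have "\<dots> = (\<integral>x. (\<Sum>k<?e. (\<xi> x $$ (i, a) * cnj (\<sigma> x $$ (k, b))) * \<sigma> y $$ (k, j)) \<partial>\<mu>)"
    proof (intro Bochner_Integration.integral_cong refl)
      fix x assume "x \<in> space \<mu>"
      then have x: "x \<in> carrier G" by simp
      have "y \<otimes> (inv y \<otimes> x) = x" using x y by (simp add: m_assoc[symmetric])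
      moreover have "cnj (\<sigma> (inv y \<otimes> x) $$ (j, b)) = (\<Sum>k<?e. \<sigma> y $$ (k, j) * cnj (\<sigma> x $$ (k, b)))"
        using x y ij ab si by (simp add: unitary_rep_mult_index unitary_rep_inv_index)
      ultimately show "\<xi> (y \<otimes> (inv y \<otimes> x)) $$ (i, a) * cnj (\<sigma> (inv y \<otimes> x) $$ (j, b))
        = (\<Sum>k<?e. (\<xi> x $$ (i, a) * cnj (\<sigma> x $$ (k, b))) * \<sigma> y $$ (k, j))"
        by (simp add: sum_distrib_left mult_ac)
    qed
    also have "\<dots> = (\<Sum>k<?e. \<integral>x. (\<xi> x $$ (i, a) * cnj (\<sigma> x $$ (k, b))) * \<sigma> y $$ (k, j) \<partial>\<mu>)"
      using ij ab xi si
      by (intro Bochner_Integration.integral_sum integrable_mult_left integrable_rep_entries) auto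
    also have "\<dots> = (\<Sum>k<?e. A $$ (i, k) * \<sigma> y $$ (k, j))"
      using ij by (simp add: A_def)
    also have "\<dots> = (A * \<sigma> y) $$ (i, j)"
      using A c ij by (intro mat_mult_index[symmetric]) auto
    finally show "(\<xi> y * A) $$ (i, j) = (A * \<sigma> y) $$ (i, j)" .
  qed (use A c in auto)
qed

lemma schur_orthogonality_inequivalent:
  assumes xi: "\<xi> \<in> irreducible_reps G T" and si: "\<sigma> \<in> irreducible_reps G T"
    and ne: "(\<sigma>, \<xi>) \<notin> rep_equiv G T"
    and idx: "i < rep_dim G \<xi>" "a < rep_dim G \<xi>" "j < rep_dim G \<sigma>" "b < rep_dim G \<sigma>"
  shows "(\<integral>x. \<xi> x $$ (i, a) * cnj (\<sigma> x $$ (j, b)) \<partial>\<mu>) = 0"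
proof -
  define A where "A = Matrix.mat (rep_dim G \<xi>) (rep_dim G \<sigma>)
    (\<lambda>(i, j). \<integral>x. \<xi> x $$ (i, a) * cnj (\<sigma> x $$ (j, b)) \<partial>\<mu>)"
  have "A \<in> carrier_mat (rep_dim G \<xi>) (rep_dim G \<sigma>)" by (simp add: A_def)
  moreover have "\<xi> x * A = A * \<sigma> x" if "x \<in> carrier G" for x
    unfolding A_def using irreducible_unitary[OF xi] irreducible_unitary[OF si] idx(2,4) that
    by (rule matrix_coefficient_intertwiner)
  ultimately have "A = 0\<^sub>m (rep_dim G \<xi>) (rep_dim G \<sigma>)"
    using schur_intertwiner[OF xi si] ne by blast
  then have "A $$ (i, j) = 0" using idx by simp
  then show ?thesis using idx by (simp add: A_def)
qed

text \<open>The averaged matrix unit is now a scalar matrix, and its trace determines the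
  scalar.\<close>

lemma schur_orthogonality:
  assumes xi: "\<xi> \<in> irreducible_reps G T"
    and idx: "i < rep_dim G \<xi>" "a < rep_dim G \<xi>" "j < rep_dim G \<xi>" "b < rep_dim G \<xi>"
  shows "(\<integral>x. \<xi> x $$ (i, a) * cnj (\<xi> x $$ (j, b)) \<partial>\<mu>)
    = (if i = j \<and> a = b then 1 / of_nat (rep_dim G \<xi>) else 0)"
proof -
  let ?d = "rep_dim G \<xi>"
  note u = irreducible_unitary[OF xi]
  define A where "A = Matrix.mat ?d ?d (\<lambda>(i, j). \<integral>x. \<xi> x $$ (i, a) * cnj (\<xi> x $$ (j, b)) \<partial>\<mu>)"
  have "A \<in> carrier_mat ?d ?d" by (simp add: A_def)
  moreover have "\<xi> x * A = A * \<xi> x" if "x \<in> carrier G" for x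
    unfolding A_def using u u idx(2,4) that by (rule matrix_coefficient_intertwiner)
  ultimately obtain c where c: "A = c \<cdot>\<^sub>m 1\<^sub>m ?d"
    using schur_scalar[OF xi] by blast
  \<comment> \<open>Under the integral the trace is the inner product of columns \<open>a\<close>
    and \<open>b\<close> of a unitary matrix, which does not depend on \<open>x\<close>.\<close>
  have "of_nat ?d * c = (\<Sum>k<?d. A $$ (k, k))" by (simp add: c)
  also have "\<dots> = (\<integral>x. (\<Sum>k<?d. \<xi> x $$ (k, a) * cnj (\<xi> x $$ (k, b))) \<partial>\<mu>)"
    using idx u by (subst Bochner_Integration.integral_sum) (auto simp: A_def intro!: integrable_rep_entries)
  also have "\<dots> = (\<integral>x. (if a = b then 1 else 0) \<partial>\<mu>)"
    using idx unitary_mat_columns[OF unitary_rep_unitary[OF u], of _ b a]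
    by (intro Bochner_Integration.integral_cong) (auto simp: mult.commute)
  also have "\<dots> = (if a = b then 1 else 0)"
    using prob_space by simp
  finally have "c = (if a = b then 1 / of_nat ?d else 0)"
    using irreducible_dim_pos[OF xi] by (auto simp: field_simps split: if_splits)
  moreover have "A $$ (i, j) = (if i = j then c else 0)" using c idx by simp
  ultimately show ?thesis using idx by (auto simp: A_def)
qed

end

section \<open>Complete reducibility\<close>

context haar_group
begin

text \<open>The hypothesis \<open>inv\<close> says that the projection
  \<open>E * mat_adjoint E\<close> fixes the columns of \<open>\<pi> x * E\<close>, that is, that
  the range of \<open>E\<close> is invariant. This is what makes the compression to the range
  multiplicative.\<close>

lemma subrepresentation:
  assumes pi: "\<pi> \<in> unitary_reps G T" and E: "E \<in> carrier_mat (rep_dim G \<pi>) e"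
    and iso: "mat_adjoint E * E = 1\<^sub>m e"
    and inv: "\<And>x. x \<in> carrier G \<Longrightarrow> E * (mat_adjoint E * (\<pi> x * E)) = \<pi> x * E"
  shows "(\<lambda>x. mat_adjoint E * \<pi> x * E) \<in> unitary_reps G T"
    and "rep_dim G (\<lambda>x. mat_adjoint E * \<pi> x * E) = e"
    and "x \<in> carrier G \<Longrightarrow> E * (mat_adjoint E * \<pi> x * E) = \<pi> x * E"
proof -
  let ?d = "rep_dim G \<pi>"
  let ?\<sigma> = "\<lambda>x. mat_adjoint E * \<pi> x * E"
  have E': "mat_adjoint E \<in> carrier_mat e ?d" using E by simp
  show dim: "rep_dim G ?\<sigma> = e" using E by (simp add: rep_dim_def)
  note c = unitary_rep_carrier[OF pi]
  have s_carrier: "?\<sigma> x \<in> carrier_mat e e" if "x \<in> carrier G" for x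
    by (rule mult_carrier_mat[OF mult_carrier_mat[OF E' c[OF that]] E])
  show "E * ?\<sigma> x = \<pi> x * E" if "x \<in> carrier G" for x
    using inv[OF that] c[OF that] E by (simp add: mat_assoc)
  have mult: "?\<sigma> (x \<otimes> y) = ?\<sigma> x * ?\<sigma> y" if x: "x \<in> carrier G" and y: "y \<in> carrier G" for x y
  proof -
    have "?\<sigma> x * ?\<sigma> y = mat_adjoint E * (\<pi> x * (E * (mat_adjoint E * (\<pi> y * E))))"
      using c[OF x] c[OF y] E by (simp add: mat_assoc)
    also have "\<dots> = mat_adjoint E * (\<pi> x * (\<pi> y * E))" by (simp only: inv[OF y])
    also have "\<dots> = ?\<sigma> (x \<otimes> y)"
      unfolding unitary_rep_mult[OF pi x y] using c[OF x] c[OF y] E by (simp add: mat_assoc)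
    finally show ?thesis by simp
  qed
  have unit: "unitary_mat e (?\<sigma> x)" if x: "x \<in> carrier G" for x
  proof -
    have ix: "inv x \<in> carrier G" using x by simp
    have "mat_adjoint (?\<sigma> x) = mat_adjoint E * (\<pi> (inv x) * E)"
      using mat_adjoint_mult[OF mult_carrier_mat[OF E' c[OF x]] E] mat_adjoint_mult[OF E' c[OF x]]
        unitary_rep_inv[OF pi x] by simp
    also have "\<dots> = ?\<sigma> (inv x)" using c[OF ix] E by (simp add: mat_assoc)
    finally have "mat_adjoint (?\<sigma> x) * ?\<sigma> x = ?\<sigma> \<one>"
      using mult[OF ix x] x by simp
    also have "\<dots> = 1\<^sub>m e"
      unfolding unitary_rep_one[OF pi] using E iso by simp
    finally show ?thesis using s_carrier[OF x] by (simp add: unitary_mat_def)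
  qed
  have cont: "continuous_map T euclidean (\<lambda>x. ?\<sigma> x $$ (i, j))" if ij: "i < e" "j < e" for i j
  proof -
    have "continuous_map T euclidean
      (\<lambda>x. \<Sum>a<?d. \<Sum>b<?d. mat_adjoint E $$ (i, a) * \<pi> x $$ (a, b) * cnj (mat_adjoint E $$ (j, b)))"
    proof (intro continuous_map_sum)
      fix a b assume ab: "a \<in> {..<?d}" "b \<in> {..<?d}"
      then have "continuous_map T euclidean (\<lambda>x. \<pi> x $$ (a, b))"
        using pi by (simp add: unitary_reps_def)
      then have "continuous_map T euclidean ((\<lambda>z. mat_adjoint E $$ (i, a) * z * cnj (mat_adjoint E $$ (j, b))) \<circ> (\<lambda>x. \<pi> x $$ (a, b)))"
        by (rule continuous_map_compose) (auto intro!: continuous_intros)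
      then show "continuous_map T euclidean (\<lambda>x. mat_adjoint E $$ (i, a) * \<pi> x $$ (a, b) * cnj (mat_adjoint E $$ (j, b)))"
        by (simp add: o_def)
    qed auto
    then show ?thesis
    proof (rule continuous_map_eq)
      fix x assume "x \<in> topspace T"
      then have x: "x \<in> carrier G" by (simp add: topspace_eq)
      show "(\<Sum>a<?d. \<Sum>b<?d. mat_adjoint E $$ (i, a) * \<pi> x $$ (a, b) * cnj (mat_adjoint E $$ (j, b))) = ?\<sigma> x $$ (i, j)"
        using mat_triple_index[OF E' c[OF x] E' ij] by simp
    qed
  qed
  show "?\<sigma> \<in> unitary_reps G T"
    using mult unit cont by (simp add: unitary_reps_def dim)
qed

lemma isometry_invariant:
  assumes pi: "\<pi> \<in> unitary_reps G T" and E: "E \<in> carrier_mat (rep_dim G \<pi>) e" and x: "x \<in> carrier G"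
    and inv: "\<And>w. w \<in> W \<Longrightarrow> \<pi> x *\<^sub>v w \<in> W"
    and EW: "\<And>u. u \<in> carrier_vec e \<Longrightarrow> E *\<^sub>v u \<in> W"
    and fixed: "\<And>w. w \<in> W \<Longrightarrow> E *\<^sub>v (mat_adjoint E *\<^sub>v w) = w"
  shows "E * (mat_adjoint E * (\<pi> x * E)) = \<pi> x * E"
proof (rule mat_eq_vecI)
  note c = unitary_rep_carrier[OF pi x] and E' = mat_adjoint_carrier[OF E]
  show "\<pi> x * E \<in> carrier_mat (rep_dim G \<pi>) e" by (rule mult_carrier_mat[OF c E])
  then show "E * (mat_adjoint E * (\<pi> x * E)) \<in> carrier_mat (rep_dim G \<pi>) e"
    by (intro mult_carrier_mat[OF E] mult_carrier_mat[OF E'])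
  fix u :: "complex Matrix.vec" assume u: "u \<in> carrier_vec e"
  have "E * (mat_adjoint E * (\<pi> x * E)) *\<^sub>v u = E *\<^sub>v (mat_adjoint E *\<^sub>v (\<pi> x *\<^sub>v (E *\<^sub>v u)))"
    using u E c by (simp add: mat_vec_assoc)
  also have "\<dots> = \<pi> x *\<^sub>v (E *\<^sub>v u)" by (rule fixed[OF inv[OF EW[OF u]]])
  finally show "E * (mat_adjoint E * (\<pi> x * E)) *\<^sub>v u = \<pi> x * E *\<^sub>v u"
    using u E c by (simp add: mat_vec_assoc)
qed

text \<open>The summands are the compressions to an invariant subspace and to its orthogonal
  complement. The strict drop in dimension on both sides is what the induction in
  \<open>complete_reducibility\<close> feeds on.\<close>

lemma reducible_split:
  assumes pi: "\<pi> \<in> unitary_reps G T" and pos: "rep_dim G \<pi> > 0" and red: "\<pi> \<notin> irreducible_reps G T"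
  obtains \<sigma> \<sigma>' E E' where "\<sigma> \<in> unitary_reps G T" "\<sigma>' \<in> unitary_reps G T"
    "rep_dim G \<sigma> < rep_dim G \<pi>" "rep_dim G \<sigma>' < rep_dim G \<pi>"
    "E \<in> carrier_mat (rep_dim G \<pi>) (rep_dim G \<sigma>)" "E' \<in> carrier_mat (rep_dim G \<pi>) (rep_dim G \<sigma>')"
    "\<And>x. x \<in> carrier G \<Longrightarrow> \<pi> x = E * \<sigma> x * mat_adjoint E + E' * \<sigma>' x * mat_adjoint E'"
proof -
  let ?d = "rep_dim G \<pi>"
  note c = unitary_rep_carrier[OF pi]
  obtain W where W: "VectorSpace.subspace class_ring W (module_vec TYPE(complex) ?d)"
    and Winv: "\<And>x w. x \<in> carrier G \<Longrightarrow> w \<in> W \<Longrightarrow> \<pi> x *\<^sub>v w \<in> W"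
    and W0: "W \<noteq> {0\<^sub>v ?d}" and W1: "W \<noteq> carrier_vec ?d"
    using pi pos red unfolding irreducible_reps_def by blast
  note WD = subspace_vecD[OF W]
  obtain e E where ed: "e \<le> ?d" and E: "E \<in> carrier_mat ?d e" and iso: "mat_adjoint E * E = 1\<^sub>m e"
    and EW: "\<And>u. u \<in> carrier_vec e \<Longrightarrow> E *\<^sub>v u \<in> W"
    and Efix: "\<And>w. w \<in> W \<Longrightarrow> E *\<^sub>v (mat_adjoint E *\<^sub>v w) = w"
    using subspace_isometry[OF W] by metis
  have Ea: "mat_adjoint E \<in> carrier_mat e ?d" using E by simp
  have Einv: "E * (mat_adjoint E * (\<pi> x * E)) = \<pi> x * E" if "x \<in> carrier G" for x
    by (rule isometry_invariant[OF pi E that Winv[OF that] EW Efix])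
  \<comment> \<open>The orthogonal complement of \<open>W\<close>, as the columns of
    \<open>E\<close> are an orthonormal basis of \<open>W\<close>.\<close>
  define W' where "W' = {v \<in> carrier_vec ?d. mat_adjoint E *\<^sub>v v = 0\<^sub>v e}"
  have W': "VectorSpace.subspace class_ring W' (module_vec TYPE(complex) ?d)"
  proof (rule subspace_vecI)
    show "0\<^sub>v ?d \<in> W'" using mat_vec_zero[OF Ea] by (simp add: W'_def)
  next
    fix v w assume "v \<in> W'" "w \<in> W'"
    then show "v + w \<in> W'" using Ea by (auto simp: W'_def mult_add_distrib_mat_vec)
  next
    fix k v assume "v \<in> W'"
    then show "k \<cdot>\<^sub>v v \<in> W'" using Ea by (auto simp: W'_def mult_mat_vec)
  qed (auto simp: W'_def)
  obtain e' E' where ed': "e' \<le> ?d" and E': "E' \<in> carrier_mat ?d e'" and iso': "mat_adjoint E' * E' = 1\<^sub>m e'"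
    and EW': "\<And>u. u \<in> carrier_vec e' \<Longrightarrow> E' *\<^sub>v u \<in> W'"
    and Efix': "\<And>w. w \<in> W' \<Longrightarrow> E' *\<^sub>v (mat_adjoint E' *\<^sub>v w) = w"
    using subspace_isometry[OF W'] by metis
  have Ea': "mat_adjoint E' \<in> carrier_mat e' ?d" using E' by simp
  have Winv': "\<pi> x *\<^sub>v w \<in> W'" if x: "x \<in> carrier G" and w: "w \<in> W'" for x w
  proof -
    have wc: "w \<in> carrier_vec ?d" "mat_adjoint E *\<^sub>v w = 0\<^sub>v e" using w by (auto simp: W'_def)
    have ix: "inv x \<in> carrier G" using x by simp
    define N where "N = mat_adjoint E * (\<pi> (inv x) * E)"
    have N: "N \<in> carrier_mat e e" unfolding N_def by (rule mult_carrier_mat[OF Ea mult_carrier_mat[OF c[OF ix] E]])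
    \<comment> \<open>Invariance of \<open>W\<close> under \<open>inv x\<close>, after taking
      adjoints, shows that \<open>\<pi> x\<close> maps the kernel of \<open>mat_adjoint E\<close>
      into itself.\<close>
    have "mat_adjoint E * \<pi> x = mat_adjoint (\<pi> (inv x) * E)"
      using mat_adjoint_mult[OF c[OF ix] E] unitary_rep_inv[OF pi x] by simp
    also have "\<dots> = mat_adjoint (E * N)" using Einv[OF ix] by (simp add: N_def)
    also have "\<dots> = mat_adjoint N * mat_adjoint E" by (rule mat_adjoint_mult[OF E N])
    finally have eq: "mat_adjoint E * \<pi> x = mat_adjoint N * mat_adjoint E" .
    have "mat_adjoint E *\<^sub>v (\<pi> x *\<^sub>v w) = mat_adjoint E * \<pi> x *\<^sub>v w"
      by (rule assoc_mult_mat_vec[OF Ea c[OF x] wc(1), symmetric])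
    also have "\<dots> = mat_adjoint N *\<^sub>v (mat_adjoint E *\<^sub>v w)"
      unfolding eq by (rule assoc_mult_mat_vec[OF mat_adjoint_carrier[OF N] Ea wc(1)])
    also have "\<dots> = 0\<^sub>v e" unfolding wc by (rule mat_vec_zero[OF mat_adjoint_carrier[OF N]])
    finally show ?thesis using wc c[OF x] by (simp add: W'_def)
  qed
  have Einv': "E' * (mat_adjoint E' * (\<pi> x * E')) = \<pi> x * E'" if "x \<in> carrier G" for x
    by (rule isometry_invariant[OF pi E' that Winv'[OF that] EW' Efix'])
  have orth: "mat_adjoint E * E' = 0\<^sub>m e e'"
  proof (rule mat_eq_vecI)
    fix u :: "complex Matrix.vec" assume u: "u \<in> carrier_vec e'"
    have "mat_adjoint E * E' *\<^sub>v u = mat_adjoint E *\<^sub>v (E' *\<^sub>v u)"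
      by (rule assoc_mult_mat_vec[OF Ea E' u])
    also have "\<dots> = 0\<^sub>v e" using EW'[OF u] by (simp add: W'_def)
    finally show "mat_adjoint E * E' *\<^sub>v u = 0\<^sub>m e e' *\<^sub>v u" using u by (simp add: zero_mat_vec)
  qed (use Ea E' in auto)
  have "mat_adjoint (mat_adjoint E * E') = mat_adjoint E' * E"
    using mat_adjoint_mult[OF Ea E'] by simp
  moreover have "mat_adjoint (0\<^sub>m e e' :: complex mat) = 0\<^sub>m e' e"
    by (rule eq_matI) auto
  ultimately have orth': "mat_adjoint E' * E = 0\<^sub>m e' e" unfolding orth by simp
  \<comment> \<open>The two projections resolve the identity: what the first one leaves of
    \<open>v\<close> lies in \<open>W'\<close> and is therefore fixed by the second.\<close>
  have sum1: "E * mat_adjoint E + E' * mat_adjoint E' = 1\<^sub>m ?d"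
  proof (rule mat_eq_vecI)
    fix v :: "complex Matrix.vec" assume v: "v \<in> carrier_vec ?d"
    define y where "y = E *\<^sub>v (mat_adjoint E *\<^sub>v v)"
    have Ev: "mat_adjoint E *\<^sub>v v \<in> carrier_vec e" by (rule mult_mat_vec_carrier[OF Ea v])
    have y: "y \<in> carrier_vec ?d" unfolding y_def by (rule mult_mat_vec_carrier[OF E Ev])
    have Ey: "mat_adjoint E *\<^sub>v y = mat_adjoint E *\<^sub>v v"
      unfolding y_def using assoc_mult_mat_vec[OF Ea E Ev] iso Ev by simp
    have Ey': "mat_adjoint E' *\<^sub>v y = 0\<^sub>v e'"
      unfolding y_def using assoc_mult_mat_vec[OF Ea' E Ev] zero_mat_vec[OF Ev, of e'] orth' by simp
    have "mat_adjoint E *\<^sub>v (v - y) = 0\<^sub>v e"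
      using mult_minus_distrib_mat_vec[OF Ea v y] Ey Ev by simp
    then have "v - y \<in> W'" using v y by (simp add: W'_def)
    then have "E' *\<^sub>v (mat_adjoint E' *\<^sub>v (v - y)) = v - y" by (rule Efix')
    moreover have "mat_adjoint E' *\<^sub>v (v - y) = mat_adjoint E' *\<^sub>v v"
      using mult_minus_distrib_mat_vec[OF Ea' v y] Ey' mult_mat_vec_carrier[OF Ea' v] by simp
    ultimately have "E' *\<^sub>v (mat_adjoint E' *\<^sub>v v) = v - y" by simp
    moreover have "(E * mat_adjoint E + E' * mat_adjoint E') *\<^sub>v v
      = E *\<^sub>v (mat_adjoint E *\<^sub>v v) + E' *\<^sub>v (mat_adjoint E' *\<^sub>v v)"
      using add_mult_distrib_mat_vec[OF mult_carrier_mat[OF E Ea] mult_carrier_mat[OF E' Ea'] v]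
        assoc_mult_mat_vec[OF E Ea v] assoc_mult_mat_vec[OF E' Ea' v] by simp
    moreover have "y + (v - y) = v"
    proof (rule eq_vecI)
      fix i assume "i < dim_vec v"
      then show "(y + (v - y)) $ i = v $ i" using carrier_vecD[OF v] carrier_vecD[OF y] by simp
    qed (use carrier_vecD[OF v] carrier_vecD[OF y] in simp)
    ultimately show "(E * mat_adjoint E + E' * mat_adjoint E') *\<^sub>v v = 1\<^sub>m ?d *\<^sub>v v"
      using v by (simp add: y_def)
  qed (use E E' Ea Ea' in auto)
  \<comment> \<open>A square isometry is onto. So full dimension of the first frame would make
    \<open>W\<close> the whole space, and full dimension of the second would make \<open>W'\<close>
    the whole space and hence \<open>W\<close> zero.\<close>
  have surj: "w \<in> range_set" if F: "F \<in> carrier_mat ?d ?d" "mat_adjoint F * F = 1\<^sub>m ?d"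
    and r: "\<And>u. u \<in> carrier_vec ?d \<Longrightarrow> F *\<^sub>v u \<in> range_set" and w: "w \<in> carrier_vec ?d"
    for F :: "complex mat" and range_set w
  proof -
    have "F * mat_adjoint F = 1\<^sub>m ?d"
      using F mat_mult_left_right_inverse mat_adjoint_carrier by blast
    then have "F *\<^sub>v (mat_adjoint F *\<^sub>v w) = w"
      using assoc_mult_mat_vec[OF F(1) mat_adjoint_carrier[OF F(1)] w] w by simp
    then show ?thesis
      using r[OF mult_mat_vec_carrier[OF mat_adjoint_carrier[OF F(1)] w]] by simp
  qed
  have "e \<noteq> ?d"
    using surj[of E W] E iso EW W1 WD(1) by blast
  with ed have lt: "e < ?d" by simp
  have "e' \<noteq> ?d"
  proof
    assume eq: "e' = ?d"
    have "w = 0\<^sub>v ?d" if w: "w \<in> W" for w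
    proof -
      have "w \<in> W'" using surj[of E' W' w] E' iso' EW' eq w WD(1) by blast
      then have "mat_adjoint E *\<^sub>v w = 0\<^sub>v e" by (simp add: W'_def)
      then have "w = E *\<^sub>v 0\<^sub>v e" using Efix[OF w] by simp
      also have "\<dots> = 0\<^sub>v ?d" by (rule mat_vec_zero[OF E])
      finally show ?thesis .
    qed
    then show False using W0 WD(2) by blast
  qed
  with ed' have lt': "e' < ?d" by simp
  have sub: "(\<lambda>x. mat_adjoint E * \<pi> x * E) \<in> unitary_reps G T"
    "rep_dim G (\<lambda>x. mat_adjoint E * \<pi> x * E) = e"
    "x \<in> carrier G \<Longrightarrow> E * (mat_adjoint E * \<pi> x * E) = \<pi> x * E" for x
    using subrepresentation[OF pi E iso] Einv by blast+
  have sub': "(\<lambda>x. mat_adjoint E' * \<pi> x * E') \<in> unitary_reps G T"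
    "rep_dim G (\<lambda>x. mat_adjoint E' * \<pi> x * E') = e'"
    "x \<in> carrier G \<Longrightarrow> E' * (mat_adjoint E' * \<pi> x * E') = \<pi> x * E'" for x
    using subrepresentation[OF pi E' iso'] Einv' by blast+
  show ?thesis
  proof (rule that[of "\<lambda>x. mat_adjoint E * \<pi> x * E" "\<lambda>x. mat_adjoint E' * \<pi> x * E'" E E'])
    fix x assume x: "x \<in> carrier G"
    have "\<pi> x = \<pi> x * (E * mat_adjoint E + E' * mat_adjoint E')"
      unfolding sum1 using c[OF x] by simp
    also have "\<dots> = \<pi> x * (E * mat_adjoint E) + \<pi> x * (E' * mat_adjoint E')"
      by (rule mult_add_distrib_mat[OF c[OF x] mult_carrier_mat[OF E Ea] mult_carrier_mat[OF E' Ea']])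
    also have "\<dots> = \<pi> x * E * mat_adjoint E + \<pi> x * E' * mat_adjoint E'"
      using assoc_mult_mat[OF c[OF x] E Ea] assoc_mult_mat[OF c[OF x] E' Ea'] by simp
    finally show "\<pi> x = E * (mat_adjoint E * \<pi> x * E) * mat_adjoint E + E' * (mat_adjoint E' * \<pi> x * E') * mat_adjoint E'"
      by (simp only: sub(3)[OF x] sub'(3)[OF x])
  qed (use sub sub' lt lt' E E' in auto)
qed

text \<open>Orthogonality of \<open>g\<close> to the whole span of matrix coefficients of
  \<open>\<pi>\<close>. Complete reducibility is stated through this dual notion, so that no direct
  sums or multiplicities have to be recorded.\<close>

definition fourier_null :: "('a \<Rightarrow> complex) \<Rightarrow> ('a \<Rightarrow> complex mat) \<Rightarrow> bool" where
  "fourier_null g \<pi> \<longleftrightarrow>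
    (\<forall>i<rep_dim G \<pi>. \<forall>j<rep_dim G \<pi>. (\<integral>x. g x * cnj (\<pi> x $$ (i, j)) \<partial>\<mu>) = 0)"

text \<open>Entries of \<open>E * \<sigma> x * mat_adjoint E\<close> are linear combinations of
  entries of \<open>\<sigma> x\<close>. \<open>E\<close> may be rectangular, which covers both a
  unitary change of basis and the embedding of a subrepresentation.\<close>

lemma integral_conjugated_rep:
  assumes si: "\<sigma> \<in> unitary_reps G T" and E: "E \<in> carrier_mat d (rep_dim G \<sigma>)"
    and g: "integrable \<mu> g" and ij: "i < d" "j < d"
  shows "integrable \<mu> (\<lambda>x. g x * cnj ((E * \<sigma> x * mat_adjoint E) $$ (i, j)))"
    and "(\<integral>x. g x * cnj ((E * \<sigma> x * mat_adjoint E) $$ (i, j)) \<partial>\<mu>)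
      = (\<Sum>a<rep_dim G \<sigma>. \<Sum>b<rep_dim G \<sigma>.
          cnj (E $$ (i, a)) * E $$ (j, b) * (\<integral>x. g x * cnj (\<sigma> x $$ (a, b)) \<partial>\<mu>))"
proof -
  let ?e = "rep_dim G \<sigma>"
  have eq: "g x * cnj ((E * \<sigma> x * mat_adjoint E) $$ (i, j))
      = (\<Sum>a<?e. \<Sum>b<?e. cnj (E $$ (i, a)) * E $$ (j, b) * (g x * cnj (\<sigma> x $$ (a, b))))"
    if "x \<in> space \<mu>" for x
    using mat_triple_index[OF E unitary_rep_carrier[OF si, of x] E ij] that
    by (simp add: sum_distrib_left mult_ac)
  have int: "integrable \<mu> (\<lambda>x. cnj (E $$ (i, a)) * E $$ (j, b) * (g x * cnj (\<sigma> x $$ (a, b))))"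
    if "a < ?e" "b < ?e" for a b
    using that si g by (intro integrable_mult_right integrable_times_rep)
  have "integrable \<mu> (\<lambda>x. g x * cnj ((E * \<sigma> x * mat_adjoint E) $$ (i, j))) \<longleftrightarrow> integrable \<mu>
      (\<lambda>x. \<Sum>a<?e. \<Sum>b<?e. cnj (E $$ (i, a)) * E $$ (j, b) * (g x * cnj (\<sigma> x $$ (a, b))))"
    by (intro Bochner_Integration.integrable_cong refl eq)
  then show "integrable \<mu> (\<lambda>x. g x * cnj ((E * \<sigma> x * mat_adjoint E) $$ (i, j)))"
    using int by (auto intro!: Bochner_Integration.integrable_sum)
  have "(\<integral>x. g x * cnj ((E * \<sigma> x * mat_adjoint E) $$ (i, j)) \<partial>\<mu>)
      = (\<integral>x. (\<Sum>a<?e. \<Sum>b<?e. cnj (E $$ (i, a)) * E $$ (j, b) * (g x * cnj (\<sigma> x $$ (a, b)))) \<partial>\<mu>)"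
    by (intro Bochner_Integration.integral_cong refl eq)
  also have "\<dots> = (\<Sum>a<?e. \<integral>x. (\<Sum>b<?e. cnj (E $$ (i, a)) * E $$ (j, b) * (g x * cnj (\<sigma> x $$ (a, b)))) \<partial>\<mu>)"
    using int by (intro Bochner_Integration.integral_sum Bochner_Integration.integrable_sum) auto
  also have "\<dots> = (\<Sum>a<?e. \<Sum>b<?e. \<integral>x. cnj (E $$ (i, a)) * E $$ (j, b) * (g x * cnj (\<sigma> x $$ (a, b))) \<partial>\<mu>)"
    using int by (intro sum.cong refl Bochner_Integration.integral_sum) auto
  finally show "(\<integral>x. g x * cnj ((E * \<sigma> x * mat_adjoint E) $$ (i, j)) \<partial>\<mu>)
      = (\<Sum>a<?e. \<Sum>b<?e. cnj (E $$ (i, a)) * E $$ (j, b) * (\<integral>x. g x * cnj (\<sigma> x $$ (a, b)) \<partial>\<mu>))"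
    by simp
qed

lemma fourier_null_equiv:
  assumes eq: "(\<xi>, \<sigma>) \<in> rep_equiv G T" and g: "integrable \<mu> g" and null: "fourier_null g \<xi>"
  shows "fourier_null g \<sigma>"
proof -
  obtain U where U: "unitary_mat (rep_dim G \<xi>) U"
    "\<And>x. x \<in> carrier G \<Longrightarrow> \<sigma> x = U * \<xi> x * mat_adjoint U"
    using rep_equiv_conj[OF eq] by blast
  have d: "rep_dim G \<sigma> = rep_dim G \<xi>" and u: "\<xi> \<in> unitary_reps G T"
    using eq irreducible_unitary by (auto simp: rep_equiv_def)
  show ?thesis
    unfolding fourier_null_def d
  proof (intro allI impI)
    fix i j assume ij: "i < rep_dim G \<xi>" "j < rep_dim G \<xi>"
    have "(\<integral>x. g x * cnj (\<sigma> x $$ (i, j)) \<partial>\<mu>) = (\<integral>x. g x * cnj ((U * \<xi> x * mat_adjoint U) $$ (i, j)) \<partial>\<mu>)"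
      by (intro Bochner_Integration.integral_cong) (simp_all only: space_haar U(2))
    also have "\<dots> = 0"
      using null by (simp add: integral_conjugated_rep(2)[OF u unitary_mat_carrier[OF U(1)] g ij] fourier_null_def)
    finally show "(\<integral>x. g x * cnj (\<sigma> x $$ (i, j)) \<partial>\<mu>) = 0" .
  qed
qed

text \<open>Dual form of the decomposition into irreducibles: functions orthogonal to finitely many
  irreducibles are orthogonal to \<open>\<pi>\<close>. Strong induction on the dimension splits
  \<open>\<pi>\<close> by \<open>reducible_split\<close>; in dimension zero the empty set
  serves.\<close>

lemma complete_reducibility:
  assumes "\<pi> \<in> unitary_reps G T"
  shows "\<exists>\<Sigma>. finite \<Sigma> \<and> \<Sigma> \<subseteq> irreducible_reps G T \<and>
    (\<forall>g. integrable \<mu> g \<longrightarrow> (\<forall>\<sigma>\<in>\<Sigma>. fourier_null g \<sigma>) \<longrightarrow> fourier_null g \<pi>)"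
  using assms
proof (induction "rep_dim G \<pi>" arbitrary: \<pi> rule: less_induct)
  case less
  note pi = less.prems
  consider "rep_dim G \<pi> = 0" | "\<pi> \<in> irreducible_reps G T" | "rep_dim G \<pi> > 0" "\<pi> \<notin> irreducible_reps G T"
    by blast
  then show ?case
  proof cases
    case 1
    then show ?thesis by (intro exI[of _ "{}"]) (auto simp: fourier_null_def)
  next
    case 2
    then show ?thesis by (intro exI[of _ "{\<pi>}"]) auto
  next
    case 3
    obtain \<sigma> \<sigma>' E E' where s: "\<sigma> \<in> unitary_reps G T" "\<sigma>' \<in> unitary_reps G T"
      and lt: "rep_dim G \<sigma> < rep_dim G \<pi>" "rep_dim G \<sigma>' < rep_dim G \<pi>"
      and E: "E \<in> carrier_mat (rep_dim G \<pi>) (rep_dim G \<sigma>)" "E' \<in> carrier_mat (rep_dim G \<pi>) (rep_dim G \<sigma>')"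
      and dec: "\<And>x. x \<in> carrier G \<Longrightarrow> \<pi> x = E * \<sigma> x * mat_adjoint E + E' * \<sigma>' x * mat_adjoint E'"
      using reducible_split[OF pi 3] by metis
    obtain \<Sigma> where S: "finite \<Sigma>" "\<Sigma> \<subseteq> irreducible_reps G T"
      "\<And>g. integrable \<mu> g \<Longrightarrow> (\<forall>\<sigma>\<in>\<Sigma>. fourier_null g \<sigma>) \<Longrightarrow> fourier_null g \<sigma>"
      using less.hyps[OF lt(1) s(1)] by blast
    obtain \<Sigma>' where S': "finite \<Sigma>'" "\<Sigma>' \<subseteq> irreducible_reps G T"
      "\<And>g. integrable \<mu> g \<Longrightarrow> (\<forall>\<sigma>\<in>\<Sigma>'. fourier_null g \<sigma>) \<Longrightarrow> fourier_null g \<sigma>'"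
      using less.hyps[OF lt(2) s(2)] by blast
    have "fourier_null g \<pi>" if g: "integrable \<mu> g" and null: "\<forall>\<sigma>\<in>\<Sigma> \<union> \<Sigma>'. fourier_null g \<sigma>" for g
      unfolding fourier_null_def
    proof (intro allI impI)
      fix i j assume ij: "i < rep_dim G \<pi>" "j < rep_dim G \<pi>"
      have n: "fourier_null g \<sigma>" "fourier_null g \<sigma>'" using S(3) S'(3) g null by auto
      have "(\<integral>x. g x * cnj (\<pi> x $$ (i, j)) \<partial>\<mu>)
        = (\<integral>x. g x * cnj ((E * \<sigma> x * mat_adjoint E) $$ (i, j))
            + g x * cnj ((E' * \<sigma>' x * mat_adjoint E') $$ (i, j)) \<partial>\<mu>)"
      proof (intro Bochner_Integration.integral_cong refl)
        fix x assume "x \<in> space \<mu>"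
        then have x: "x \<in> carrier G" by simp
        have "\<pi> x $$ (i, j) = (E * \<sigma> x * mat_adjoint E) $$ (i, j) + (E' * \<sigma>' x * mat_adjoint E') $$ (i, j)"
          unfolding dec[OF x] using E ij by (intro index_add_mat) auto
        then show "g x * cnj (\<pi> x $$ (i, j)) = g x * cnj ((E * \<sigma> x * mat_adjoint E) $$ (i, j))
            + g x * cnj ((E' * \<sigma>' x * mat_adjoint E') $$ (i, j))"
          by (simp add: distrib_left)
      qed
      also have "\<dots> = (\<integral>x. g x * cnj ((E * \<sigma> x * mat_adjoint E) $$ (i, j)) \<partial>\<mu>)
          + (\<integral>x. g x * cnj ((E' * \<sigma>' x * mat_adjoint E') $$ (i, j)) \<partial>\<mu>)"
        by (rule Bochner_Integration.integral_add[OF integral_conjugated_rep(1)[OF s(1) E(1) g ij]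
            integral_conjugated_rep(1)[OF s(2) E(2) g ij]])
      also have "\<dots> = 0"
        using n unfolding integral_conjugated_rep(2)[OF s(1) E(1) g ij]
          integral_conjugated_rep(2)[OF s(2) E(2) g ij] by (simp add: fourier_null_def)
      finally show "(\<integral>x. g x * cnj (\<pi> x $$ (i, j)) \<partial>\<mu>) = 0" .
    qed
    then show ?thesis
      using S S' by (intro exI[of _ "\<Sigma> \<union> \<Sigma>'"]) auto
  qed
qed

end

section \<open>Square-integrable functions and their translates\<close>

lemma cmod_add_square_le: "(cmod (a + b))\<^sup>2 \<le> 2 * (cmod a)\<^sup>2 + 2 * (cmod b)\<^sup>2"
proof -
  have "(cmod (a + b))\<^sup>2 \<le> (cmod a + cmod b)\<^sup>2"
    by (intro power_mono norm_triangle_ineq norm_ge_zero)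
  also have "\<dots> \<le> 2 * (cmod a)\<^sup>2 + 2 * (cmod b)\<^sup>2"
    using sum_squares_bound[of "cmod a" "cmod b"] by (simp add: power2_sum)
  finally show ?thesis .
qed

context haar_group
begin

lemma L2_square_integrable: "f \<in> L2 \<mu> \<Longrightarrow> integrable \<mu> (\<lambda>x. (cmod (f x))\<^sup>2)"
  by (simp add: L2_def)

lemma L2_add:
  assumes "f \<in> L2 \<mu>" "g \<in> L2 \<mu>"
  shows "(\<lambda>x. f x + g x) \<in> L2 \<mu>"
proof -
  have [measurable]: "f \<in> borel_measurable \<mu>" "g \<in> borel_measurable \<mu>" using assms by (auto simp: L2_def)
  have "integrable \<mu> (\<lambda>x. (cmod (f x + g x))\<^sup>2)"
  proof (rule Bochner_Integration.integrable_bound)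
    show "integrable \<mu> (\<lambda>x. 2 * (cmod (f x))\<^sup>2 + 2 * (cmod (g x))\<^sup>2)"
      using assms by (intro Bochner_Integration.integrable_add integrable_mult_right L2_square_integrable)
    show "AE x in \<mu>. norm ((cmod (f x + g x))\<^sup>2) \<le> norm (2 * (cmod (f x))\<^sup>2 + 2 * (cmod (g x))\<^sup>2)"
      using cmod_add_square_le by (intro AE_I2) simp
  qed measurable
  then show ?thesis by (simp add: L2_def)
qed

lemma L2_scale:
  assumes "f \<in> L2 \<mu>"
  shows "(\<lambda>x. c * f x) \<in> L2 \<mu>"
  using assms by (auto simp: L2_def norm_mult power_mult_distrib)

lemma L2_diff:
  assumes "f \<in> L2 \<mu>" "g \<in> L2 \<mu>"
  shows "(\<lambda>x. f x - g x) \<in> L2 \<mu>"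
  using L2_add[OF assms(1) L2_scale[OF assms(2), of "-1"]] by simp

lemma L2_sum:
  assumes "finite I" "\<And>i. i \<in> I \<Longrightarrow> f i \<in> L2 \<mu>"
  shows "(\<lambda>x. \<Sum>i\<in>I. f i x) \<in> L2 \<mu>"
  using assms
proof (induction I)
  case empty
  show ?case by (simp add: L2_def)
next
  case (insert i I)
  then show ?case using L2_add[of "f i"] by simp
qed

lemma L2_cong:
  assumes f: "f \<in> L2 \<mu>" and eq: "\<And>x. x \<in> carrier G \<Longrightarrow> f x = g x"
  shows "g \<in> L2 \<mu>"
proof -
  have "g \<in> borel_measurable \<mu> \<longleftrightarrow> f \<in> borel_measurable \<mu>"
    by (rule measurable_cong) (simp add: eq)
  moreover have "integrable \<mu> (\<lambda>x. (cmod (g x))\<^sup>2) \<longleftrightarrow> integrable \<mu> (\<lambda>x. (cmod (f x))\<^sup>2)"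
    by (rule Bochner_Integration.integrable_cong) (simp_all add: eq)
  ultimately show ?thesis using f by (simp add: L2_def)
qed

lemma L2_translate:
  assumes h: "h \<in> carrier G" and f: "f \<in> L2 \<mu>"
  shows "(\<lambda>x. f (h \<otimes> x)) \<in> L2 \<mu>"
  using integrable_translate[OF h L2_square_integrable[OF f]]
    measurable_compose[OF translate_measurable[OF h] L2_measurable[OF f]]
  by (simp add: L2_def)

lemma integral_square_triangle:
  assumes "f \<in> L2 \<mu>" "g \<in> L2 \<mu>"
  shows "(\<integral>x. (cmod (f x + g x))\<^sup>2 \<partial>\<mu>) \<le> 2 * (\<integral>x. (cmod (f x))\<^sup>2 \<partial>\<mu>) + 2 * (\<integral>x. (cmod (g x))\<^sup>2 \<partial>\<mu>)"
proof -
  have "(\<integral>x. (cmod (f x + g x))\<^sup>2 \<partial>\<mu>) \<le> (\<integral>x. 2 * (cmod (f x))\<^sup>2 + 2 * (cmod (g x))\<^sup>2 \<partial>\<mu>)"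
    using assms cmod_add_square_le
    by (intro integral_mono L2_square_integrable L2_add Bochner_Integration.integrable_add integrable_mult_right) auto
  also have "\<dots> = 2 * (\<integral>x. (cmod (f x))\<^sup>2 \<partial>\<mu>) + 2 * (\<integral>x. (cmod (g x))\<^sup>2 \<partial>\<mu>)"
    using assms by (simp add: L2_square_integrable)
  finally show ?thesis .
qed

lemma fourier_coeff_carrier: "fourier_coeff G \<mu> f \<xi> \<in> carrier_mat (rep_dim G \<xi>) (rep_dim G \<xi>)"
  by (simp add: fourier_coeff_def)

text \<open>Substituting \<open>inv h \<otimes> x\<close> for \<open>x\<close> in the coefficient of
  the translate produces the adjoint of \<open>\<xi> (inv h \<otimes> x)\<close>, which is
  \<open>mat_adjoint (\<xi> x) * \<xi> h\<close>. Hence a left translation acts on the coefficient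
  by a factor on the right.\<close>

lemma fourier_coeff_translate_diff:
  assumes f: "f \<in> L2 \<mu>" and xi: "\<xi> \<in> unitary_reps G T" and h: "h \<in> carrier G"
  shows "fourier_coeff G \<mu> (\<lambda>x. f (h \<otimes> x) - f x) \<xi> = fourier_coeff G \<mu> f \<xi> * \<xi> h - fourier_coeff G \<mu> f \<xi>"
    (is "?L = ?A * \<xi> h - ?A")
proof (rule eq_matI)
  let ?d = "rep_dim G \<xi>"
  note A = fourier_coeff_carrier[of f \<xi>] and hc = unitary_rep_carrier[OF xi h]
  have ih: "inv h \<in> carrier G" using h by simp
  fix i j assume "i < dim_row (?A * \<xi> h - ?A)" "j < dim_col (?A * \<xi> h - ?A)"
  then have ij: "i < ?d" "j < ?d" using carrier_matD[OF A] by auto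
  have fi: "integrable \<mu> f" "integrable \<mu> (\<lambda>x. f (h \<otimes> x))"
    using f h by (auto intro: L2_integrable L2_translate)
  have int: "integrable \<mu> (\<lambda>x. f x * cnj (\<xi> x $$ (l, i)) * \<xi> h $$ (l, j))" if "l < ?d" for l
    using fi(1) xi that ij by (intro integrable_mult_left integrable_times_rep)
  have "(?A * \<xi> h) $$ (i, j) = (\<Sum>l<?d. ?A $$ (i, l) * \<xi> h $$ (l, j))"
    using A hc ij by (intro mat_mult_index) auto
  also have "\<dots> = (\<Sum>l<?d. \<integral>x. f x * cnj (\<xi> x $$ (l, i)) * \<xi> h $$ (l, j) \<partial>\<mu>)"
    using ij xi by (simp add: fourier_coeff_index)
  also have "\<dots> = (\<integral>x. (\<Sum>l<?d. f x * cnj (\<xi> x $$ (l, i)) * \<xi> h $$ (l, j)) \<partial>\<mu>)"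
    using int by (intro Bochner_Integration.integral_sum[symmetric]) auto
  also have "\<dots> = (\<integral>x. f (h \<otimes> (inv h \<otimes> x)) * cnj (\<xi> (inv h \<otimes> x) $$ (j, i)) \<partial>\<mu>)"
  proof (intro Bochner_Integration.integral_cong refl)
    fix x assume "x \<in> space \<mu>"
    then have x: "x \<in> carrier G" by simp
    have "h \<otimes> (inv h \<otimes> x) = x" using h x by (simp add: m_assoc[symmetric])
    moreover have "\<xi> (inv h \<otimes> x) $$ (j, i) = (\<Sum>l<?d. cnj (\<xi> h $$ (l, j)) * \<xi> x $$ (l, i))"
      using unitary_rep_mult_index[OF xi ih x ij(2,1)] unitary_rep_inv_index[OF xi h ij(2)] by simp
    ultimately show "(\<Sum>l<?d. f x * cnj (\<xi> x $$ (l, i)) * \<xi> h $$ (l, j))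
        = f (h \<otimes> (inv h \<otimes> x)) * cnj (\<xi> (inv h \<otimes> x) $$ (j, i))"
      by (simp add: sum_distrib_left mult_ac)
  qed
  also have "\<dots> = (\<integral>x. f (h \<otimes> x) * cnj (\<xi> x $$ (j, i)) \<partial>\<mu>)"
    using fi(2) xi ij
    by (intro integral_translate[OF ih, of "\<lambda>x. f (h \<otimes> x) * cnj (\<xi> x $$ (j, i))"])
      (auto intro: borel_measurable_integrable integrable_times_rep)
  finally have Ah: "(?A * \<xi> h) $$ (i, j) = (\<integral>x. f (h \<otimes> x) * cnj (\<xi> x $$ (j, i)) \<partial>\<mu>)" .
  have "?L $$ (i, j) = (\<integral>x. f (h \<otimes> x) * cnj (\<xi> x $$ (j, i)) - f x * cnj (\<xi> x $$ (j, i)) \<partial>\<mu>)"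
    using xi ij by (simp add: fourier_coeff_index left_diff_distrib)
  also have "\<dots> = (?A * \<xi> h) $$ (i, j) - ?A $$ (i, j)"
    unfolding Ah fourier_coeff_index[OF xi ij]
    by (intro Bochner_Integration.integral_diff integrable_times_rep fi xi ij)
  also have "\<dots> = (?A * \<xi> h - ?A) $$ (i, j)"
    using carrier_matD[OF A] ij by simp
  finally show "?L $$ (i, j) = (?A * \<xi> h - ?A) $$ (i, j)" .
qed (use carrier_matD[OF fourier_coeff_carrier[of f \<xi>]] in \<open>simp_all add: fourier_coeff_def\<close>)

end

section \<open>Cosets of a Vilenkin group and Condition (A)\<close>

locale vilenkin_haar = compact_vilenkin_group G T S + haar_group G T \<mu>
  for G (structure) and T S \<mu>
begin

abbreviation index :: "nat \<Rightarrow> nat" where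
  "index n \<equiv> subgroup_index G (carrier G) (S n)"

text \<open>The left coset of \<open>t\<close>, written as the preimage of \<open>S n\<close> under
  a translation so that openness is immediate. Left cosets are the right choice: Haar measure is
  assumed invariant on the left, and a representation trivial on \<open>S n\<close> is constant on
  left cosets.\<close>

definition coset :: "nat \<Rightarrow> 'a \<Rightarrow> 'a set" where
  "coset n t = {x \<in> carrier G. inv t \<otimes> x \<in> S n}"

definition trivial_on :: "nat \<Rightarrow> ('a \<Rightarrow> complex mat) \<Rightarrow> bool" where
  "trivial_on n \<xi> \<longleftrightarrow> (\<forall>x\<in>S n. \<xi> x = 1\<^sub>m (rep_dim G \<xi>))"

lemma S_subset: "x \<in> S n \<Longrightarrow> x \<in> carrier G"
  using subgroup.subset[OF subgroup_S] by blast

lemma one_in_S [simp]: "\<one> \<in> S n"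
  using subgroup.one_closed[OF subgroup_S] .

lemma S_mult: "x \<in> S n \<Longrightarrow> y \<in> S n \<Longrightarrow> x \<otimes> y \<in> S n"
  using subgroup.m_closed[OF subgroup_S] .

lemma S_inv: "x \<in> S n \<Longrightarrow> inv x \<in> S n"
  using subgroup.m_inv_closed[OF subgroup_S] .

lemma S_mult_left_iff:
  assumes a: "a \<in> S n" and x: "x \<in> carrier G"
  shows "a \<otimes> x \<in> S n \<longleftrightarrow> x \<in> S n"
proof
  assume "a \<otimes> x \<in> S n"
  then have "inv a \<otimes> (a \<otimes> x) \<in> S n" by (rule S_mult[OF S_inv[OF a]])
  then show "x \<in> S n" using S_subset[OF a] x by (simp add: m_assoc[symmetric])
qed (rule S_mult[OF a])

lemma S_mult_right_iff:
  assumes a: "a \<in> S n" and x: "x \<in> carrier G"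
  shows "x \<otimes> a \<in> S n \<longleftrightarrow> x \<in> S n"
proof
  assume "x \<otimes> a \<in> S n"
  then have "x \<otimes> a \<otimes> inv a \<in> S n" by (rule S_mult[OF _ S_inv[OF a]])
  then show "x \<in> S n" using S_subset[OF a] x by (simp add: m_assoc)
qed (rule S_mult[OF _ a])

lemma S_mono: "m \<le> n \<Longrightarrow> S n \<subseteq> S m"
  using lift_Suc_antimono_le[of S m n] strictly_decreasing by blast

lemma S_0: "S 0 = carrier G"
  using Union_S S_mono[of 0] by blast

lemma coset_one: "coset n \<one> = S n"
  using S_subset by (auto simp: coset_def)

lemma openin_coset:
  assumes "t \<in> carrier G"
  shows "openin T (coset n t)"
proof -
  have "openin T {x \<in> topspace T. inv t \<otimes> x \<in> S n}"
    using continuous_map_left_translate[of "inv t"] open_S[of n] assms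
    by (simp add: continuous_map_def)
  then show ?thesis by (simp add: coset_def topspace_eq)
qed

lemma coset_sets [measurable]: "t \<in> carrier G \<Longrightarrow> coset n t \<in> sets \<mu>"
  using openin_coset openin_sets by blast

lemma S_sets [measurable]: "S n \<in> sets \<mu>"
  using coset_sets[of \<one> n] by (simp add: coset_one)

lemma measure_coset:
  assumes t: "t \<in> carrier G"
  shows "measure \<mu> (coset n t) = measure \<mu> (S n)"
proof -
  have "coset n t = (\<lambda>y. t \<otimes> y) ` S n"
  proof (intro equalityI subsetI)
    fix x assume "x \<in> coset n t"
    then show "x \<in> (\<lambda>y. t \<otimes> y) ` S n"
      using t by (intro image_eqI[of _ _ "inv t \<otimes> x"]) (auto simp: coset_def m_assoc[symmetric])
  next
    fix x assume "x \<in> (\<lambda>y. t \<otimes> y) ` S n"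
    then show "x \<in> coset n t"
      using t S_subset by (auto simp: coset_def m_assoc[symmetric])
  qed
  then show ?thesis
    using haar t S_sets[of n] by (simp add: normalized_haar_measure_def measure_def)
qed

lemma prob_carrier [simp]: "measure \<mu> (carrier G) = 1"
  using prob_space by simp

lemma integrable_indicator_real: "A \<in> sets \<mu> \<Longrightarrow> integrable \<mu> (indicator A :: 'a \<Rightarrow> real)"
  by (intro integrable_real_indicator) (auto simp: less_top[symmetric])

lemma integral_indicator_real: "A \<in> sets \<mu> \<Longrightarrow> (\<integral>x. indicator A x \<partial>\<mu> :: real) = measure \<mu> A"
  using sets.Int_space_eq2[of A \<mu>] by simp

lemma integral_indicator_complex:
  assumes "A \<in> sets \<mu>"
  shows "(\<integral>x. indicator A x \<partial>\<mu> :: complex) = of_real (measure \<mu> A)"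
proof -
  have "(\<integral>x. indicator A x \<partial>\<mu> :: complex) = (\<integral>x. of_real (indicator A x) \<partial>\<mu>)"
    by (intro Bochner_Integration.integral_cong) (auto simp: indicator_def)
  then show ?thesis using integral_indicator_real[OF assms] by simp
qed

section \<open>Transversals and measures of cosets\<close>

lemma coset_disjoint_or_eq:
  assumes "s \<in> carrier G" "t \<in> carrier G" "x \<in> coset n s" "x \<in> coset n t"
  shows "inv s \<otimes> t \<in> S n"
proof -
  have x: "x \<in> carrier G" "inv s \<otimes> x \<in> S n" "inv t \<otimes> x \<in> S n"
    using assms by (auto simp: coset_def)
  have "(inv s \<otimes> x) \<otimes> inv (inv t \<otimes> x) \<in> S n"
    using x S_mult S_inv by blast
  also have "(inv s \<otimes> x) \<otimes> inv (inv t \<otimes> x) = inv s \<otimes> t"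
  proof -
    have "(inv s \<otimes> x) \<otimes> inv (inv t \<otimes> x) = inv s \<otimes> (x \<otimes> (inv x \<otimes> t))"
      using assms x by (simp add: inv_mult_group m_assoc)
    also have "x \<otimes> (inv x \<otimes> t) = t"
      using assms x by (simp add: m_assoc[symmetric])
    finally show ?thesis .
  qed
  finally show ?thesis .
qed

text \<open>The right cosets are an open partition of a compact space, and a finite subcover of a
  partition into nonempty sets must contain every block. Without finiteness the cardinality in
  \<open>subgroup_index\<close> would default to \<open>0\<close>.\<close>

lemma finite_rcosets: "finite (rcosets (S n))"
proof -
  have "openin T (S n #> g)" if g: "g \<in> carrier G" for g
  proof -
    have "openin T {x \<in> topspace T. \<one> \<otimes> x \<otimes> inv g \<in> S n}"
      using continuous_map_translate[of \<one> "inv g"] open_S[of n] g by (simp add: continuous_map_def)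
    moreover have "{x \<in> topspace T. \<one> \<otimes> x \<otimes> inv g \<in> S n} = S n #> g"
    proof -
      have "S n #> g \<subseteq> carrier G"
        by (rule r_coset_subset_G[OF subgroup.subset[OF subgroup_S] g])
      moreover have "x \<in> S n #> g \<longleftrightarrow> x \<otimes> inv g \<in> S n" if "x \<in> carrier G" for x
        by (rule subgroup.rcos_module[OF subgroup_S is_group g that])
      ultimately show ?thesis by (auto simp: topspace_eq)
    qed
    ultimately show ?thesis by simp
  qed
  then have "\<And>C. C \<in> rcosets (S n) \<Longrightarrow> openin T C"
    by (auto simp: RCOSETS_def)
  moreover have "topspace T \<subseteq> \<Union>(rcosets (S n))"
    using rcosets_part_G[OF subgroup_S] by (simp add: topspace_eq)
  ultimately obtain \<F> where F: "finite \<F>" "\<F> \<subseteq> rcosets (S n)" "topspace T \<subseteq> \<Union>\<F>"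
    using compact unfolding compact_space_def compactin_def by (metis (no_types, lifting) order_refl)
  have "rcosets (S n) \<subseteq> \<F>"
  proof
    fix C assume C: "C \<in> rcosets (S n)"
    obtain x where x: "x \<in> C"
      using subgroup.rcosets_non_empty[OF subgroup_S C] by blast
    then have "x \<in> carrier G" using C rcosets_part_G[OF subgroup_S] by blast
    then obtain D where D: "D \<in> \<F>" "x \<in> D" using F(3) by (auto simp: topspace_eq)
    then have "C = D" using rcos_disjoint[OF subgroup_S] F(2) C x by (auto simp: pairwise_def disjnt_def)
    then show "C \<in> \<F>" using D by simp
  qed
  then show ?thesis using F(1) finite_subset by blast
qed

text \<open>\<open>subgroup_index\<close> counts right cosets, whereas \<open>coset\<close> is a
  left coset. Inversion exchanges the two kinds, so the inverses of right coset representatives form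
  a left transversal of the same size.\<close>

lemma transversal_exists:
  "\<exists>t. (\<forall>k<index n. t k \<in> carrier G) \<and> (\<forall>g\<in>carrier G. \<exists>!k. k < index n \<and> g \<in> coset n (t k))"
proof -
  have idx: "index n = card (rcosets (S n))" by (simp add: subgroup_index_def)
  obtain e where e: "bij_betw e {0..<index n} (rcosets (S n))"
    using ex_bij_betw_nat_finite[OF finite_rcosets] idx by metis
  define r where "r k = (SOME x. x \<in> e k)" for k
  have r: "r k \<in> e k" "e k \<in> rcosets (S n)" if "k < index n" for k
  proof -
    show ek: "e k \<in> rcosets (S n)" using e that by (auto simp: bij_betw_def)
    show "r k \<in> e k" unfolding r_def
      using subgroup.rcosets_non_empty[OF subgroup_S ek] by (simp add: some_in_eq)
  qed
  have rc: "r k \<in> carrier G" if "k < index n" for k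
    using r[OF that] rcosets_part_G[OF subgroup_S] by blast
  have er: "e k = S n #> r k" if k: "k < index n" for k
  proof -
    obtain a where "a \<in> carrier G" "e k = S n #> a" using r(2)[OF k] by (auto simp: RCOSETS_def)
    then show ?thesis using repr_independence[of "r k" "S n" a] r(1)[OF k] subgroup_S by simp
  qed
  have iff: "g \<in> coset n (inv (r k)) \<longleftrightarrow> e k = S n #> inv g" if k: "k < index n" and g: "g \<in> carrier G" for k g
  proof -
    have "g \<in> coset n (inv (r k)) \<longleftrightarrow> r k \<otimes> inv (inv g) \<in> S n"
      using rc[OF k] g by (simp add: coset_def)
    also have "\<dots> \<longleftrightarrow> r k \<in> S n #> inv g"
      using subgroup.rcos_module[OF subgroup_S is_group, of "inv g" "r k"] rc[OF k] g by simp
    also have "\<dots> \<longleftrightarrow> e k = S n #> inv g"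
    proof
      assume "r k \<in> S n #> inv g"
      then show "e k = S n #> inv g"
        using repr_independence[of "r k" "S n" "inv g"] er[OF k] g subgroup_S by simp
    next
      assume "e k = S n #> inv g"
      then show "r k \<in> S n #> inv g" using r(1)[OF k] by simp
    qed
    finally show ?thesis .
  qed
  have "\<exists>!k. k < index n \<and> g \<in> coset n (inv (r k))" if g: "g \<in> carrier G" for g
  proof -
    have "S n #> inv g \<in> rcosets (S n)"
      using g subgroup.subset[OF subgroup_S] by (intro rcosetsI) auto
    then have "S n #> inv g \<in> e ` {0..<index n}" using bij_betw_imp_surj_on[OF e] by simp
    then obtain k where k: "k < index n" "e k = S n #> inv g" by auto
    show ?thesis
    proof (rule ex1I[of _ k])
      show "k < index n \<and> g \<in> coset n (inv (r k))" using k iff[OF k(1) g] by simp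
      fix l assume "l < index n \<and> g \<in> coset n (inv (r l))"
      then have l: "l < index n" "e l = e k" using iff[of l g] g k by auto
      then show "l = k" using inj_onD[OF bij_betw_imp_inj_on[OF e], of l k] k by simp
    qed
  qed
  then show ?thesis
    using rc by (intro exI[of _ "\<lambda>k. inv (r k)"]) auto
qed

definition tr :: "nat \<Rightarrow> nat \<Rightarrow> 'a" where
  "tr n = (SOME t. (\<forall>k<index n. t k \<in> carrier G) \<and>
    (\<forall>g\<in>carrier G. \<exists>!k. k < index n \<and> g \<in> coset n (t k)))"

lemma tr_transversal:
  "(\<forall>k<index n. tr n k \<in> carrier G) \<and> (\<forall>g\<in>carrier G. \<exists>!k. k < index n \<and> g \<in> coset n (tr n k))"
  unfolding tr_def by (rule someI_ex[OF transversal_exists])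

lemma tr_carrier: "k < index n \<Longrightarrow> tr n k \<in> carrier G"
  using tr_transversal[of n] by simp

lemma tr_unique: "g \<in> carrier G \<Longrightarrow> \<exists>!k. k < index n \<and> g \<in> coset n (tr n k)"
  using tr_transversal[of n] by simp

lemma transversal_obtain:
  assumes "g \<in> carrier G"
  obtains k where "k < index n" "g \<in> coset n (tr n k)"
  using tr_unique[OF assms, of n] by blast

lemma mem_coset_tr_iff:
  assumes "k < index n" "g \<in> coset n (tr n k)" "l < index n"
  shows "g \<in> coset n (tr n l) \<longleftrightarrow> l = k"
proof -
  have "g \<in> carrier G" using assms by (simp add: coset_def)
  then show ?thesis using tr_unique[of g n] assms by blast
qed

lemma sum_transversal:
  fixes f :: "nat \<Rightarrow> 'd :: semiring_1"
  assumes k: "k < index n" "g \<in> coset n (tr n k)"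
  shows "(\<Sum>l<index n. indicator (coset n (tr n l)) g * f l) = f k"
proof -
  have "(\<Sum>l<index n. indicator (coset n (tr n l)) g * f l) = (\<Sum>l<index n. if l = k then f l else 0)"
    by (intro sum.cong) (simp_all add: indicator_def mem_coset_tr_iff[OF k])
  then show ?thesis using k by simp
qed

text \<open>The cosets of a transversal partition a space of mass one into \<open>index n\<close>
  sets of equal measure. Positivity of the index falls out of the same equation.\<close>

lemma measure_S: "measure \<mu> (S n) = 1 / real (index n)" and index_pos: "index n > 0"
proof -
  have "1 = (\<integral>x. 1 \<partial>\<mu> :: real)" by simp
  also have "\<dots> = (\<integral>x. (\<Sum>l<index n. indicator (coset n (tr n l)) x) \<partial>\<mu>)"
  proof (intro Bochner_Integration.integral_cong refl)
    fix x assume "x \<in> space \<mu>"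
    then obtain k where "k < index n" "x \<in> coset n (tr n k)" using transversal_obtain[of x n] by auto
    from sum_transversal[OF this, of "\<lambda>_. 1 :: real"]
    show "(1::real) = (\<Sum>l<index n. indicator (coset n (tr n l)) x)" by simp
  qed
  also have "\<dots> = (\<Sum>l<index n. measure \<mu> (coset n (tr n l)))"
    using tr_carrier by (subst Bochner_Integration.integral_sum)
      (auto intro!: sum.cong integral_indicator_real integrable_indicator_real coset_sets simp del: Bochner_Integration.integral_indicator)
  also have "\<dots> = real (index n) * measure \<mu> (S n)"
    using tr_carrier by (simp add: measure_coset)
  finally have *: "real (index n) * measure \<mu> (S n) = 1" ..
  then show "index n > 0" by (metis mult_zero_left of_nat_0 gr0I zero_neq_one)
  then show "measure \<mu> (S n) = 1 / real (index n)" using * by (simp add: field_simps)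
qed

text \<open>Growth of the index is read off from measures: \<open>S n\<close> contains two disjoint
  cosets of \<open>S (Suc n)\<close>, so the measure at least halves and the index at least
  doubles.\<close>

lemma index_less_Suc: "index n < index (Suc n)"
proof -
  obtain a where a: "a \<in> S n" "a \<notin> S (Suc n)" using strictly_decreasing[of n] by blast
  have ac: "a \<in> carrier G" using a S_subset by blast
  have sub: "coset (Suc n) a \<subseteq> S n"
  proof
    fix x assume "x \<in> coset (Suc n) a"
    then have "x \<in> carrier G" "inv a \<otimes> x \<in> S n" using S_mono[of n "Suc n"] by (auto simp: coset_def)
    then show "x \<in> S n" using S_mult_left_iff[OF S_inv[OF a(1)]] by simp
  qed
  have "coset (Suc n) a \<inter> S (Suc n) = {}"
  proof (rule ccontr)
    assume "coset (Suc n) a \<inter> S (Suc n) \<noteq> {}"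
    then obtain x where "x \<in> coset (Suc n) a" "x \<in> coset (Suc n) \<one>" by (auto simp: coset_one)
    then have "inv a \<otimes> \<one> \<in> S (Suc n)" using coset_disjoint_or_eq ac by blast
    then show False using a ac S_inv[of "inv a"] by simp
  qed
  then have "measure \<mu> (coset (Suc n) a) + measure \<mu> (S (Suc n)) = measure \<mu> (coset (Suc n) a \<union> S (Suc n))"
    using ac by (intro finite_measure_Union[symmetric]) auto
  also have "\<dots> \<le> measure \<mu> (S n)"
    using sub S_mono[of n "Suc n"] by (intro finite_measure_mono) auto
  finally have "2 * (1 / real (index (Suc n))) \<le> 1 / real (index n)"
    by (simp add: measure_coset[OF ac] measure_S)
  then have "2 * real (index n) \<le> real (index (Suc n))"
    using index_pos[of n] index_pos[of "Suc n"] by (simp add: field_simps)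
  then show ?thesis using index_pos[of n] by linarith
qed

section \<open>Levels, absolute value and weight\<close>

lemma strict_mono_index: "strict_mono index"
  by (intro strict_mono_Suc_iff[THEN iffD2] allI index_less_Suc)

lemma index_less_iff: "index m < index n \<longleftrightarrow> m < n"
  using strict_mono_less[OF strict_mono_index] .

lemma exists_level:
  assumes "h \<in> carrier G" "h \<noteq> \<one>"
  obtains k where "h \<in> S k - S (Suc k)"
proof -
  have ex: "\<exists>n. h \<notin> S n" using Inter_S assms by blast
  define m where "m = (LEAST n. h \<notin> S n)"
  have m: "h \<notin> S m" unfolding m_def using ex by (rule LeastI_ex)
  then have "m \<noteq> 0" using S_0 assms by metis
  then obtain k where k: "m = Suc k" using not0_implies_Suc by blast
  then have "h \<in> S k" using not_less_Least[of k "\<lambda>n. h \<notin> S n"] m_def by auto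
  then show ?thesis using that m k by blast
qed

lemma level_unique: "h \<in> S k - S (Suc k) \<Longrightarrow> h \<in> S l - S (Suc l) \<Longrightarrow> l = k"
  by (metis DiffE S_mono Suc_leI linorder_neqE_nat subsetD)

lemma vabs_level:
  assumes h: "h \<in> S k - S (Suc k)"
  shows "vabs G S \<mu> h = 1 / real (index k)"
proof -
  have "(THE n. h \<in> S n - S (Suc n)) = k"
    using h level_unique by (intro the_equality) blast+
  moreover have "h \<noteq> \<one>" using h by auto
  ultimately show ?thesis by (simp add: vabs_def measure_S)
qed

lemma vabs_one: "vabs G S \<mu> \<one> = 0"
  by (simp add: vabs_def)

lemma rep_weight_pos: "rep_weight G T S \<xi> > 0"
  using index_pos by (simp add: rep_weight_def)

lemma trivial_on_mono: "m \<le> n \<Longrightarrow> trivial_on m \<xi> \<Longrightarrow> trivial_on n \<xi>"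
  using S_mono by (auto simp: trivial_on_def)

lemma annihilator_iff: "\<xi> \<in> unitary_reps G T \<Longrightarrow> \<xi> \<in> annihilator G T (S n) \<longleftrightarrow> trivial_on n \<xi>"
  by (simp add: annihilator_def trivial_on_def)

lemma indicator_L2: "A \<in> sets \<mu> \<Longrightarrow> indicator A \<in> L2 \<mu>"
  by (rule bounded_L2[where B = 1]) (auto simp: indicator_def)

end

section \<open>Consequences of Condition (A)\<close>

locale vilenkin_haar_A = vilenkin_haar +
  assumes cond_A: "condition_A G T S \<mu>"
begin

text \<open>Condition (A) is applied to the Fourier coefficient of the indicator of \<open>S k\<close>.\<close>

lemma integral_S_null:
  assumes xi: "\<xi> \<in> irreducible_reps G T" and nt: "\<not> trivial_on k \<xi>"
    and ij: "i < rep_dim G \<xi>" "j < rep_dim G \<xi>"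
  shows "(\<integral>x. indicator (S k) x * cnj (\<xi> x $$ (i, j)) \<partial>\<mu>) = 0"
proof -
  let ?d = "rep_dim G \<xi>"
  note u = irreducible_unitary[OF xi]
  note c = unitary_rep_carrier[OF u]
  obtain x where x: "x \<in> S k" "\<xi> x \<noteq> 1\<^sub>m ?d" using nt by (auto simp: trivial_on_def)
  \<comment> \<open>Condition (A) asks for nontriviality on the shell
    \<open>S k - S (Suc k)\<close>, the hypothesis only on \<open>S k\<close>. If \<open>x\<close>
    lies in \<open>S (Suc k)\<close> and \<open>a\<close> in the shell, then
    \<open>a \<otimes> x\<close> lies in the shell too, so triviality on the shell would force
    \<open>\<xi> x\<close> to be the identity.\<close>
  have "\<exists>x \<in> S k - S (Suc k). \<xi> x \<noteq> 1\<^sub>m ?d"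
  proof (rule ccontr)
    assume *: "\<not> ?thesis"
    then have xS: "x \<in> S (Suc k)" using x by blast
    obtain a where a: "a \<in> S k" "a \<notin> S (Suc k)" using strictly_decreasing[of k] by blast
    have "a \<otimes> x \<in> S k - S (Suc k)"
      using a x xS S_mult S_mult_right_iff[OF xS] S_subset by blast
    then have "\<xi> (a \<otimes> x) = 1\<^sub>m ?d" "\<xi> a = 1\<^sub>m ?d" using * a by auto
    moreover have "\<xi> (a \<otimes> x) = \<xi> a * \<xi> x" using unitary_rep_mult[OF u] a x S_subset by blast
    ultimately show False using x c[OF S_subset[OF x(1)]] by simp
  qed
  note nt' = this
  obtain N :: nat and h where h: "\<forall>k. \<forall>i<N. h k i \<in> carrier G \<and> vabs G S \<mu> (h k i) = 1 / vindex G S k"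
    and ineq: "\<forall>q::real. 1 \<le> q \<longrightarrow> (\<exists>C>0. \<forall>k. \<forall>\<xi>\<in>irreducible_reps G T.
           (\<exists>x \<in> S k - S (Suc k). \<xi> x \<noteq> 1\<^sub>m (rep_dim G \<xi>)) \<longrightarrow>
           (\<forall>A \<in> {fourier_coeff G \<mu> f \<xi> | f. f \<in> L2 \<mu>}.
              vindex G S k powr q * rep_weight G T S \<xi> powr (- q) * HS_norm A powr q
              \<le> C * (\<Sum>i<N. HS_norm (A * (\<xi> (h k i) - 1\<^sub>m (rep_dim G \<xi>))) powr q)))"
    using cond_A unfolding condition_A_def by (elim exE conjE) (rule that)
  \<comment> \<open>The value of \<open>vabs\<close> determines the level because
    \<open>index\<close> is injective. So the points lie in \<open>S k\<close>, and translation by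
    them leaves the indicator of \<open>S k\<close> unchanged.\<close>
  have hS: "h k i \<in> S k" if "i < N" for i
  proof -
    have hi: "h k i \<in> carrier G" "vabs G S \<mu> (h k i) = 1 / real (index k)" using h that by blast+
    then have "h k i \<noteq> \<one>" using index_pos[of k] vabs_one by auto
    then obtain l where l: "h k i \<in> S l - S (Suc l)" using exists_level hi(1) by blast
    then have "index l = index k" using vabs_level[OF l] hi(2) by simp
    then have "l = k" using strict_mono_index strict_mono_eq by blast
    then show ?thesis using l by blast
  qed
  define f :: "'a \<Rightarrow> complex" where "f = indicator (S k)"
  have f: "f \<in> L2 \<mu>" unfolding f_def by (rule indicator_L2[OF S_sets])
  define A where "A = fourier_coeff G \<mu> f \<xi>"
  have A: "A \<in> carrier_mat ?d ?d" by (simp add: A_def fourier_coeff_def)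
  have zero: "A * (\<xi> (h k i) - 1\<^sub>m ?d) = 0\<^sub>m ?d ?d" if i: "i < N" for i
  proof -
    note hc = S_subset[OF hS[OF i]]
    have "f (h k i \<otimes> x) - f x = 0" if "x \<in> carrier G" for x
      using S_mult_left_iff[OF hS[OF i] that] by (simp add: f_def indicator_def)
    then have "fourier_coeff G \<mu> (\<lambda>x. f (h k i \<otimes> x) - f x) \<xi> = 0\<^sub>m ?d ?d"
      unfolding fourier_coeff_def
      by (intro eq_matI) (auto intro!: integral_eq_zero_AE AE_I2)
    then have "A * \<xi> (h k i) - A = 0\<^sub>m ?d ?d"
      using fourier_coeff_translate_diff[OF f u hc] by (simp add: A_def)
    moreover have "A * (\<xi> (h k i) - 1\<^sub>m ?d) = A * \<xi> (h k i) - A * 1\<^sub>m ?d"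
      by (rule mult_minus_distrib_mat[OF A c[OF hc]]) simp
    ultimately show ?thesis using A by simp
  qed
  \<comment> \<open>The exponent \<open>q = 1\<close> is chosen. The right side is zero and the
    factors in front of \<open>HS_norm A\<close> are positive, so the inequality can hold only if
    \<open>HS_norm A\<close> vanishes.\<close>
  obtain C where C: "C > 0" "\<forall>k. \<forall>\<xi>\<in>irreducible_reps G T.
           (\<exists>x \<in> S k - S (Suc k). \<xi> x \<noteq> 1\<^sub>m (rep_dim G \<xi>)) \<longrightarrow>
           (\<forall>A \<in> {fourier_coeff G \<mu> f \<xi> | f. f \<in> L2 \<mu>}.
              vindex G S k powr 1 * rep_weight G T S \<xi> powr (- 1) * HS_norm A powr 1
              \<le> C * (\<Sum>i<N. HS_norm (A * (\<xi> (h k i) - 1\<^sub>m (rep_dim G \<xi>))) powr 1))"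
    using ineq[rule_format, OF order_refl] by blast
  have "A \<in> {fourier_coeff G \<mu> f \<xi> | f. f \<in> L2 \<mu>}" using f by (auto simp: A_def)
  then have "vindex G S k powr 1 * rep_weight G T S \<xi> powr (- 1) * HS_norm A powr 1
      \<le> C * (\<Sum>i<N. HS_norm (A * (\<xi> (h k i) - 1\<^sub>m ?d)) powr 1)"
    using C(2)[rule_format, OF xi nt'] by blast
  also have "\<dots> = 0" using zero by (simp add: HS_norm_def)
  finally have le: "vindex G S k powr 1 * rep_weight G T S \<xi> powr (- 1) * HS_norm A powr 1 \<le> 0" .
  have "HS_norm A = 0"
  proof (rule ccontr)
    assume "HS_norm A \<noteq> 0"
    then have "0 < vindex G S k powr 1 * rep_weight G T S \<xi> powr (- 1) * HS_norm A powr 1"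
      using index_pos[of k] rep_weight_pos[of \<xi>] by (intro mult_pos_pos) (simp_all del: powr_one powr_minus)
    then show False using le by linarith
  qed
  then have "(\<Sum>i<?d. \<Sum>j<?d. (cmod (A $$ (i, j)))\<^sup>2) = 0" using A by (simp add: HS_norm_def)
  \<comment> \<open>Row \<open>j\<close> is selected because the Fourier coefficient uses the
    adjoint of \<xi>, which swaps the indices \<open>i\<close> and \<open>j\<close> of the
    claim.\<close>
  then have "(\<Sum>i<?d. (cmod (A $$ (j, i)))\<^sup>2) = 0"
    by (rule sum_nonneg_0[rotated 2]) (use ij in \<open>auto intro: sum_nonneg\<close>)
  then have "(cmod (A $$ (j, i)))\<^sup>2 = 0"
    by (rule sum_nonneg_0[rotated 2]) (use ij in auto)
  then show ?thesis using fourier_coeff_index[OF u ij(2,1), of f] by (simp add: A_def f_def)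
qed

lemma integral_S_trivial:
  assumes u: "\<xi> \<in> unitary_reps G T" and tr: "trivial_on k \<xi>" and ij: "i < rep_dim G \<xi>" "j < rep_dim G \<xi>"
  shows "(\<integral>x. indicator (S k) x * cnj (\<xi> x $$ (i, j)) \<partial>\<mu>) = (if i = j then 1 / of_nat (index k) else 0)"
proof -
  have "(\<integral>x. indicator (S k) x * cnj (\<xi> x $$ (i, j)) \<partial>\<mu>) = (\<integral>x. indicator (S k) x * (if i = j then 1 else 0) \<partial>\<mu>)"
    using tr ij by (intro Bochner_Integration.integral_cong) (auto simp: indicator_def trivial_on_def)
  also have "\<dots> = of_real (measure \<mu> (S k)) * (if i = j then 1 else 0)"
    by (simp add: integral_indicator_complex[OF S_sets] del: Bochner_Integration.integral_indicator)
  finally show ?thesis by (simp add: measure_S)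
qed

text \<open>Near the identity the \<open>(0, 0)\<close> entry stays away from \<open>0\<close>, so its integral over \<open>S n\<close> does
  not vanish.\<close>

lemma eventually_trivial:
  assumes xi: "\<xi> \<in> irreducible_reps G T"
  obtains n where "trivial_on n \<xi>"
proof -
  note u = irreducible_unitary[OF xi] and d = irreducible_dim_pos[OF xi]
  let ?U = "{x \<in> topspace T. \<xi> x $$ (0, 0) \<in> ball 1 (1/2)}"
  have "continuous_map T euclidean (\<lambda>x. \<xi> x $$ (0, 0))"
    using u d by (simp add: unitary_reps_def)
  then have "openin T ?U" by (rule openin_continuous_map_preimage) simp
  moreover have "\<one> \<in> ?U" using unitary_rep_one[OF u] d by (simp add: topspace_eq)
  ultimately obtain n where n: "S n \<subseteq> ?U" using basis_S by blast
  have "trivial_on n \<xi>"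
  proof (rule ccontr)
    assume "\<not> trivial_on n \<xi>"
    then have "0 = (\<integral>x. indicator (S n) x * cnj (\<xi> x $$ (0, 0)) \<partial>\<mu>)"
      using integral_S_null[OF xi _ d d] by simp
    then have "0 = Re (\<integral>x. indicator (S n) x * cnj (\<xi> x $$ (0, 0)) \<partial>\<mu>)" by simp
    also have "\<dots> = (\<integral>x. Re (indicator (S n) x * cnj (\<xi> x $$ (0, 0))) \<partial>\<mu>)"
      using u d indicator_L2[OF S_sets] by (intro integral_Re[symmetric] integrable_times_rep L2_integrable)
    also have "\<dots> \<ge> (\<integral>x. indicator (S n) x * (1/2) \<partial>\<mu>)"
    proof (rule integral_mono)
      show "integrable \<mu> (\<lambda>x. Re (indicator (S n) x * cnj (\<xi> x $$ (0, 0))))"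
        using u d indicator_L2[OF S_sets] by (intro integrable_Re integrable_times_rep L2_integrable)
      fix x
      show "indicator (S n) x * (1/2) \<le> Re (indicator (S n) x * cnj (\<xi> x $$ (0, 0)))"
      proof (cases "x \<in> S n")
        case True
        then have "cmod (1 - \<xi> x $$ (0, 0)) < 1/2" using n by (auto simp: dist_norm)
        moreover have "Re (1 - \<xi> x $$ (0, 0)) \<le> cmod (1 - \<xi> x $$ (0, 0))" by (rule complex_Re_le_cmod)
        ultimately show ?thesis using True by simp
      qed simp
    next
      show "integrable \<mu> (\<lambda>x. indicator (S n) x * (1/2) :: real)"
        by (intro integrable_mult_left integrable_indicator_real S_sets)
    qed
    finally have "(\<integral>x. indicator (S n) x * (1/2) \<partial>\<mu>) \<le> (0::real)" .
    moreover have "(\<integral>x. indicator (S n) x * (1/2) \<partial>\<mu>) = measure \<mu> (S n) / 2"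
      using sets.Int_space_eq2[OF S_sets[of n]] by simp
    ultimately show False using index_pos[of n] by (simp add: measure_S)
  qed
  then show ?thesis using that by blast
qed

text \<open>For \<xi> not identically trivial, the least \<open>m\<close> with \<xi> trivial on
  \<open>S m\<close> exists by \<open>eventually_trivial\<close> and is the only level at which
  \<xi> occurs in \<open>Rep_level\<close>. The weight is then \<open>index m\<close>, and strict
  monotonicity compares it with \<open>index k\<close>. For trivial \<xi> the weight
  \<open>1\<close> never exceeds an index.\<close>

lemma rep_weight_gt_iff:
  assumes xi: "\<xi> \<in> irreducible_reps G T"
  shows "rep_weight G T S \<xi> > vindex G S k \<longleftrightarrow> \<not> trivial_on k \<xi>"
proof (cases "trivial_on 0 \<xi>")
  case True
  then have "\<xi> \<in> annihilator G T (carrier G)"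
    using annihilator_iff[OF irreducible_unitary[OF xi], of 0] S_0 by simp
  then show ?thesis
    using index_pos[of k] trivial_on_mono[OF _ True, of k] by (simp add: rep_weight_def)
next
  case False
  note u = irreducible_unitary[OF xi]
  have ex: "\<exists>n. trivial_on n \<xi>" using eventually_trivial[OF xi] by blast
  define m where "m = (LEAST n. trivial_on n \<xi>)"
  have m: "trivial_on m \<xi>" unfolding m_def using ex by (rule LeastI_ex)
  have iff: "trivial_on n \<xi> \<longleftrightarrow> m \<le> n" for n
    using trivial_on_mono[OF _ m] Least_le[of "\<lambda>n. trivial_on n \<xi>" n] m_def by blast
  have m1: "m \<ge> 1" using False m by (cases m) auto
  have "(THE n. 1 \<le> n \<and> \<xi> \<in> Rep_level G T S n) = m"
  proof (rule the_equality)
    show "1 \<le> m \<and> \<xi> \<in> Rep_level G T S m"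
      using m1 by (auto simp: Rep_level_def annihilator_iff[OF u] iff)
    fix n assume "1 \<le> n \<and> \<xi> \<in> Rep_level G T S n"
    then show "n = m" by (auto simp: Rep_level_def annihilator_iff[OF u] iff)
  qed
  moreover have "\<xi> \<notin> annihilator G T (carrier G)"
    using annihilator_iff[OF u, of 0] S_0 False by simp
  ultimately have "rep_weight G T S \<xi> = vindex G S m" by (simp add: rep_weight_def)
  then show ?thesis by (simp add: index_less_iff iff not_le)
qed

end

section \<open>The Plancherel identity on finite levels\<close>

lemma continuous_map_clopen_indicator:
  fixes c d :: "'c :: topological_space"
  assumes "openin X A" "closedin X A"
  shows "continuous_map X euclidean (\<lambda>x. if x \<in> A then c else d)"
  unfolding continuous_map_def
proof (intro conjI allI impI)
  fix U :: "'c set"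
  have "{x \<in> topspace X. (if x \<in> A then c else d) \<in> U}
      = (if c \<in> U then A else {}) \<union> (if d \<in> U then topspace X - A else {})"
    using openin_subset[OF assms(1)] by auto
  moreover have "openin X (topspace X - A)" using assms(2) by (simp add: closedin_def)
  ultimately show "openin X {x \<in> topspace X. (if x \<in> A then c else d) \<in> U}"
    using assms(1) by auto
qed auto

lemma HS_norm_square_real: "(HS_norm A)\<^sup>2 = (\<Sum>i<dim_row A. \<Sum>j<dim_col A. (cmod (A $$ (i, j)))\<^sup>2)"
  unfolding HS_norm_def by (intro real_sqrt_pow2 sum_nonneg) auto

lemma HS_norm_square: "complex_of_real ((HS_norm A)\<^sup>2)
    = (\<Sum>i<dim_row A. \<Sum>j<dim_col A. A $$ (i, j) * cnj (A $$ (i, j)))"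
  by (simp add: HS_norm_square_real complex_norm_square del: of_real_power)

lemma sum_rotate3:
  "(\<Sum>j\<in>A. \<Sum>k\<in>B. \<Sum>l\<in>C. F j k l) = (\<Sum>k\<in>B. \<Sum>l\<in>C. \<Sum>j\<in>A. F j k l)"
  by (rule trans[OF sum.swap]) (rule sum.cong[OF refl], rule sum.swap)

context vilenkin_haar
begin

section \<open>The permutation representation on left cosets\<close>

lemma closedin_S: "closedin T (S n)"
  using compactin_imp_closedin[OF Hausdorff compact_S] .

lemma coset_left_mult:
  assumes "t \<in> carrier G" "x \<in> carrier G" "s \<in> carrier G" "g \<in> coset n s"
  shows "x \<otimes> g \<in> coset n t \<longleftrightarrow> x \<otimes> s \<in> coset n t"
proof -
  have g: "g \<in> carrier G" "inv s \<otimes> g \<in> S n" using assms by (auto simp: coset_def)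
  have "s \<otimes> (inv s \<otimes> g) = g" using assms g by (simp add: m_assoc[symmetric])
  then have "inv t \<otimes> (x \<otimes> g) = inv t \<otimes> (x \<otimes> s) \<otimes> (inv s \<otimes> g)"
    using assms g by (simp add: m_assoc)
  then show ?thesis
    using assms g S_mult_right_iff[OF g(2), of "inv t \<otimes> (x \<otimes> s)"] by (simp add: coset_def)
qed

lemma self_coset: "t \<in> carrier G \<Longrightarrow> t \<in> coset n t"
  by (simp add: coset_def)

lemma coset_tr_eq_iff:
  assumes "i < index n" "j < index n" "inv (tr n i) \<otimes> tr n j \<in> S n"
  shows "i = j"
  using mem_coset_tr_iff[OF assms(1) _ assms(2), of "tr n j"] self_coset[OF tr_carrier[OF assms(2)]] assms tr_carrier
  by (auto simp: coset_def)

text \<open>The permutation matrix of \<open>x\<close> acting on left cosets by translation: column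
  \<open>j\<close> has its \<open>1\<close> in the row of the coset that contains
  \<open>x \<otimes> tr n j\<close>.\<close>

definition coset_rep :: "nat \<Rightarrow> 'a \<Rightarrow> complex mat" where
  "coset_rep n x = Matrix.mat (index n) (index n)
    (\<lambda>(i, j). indicator (coset n (tr n i)) (x \<otimes> tr n j))"

lemma rep_dim_coset_rep: "rep_dim G (coset_rep n) = index n"
  by (simp add: rep_dim_def coset_rep_def)

text \<open>In the matrix product only the coset containing \<open>y \<otimes> tr n j\<close>
  survives, which gives multiplicativity. Columns are orthonormal because translation by
  \<open>x\<close> keeps distinct cosets distinct, and entries are continuous as indicators of
  clopen sets.\<close>

lemma coset_rep_unitary_rep: "coset_rep n \<in> unitary_reps G T"
proof -
  have carr: "coset_rep n x \<in> carrier_mat (index n) (index n)" for x by (simp add: coset_rep_def)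
  have idx: "coset_rep n x $$ (i, j) = indicator (coset n (tr n i)) (x \<otimes> tr n j)"
    if "i < index n" "j < index n" for x i j
    using that by (simp add: coset_rep_def)
  have mult: "coset_rep n (x \<otimes> y) = coset_rep n x * coset_rep n y"
    if x: "x \<in> carrier G" and y: "y \<in> carrier G" for x y
  proof (rule eq_matI)
    fix i j assume "i < dim_row (coset_rep n x * coset_rep n y)" "j < dim_col (coset_rep n x * coset_rep n y)"
    then have ij: "i < index n" "j < index n" using carr[of x] carr[of y] by auto
    note tc = tr_carrier[OF ij(1)] tr_carrier[OF ij(2)]
    obtain k where k: "k < index n" "y \<otimes> tr n j \<in> coset n (tr n k)"
      using transversal_obtain[of "y \<otimes> tr n j" n] y tc by auto
    have "(coset_rep n x * coset_rep n y) $$ (i, j)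
        = (\<Sum>l<index n. coset_rep n x $$ (i, l) * coset_rep n y $$ (l, j))"
      using carr ij by (intro mat_mult_index)
    also have "\<dots> = (\<Sum>l<index n. indicator (coset n (tr n l)) (y \<otimes> tr n j) * indicator (coset n (tr n i)) (x \<otimes> tr n l))"
      using ij by (intro sum.cong refl) (simp add: idx)
    also have "\<dots> = indicator (coset n (tr n i)) (x \<otimes> tr n k)"
      by (rule sum_transversal[OF k])
    also have "\<dots> = indicator (coset n (tr n i)) (x \<otimes> (y \<otimes> tr n j))"
      using coset_left_mult[OF tc(1) x tr_carrier[OF k(1)] k(2)] by (simp add: indicator_def)
    also have "\<dots> = coset_rep n (x \<otimes> y) $$ (i, j)"
      using ij tc x y by (simp add: idx m_assoc)
    finally show "coset_rep n (x \<otimes> y) $$ (i, j) = (coset_rep n x * coset_rep n y) $$ (i, j)" ..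
  qed (simp_all add: coset_rep_def)
  have unit: "unitary_mat (index n) (coset_rep n x)" if x: "x \<in> carrier G" for x
    unfolding unitary_mat_def
  proof (intro conjI carr eq_matI)
    fix i j assume "i < dim_row (1\<^sub>m (index n) :: complex mat)" "j < dim_col (1\<^sub>m (index n) :: complex mat)"
    then have ij: "i < index n" "j < index n" by auto
    note tc = tr_carrier[OF ij(1)] tr_carrier[OF ij(2)]
    obtain k where k: "k < index n" "x \<otimes> tr n i \<in> coset n (tr n k)"
      using transversal_obtain[of "x \<otimes> tr n i" n] x tc by auto
    note kc = tr_carrier[OF k(1)]
    have same: "x \<otimes> tr n j \<in> coset n (tr n k) \<longleftrightarrow> i = j"
    proof
      assume j: "x \<otimes> tr n j \<in> coset n (tr n k)"
      have "inv (inv (tr n k) \<otimes> (x \<otimes> tr n i)) \<otimes> (inv (tr n k) \<otimes> (x \<otimes> tr n j)) \<in> S n"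
        by (rule S_mult[OF S_inv]) (use j k in \<open>auto simp: coset_def\<close>)
      also have "inv (inv (tr n k) \<otimes> (x \<otimes> tr n i)) \<otimes> (inv (tr n k) \<otimes> (x \<otimes> tr n j)) = inv (tr n i) \<otimes> tr n j"
      proof -
        have "inv (inv (tr n k) \<otimes> (x \<otimes> tr n i)) \<otimes> (inv (tr n k) \<otimes> (x \<otimes> tr n j))
            = inv (tr n i) \<otimes> (inv x \<otimes> (tr n k \<otimes> (inv (tr n k) \<otimes> (x \<otimes> tr n j))))"
          using tc kc x by (simp add: inv_mult_group m_assoc)
        also have "tr n k \<otimes> (inv (tr n k) \<otimes> (x \<otimes> tr n j)) = x \<otimes> tr n j"
          using tc kc x by (simp add: m_assoc[symmetric])
        also have "inv x \<otimes> (x \<otimes> tr n j) = tr n j"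
          using tc x by (simp add: m_assoc[symmetric])
        finally show ?thesis .
      qed
      finally show "i = j" by (rule coset_tr_eq_iff[OF ij])
    qed (use k in simp)
    have "(mat_adjoint (coset_rep n x) * coset_rep n x) $$ (i, j)
        = (\<Sum>l<index n. mat_adjoint (coset_rep n x) $$ (i, l) * coset_rep n x $$ (l, j))"
      using carr ij by (intro mat_mult_index) auto
    also have "\<dots> = (\<Sum>l<index n. indicator (coset n (tr n l)) (x \<otimes> tr n i) * indicator (coset n (tr n l)) (x \<otimes> tr n j))"
    proof (intro sum.cong refl)
      fix l assume "l \<in> {..<index n}"
      then have l: "l < index n" by simp
      have "mat_adjoint (coset_rep n x) $$ (i, l) = cnj (coset_rep n x $$ (l, i))"
        using carr[of x] ij l by simp
      then show "mat_adjoint (coset_rep n x) $$ (i, l) * coset_rep n x $$ (l, j)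
          = indicator (coset n (tr n l)) (x \<otimes> tr n i) * indicator (coset n (tr n l)) (x \<otimes> tr n j)"
        using ij l by (simp add: idx indicator_def)
    qed
    also have "\<dots> = indicator (coset n (tr n k)) (x \<otimes> tr n j)"
      by (rule sum_transversal[OF k])
    also have "\<dots> = 1\<^sub>m (index n) $$ (i, j)"
      using ij same by (simp add: indicator_def)
    finally show "(mat_adjoint (coset_rep n x) * coset_rep n x) $$ (i, j) = 1\<^sub>m (index n) $$ (i, j)" .
  qed (use carr[of x] in auto)
  have cont: "continuous_map T euclidean (\<lambda>x. coset_rep n x $$ (i, j))" if ij: "i < index n" "j < index n" for i j
  proof -
    note tc = tr_carrier[OF ij(1)] tr_carrier[OF ij(2)]
    let ?A = "{x \<in> topspace T. inv (tr n i) \<otimes> x \<otimes> tr n j \<in> S n}"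
    have c: "continuous_map T T (\<lambda>x. inv (tr n i) \<otimes> x \<otimes> tr n j)"
      using tc by (intro continuous_map_translate) auto
    have "continuous_map T euclidean (\<lambda>x. if x \<in> ?A then 1 else 0 :: complex)"
      by (intro continuous_map_clopen_indicator openin_continuous_map_preimage[OF c]
          closedin_continuous_map_preimage[OF c] open_S closedin_S)
    then show ?thesis
    proof (rule continuous_map_eq)
      fix x assume x: "x \<in> topspace T"
      then show "(if x \<in> ?A then 1 else 0) = coset_rep n x $$ (i, j)"
        using tc ij by (simp add: idx indicator_def coset_def topspace_eq m_assoc)
    qed
  qed
  show ?thesis
    using mult unit cont by (simp add: unitary_reps_def rep_dim_coset_rep)
qed

text \<open>Indicators of cosets are themselves matrix coefficients: column \<open>i\<close>,
  belonging to the coset \<open>S n\<close> of the identity, has the entry \<open>1\<close> in row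
  \<open>j\<close> exactly when \<open>x\<close> lies in the coset of \<open>tr n j\<close>.\<close>

lemma coset_integral_null:
  assumes g: "integrable \<mu> g" and null: "fourier_null g (coset_rep n)" and j: "j < index n"
  shows "(\<integral>x. g x * indicator (coset n (tr n j)) x \<partial>\<mu>) = 0"
proof -
  obtain i where i: "i < index n" "\<one> \<in> coset n (tr n i)"
    using transversal_obtain[of \<one> n] by auto
  have "0 = (\<integral>x. g x * cnj (coset_rep n x $$ (j, i)) \<partial>\<mu>)"
    using null i j by (simp add: fourier_null_def rep_dim_coset_rep)
  also have "\<dots> = (\<integral>x. g x * indicator (coset n (tr n j)) x \<partial>\<mu>)"
  proof (intro Bochner_Integration.integral_cong refl)
    fix x assume "x \<in> space \<mu>"
    then have x: "x \<in> carrier G" by simp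
    have "x \<otimes> tr n i \<in> coset n (tr n j) \<longleftrightarrow> x \<in> coset n (tr n j)"
      using coset_left_mult[OF tr_carrier[OF j] x tr_carrier[OF i(1)] i(2)] x by simp
    then show "g x * cnj (coset_rep n x $$ (j, i)) = g x * indicator (coset n (tr n j)) x"
      using i j by (simp add: coset_rep_def indicator_def)
  qed
  finally show ?thesis ..
qed

lemma trivial_on_coset:
  assumes u: "\<xi> \<in> unitary_reps G T" and tr: "trivial_on n \<xi>" and t: "t \<in> carrier G" and x: "x \<in> coset n t"
  shows "\<xi> x = \<xi> t"
proof -
  have xc: "x \<in> carrier G" "inv t \<otimes> x \<in> S n" using x by (auto simp: coset_def)
  have "x = t \<otimes> (inv t \<otimes> x)" using t xc by (simp add: m_assoc[symmetric])
  then have "\<xi> x = \<xi> t * \<xi> (inv t \<otimes> x)"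
    using unitary_rep_mult[OF u t, of "inv t \<otimes> x"] t xc by simp
  also have "\<xi> (inv t \<otimes> x) = 1\<^sub>m (rep_dim G \<xi>)" using tr xc by (simp add: trivial_on_def)
  finally show ?thesis using unitary_rep_carrier[OF u t] by simp
qed

lemma coset_S_iff:
  assumes t: "t \<in> carrier G" and x: "x \<in> coset n t"
  shows "x \<in> S n \<longleftrightarrow> t \<in> S n"
proof -
  have xc: "x \<in> carrier G" "inv t \<otimes> x \<in> S n" using x by (auto simp: coset_def)
  have "x = t \<otimes> (inv t \<otimes> x)" using t xc by (simp add: m_assoc[symmetric])
  then show ?thesis using S_mult_right_iff[OF xc(2) t] by simp
qed

definition level_dual :: "nat \<Rightarrow> ('a \<Rightarrow> complex mat) set set" where
  "level_dual n = {c \<in> unitary_dual G T. trivial_on n (representative c)}"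

abbreviation dual_dim :: "('a \<Rightarrow> complex mat) set \<Rightarrow> nat" where
  "dual_dim c \<equiv> rep_dim G (representative c)"

text \<open>By complete reducibility of the coset representation only finitely many irreducibles can
  be non-orthogonal to the indicator of \<open>S n\<close>.\<close>

lemma finite_level_dual: "finite (level_dual n)"
proof -
  obtain \<Sigma> where S: "finite \<Sigma>" "\<Sigma> \<subseteq> irreducible_reps G T"
    "\<And>g. integrable \<mu> g \<Longrightarrow> (\<forall>\<sigma>\<in>\<Sigma>. fourier_null g \<sigma>) \<Longrightarrow> fourier_null g (coset_rep n)"
    using complete_reducibility[OF coset_rep_unitary_rep[of n]] by blast
  have "level_dual n \<subseteq> (\<lambda>\<sigma>. rep_equiv G T `` {\<sigma>}) ` \<Sigma>"
  proof
    fix c assume c: "c \<in> level_dual n"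
    then have cd: "c \<in> unitary_dual G T" and triv: "trivial_on n (representative c)"
      by (auto simp: level_dual_def)
    let ?\<xi> = "representative c"
    have xi: "?\<xi> \<in> irreducible_reps G T" by (rule representative_irreducible[OF cd])
    note u = irreducible_unitary[OF xi] and d = irreducible_dim_pos[OF xi]
    let ?g = "\<lambda>x. ?\<xi> x $$ (0, 0)"
    have g: "integrable \<mu> ?g" using u d by (intro L2_integrable unitary_rep_L2)
    have "\<exists>\<sigma>\<in>\<Sigma>. (\<sigma>, ?\<xi>) \<in> rep_equiv G T"
    proof (rule ccontr)
      assume *: "\<not> ?thesis"
      \<comment> \<open>By Schur orthogonality an irreducible inequivalent to all of
        \<open>\<Sigma>\<close> is orthogonal to \<open>\<Sigma>\<close>, hence to the coset of the
        identity. But its \<open>(0, 0)\<close> entry equals \<open>1\<close> on that coset, which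
        has positive measure.\<close>
      have "fourier_null ?g \<sigma>" if "\<sigma> \<in> \<Sigma>" for \<sigma>
        unfolding fourier_null_def
        using schur_orthogonality_inequivalent[OF xi, of \<sigma>] that * S(2) d by blast
      then have null: "fourier_null ?g (coset_rep n)" using S(3)[OF g] by blast
      obtain k where k: "k < index n" "\<one> \<in> coset n (tr n k)"
        using transversal_obtain[of \<one> n] by auto
      have "?g x * indicator (coset n (tr n k)) x = indicator (coset n (tr n k)) x" if "x \<in> space \<mu>" for x
      proof (cases "x \<in> coset n (tr n k)")
        case True
        then have "?\<xi> x = ?\<xi> \<one>"
          using trivial_on_coset[OF u triv tr_carrier[OF k(1)]] k(2) by metis
        then show ?thesis using unitary_rep_one[OF u] d by simp
      qed simp
      then have "(\<integral>x. ?g x * indicator (coset n (tr n k)) x \<partial>\<mu>) = (\<integral>x. indicator (coset n (tr n k)) x \<partial>\<mu>)"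
        by (intro Bochner_Integration.integral_cong refl)
      then have "0 = (\<integral>x. indicator (coset n (tr n k)) x \<partial>\<mu> :: complex)"
        using coset_integral_null[OF g null k(1)] by simp
      also have "\<dots> = of_real (measure \<mu> (coset n (tr n k)))"
        using tr_carrier[OF k(1)] by (intro integral_indicator_complex coset_sets)
      also have "\<dots> \<noteq> 0"
        using tr_carrier[OF k(1)] index_pos[of n] by (simp add: measure_coset measure_S)
      finally show False by simp
    qed
    then obtain \<sigma> where s: "\<sigma> \<in> \<Sigma>" "(\<sigma>, ?\<xi>) \<in> rep_equiv G T" by blast
    have "c = rep_equiv G T `` {?\<xi>}"
      using cd representative_in[OF cd] quotientI[OF xi, of "rep_equiv G T"] equiv_class_self[OF equiv_rep_equiv xi]
        quotient_disj[OF equiv_rep_equiv, of c "rep_equiv G T `` {?\<xi>}"] by (auto simp: unitary_dual_def)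
    also have "\<dots> = rep_equiv G T `` {\<sigma>}"
      using equiv_class_eq[OF equiv_rep_equiv s(2)] by simp
    finally show "c \<in> (\<lambda>\<sigma>. rep_equiv G T `` {\<sigma>}) ` \<Sigma>" using s(1) by blast
  qed
  then show ?thesis using S(1) finite_surj by blast
qed

text \<open>When \<open>S n\<close> is normal this is the character of the regular representation of
  the quotient, lifted to \<open>G\<close>.\<close>

definition level_char :: "nat \<Rightarrow> 'a \<Rightarrow> complex" where
  "level_char n x = (\<Sum>c\<in>level_dual n. of_nat (dual_dim c) * (\<Sum>i<dual_dim c. representative c x $$ (i, i)))"

lemma representative_orthogonality:
  assumes c: "c \<in> unitary_dual G T" and c': "c' \<in> unitary_dual G T"
    and idx: "a < dual_dim c" "b < dual_dim c" "i < dual_dim c'" "j < dual_dim c'"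
  shows "(\<integral>x. representative c x $$ (a, b) * cnj (representative c' x $$ (i, j)) \<partial>\<mu>)
    = (if c = c' \<and> a = i \<and> b = j then 1 / of_nat (dual_dim c) else 0)"
proof (cases "c = c'")
  case True
  then show ?thesis
    using schur_orthogonality[OF representative_irreducible[OF c] idx(1,2)] idx by simp
next
  case False
  then have "(representative c', representative c) \<notin> rep_equiv G T"
    using representative_eqI[OF c' c] by blast
  then show ?thesis
    using schur_orthogonality_inequivalent[OF representative_irreducible[OF c] representative_irreducible[OF c']]
      idx False by simp
qed

end

section \<open>Character identity and Plancherel on one level\<close>

context vilenkin_haar_A
begin

text \<open>The dimensions on one side and the index on the other are normalized so that both
  functions pair with the entry \<open>(i, j)\<close> of a class in \<open>level_dual n\<close> to
  \<open>1\<close> if \<open>i = j\<close> and to \<open>0\<close> otherwise, and with any other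
  class to \<open>0\<close>. Complete reducibility transfers the equality of pairings to the coset
  indicators, which detect a function constant on cosets.\<close>

lemma level_char_eq:
  assumes x: "x \<in> carrier G"
  shows "level_char n x = of_nat (index n) * indicator (S n) x"
proof -
  define g where "g x = level_char n x - of_nat (index n) * indicator (S n) x" for x
  have mem: "c \<in> unitary_dual G T" "representative c \<in> unitary_reps G T" "trivial_on n (representative c)"
    if "c \<in> level_dual n" for c
    using that representative_irreducible irreducible_unitary by (auto simp: level_dual_def)
  have iS: "integrable \<mu> (\<lambda>x. of_nat (index n) * indicator (S n) x :: complex)"
    by (intro integrable_mult_right L2_integrable indicator_L2 S_sets)
  have iD: "integrable \<mu> (\<lambda>x. level_char n x)"
    unfolding level_char_def using mem
    by (intro Bochner_Integration.integrable_sum integrable_mult_right L2_integrable unitary_rep_L2) auto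
  have g: "integrable \<mu> g" unfolding g_def using iS iD by (rule Bochner_Integration.integrable_diff[rotated])
  have null_rep: "fourier_null g (representative c')" if c': "c' \<in> unitary_dual G T" for c'
    unfolding fourier_null_def
  proof (intro allI impI)
    fix i j assume ij: "i < dual_dim c'" "j < dual_dim c'"
    let ?\<xi> = "representative c'"
    have xi: "?\<xi> \<in> irreducible_reps G T" by (rule representative_irreducible[OF c'])
    note u = irreducible_unitary[OF xi]
    have D: "(\<integral>x. level_char n x * cnj (?\<xi> x $$ (i, j)) \<partial>\<mu>) = (if c' \<in> level_dual n \<and> i = j then 1 else 0)"
    proof -
      have "(\<integral>x. level_char n x * cnj (?\<xi> x $$ (i, j)) \<partial>\<mu>)
        = (\<integral>x. (\<Sum>c\<in>level_dual n. \<Sum>a<dual_dim c. of_nat (dual_dim c) *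
            (representative c x $$ (a, a) * cnj (?\<xi> x $$ (i, j)))) \<partial>\<mu>)"
        by (simp add: level_char_def sum_distrib_right sum_distrib_left mult_ac)
      also have "\<dots> = (\<Sum>c\<in>level_dual n. \<integral>x. (\<Sum>a<dual_dim c. of_nat (dual_dim c) *
            (representative c x $$ (a, a) * cnj (?\<xi> x $$ (i, j)))) \<partial>\<mu>)"
        using mem u ij by (intro Bochner_Integration.integral_sum Bochner_Integration.integrable_sum
            integrable_mult_right integrable_rep_entries) auto
      also have "\<dots> = (\<Sum>c\<in>level_dual n. \<Sum>a<dual_dim c. \<integral>x. of_nat (dual_dim c) *
            (representative c x $$ (a, a) * cnj (?\<xi> x $$ (i, j))) \<partial>\<mu>)"
        using mem u ij by (intro sum.cong refl Bochner_Integration.integral_sum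
            integrable_mult_right integrable_rep_entries) auto
      also have "\<dots> = (\<Sum>c\<in>level_dual n. \<Sum>a<dual_dim c. if a = i then (if c = c' \<and> i = j then 1 else 0) else 0)"
      proof (intro sum.cong refl)
        fix c a assume "c \<in> level_dual n" "a \<in> {..<dual_dim c}"
        then show "(\<integral>x. of_nat (dual_dim c) * (representative c x $$ (a, a) * cnj (?\<xi> x $$ (i, j))) \<partial>\<mu>)
            = (if a = i then (if c = c' \<and> i = j then 1 else 0) else 0)"
          using representative_orthogonality[OF mem(1) c', of c a a i j] ij by auto
      qed
      also have "\<dots> = (\<Sum>c\<in>level_dual n. if c = c' then (if i = j then 1 else 0) else 0)"
        using ij by (intro sum.cong refl) auto
      also have "\<dots> = (if c' \<in> level_dual n \<and> i = j then 1 else 0)"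
        using finite_level_dual by simp
      finally show ?thesis .
    qed
    \<comment> \<open>Here Condition (A) enters, through \<open>integral_S_null\<close>: classes
      outside \<open>level_dual n\<close> do not see the indicator of \<open>S n\<close>.\<close>
    have Sn: "(\<integral>x. of_nat (index n) * indicator (S n) x * cnj (?\<xi> x $$ (i, j)) \<partial>\<mu>)
        = (if c' \<in> level_dual n \<and> i = j then 1 else 0)"
    proof (cases "trivial_on n ?\<xi>")
      case True
      then show ?thesis
        using integral_S_trivial[OF u True ij] c' index_pos[of n] by (simp add: level_dual_def mult.assoc)
    next
      case False
      then show ?thesis
        using integral_S_null[OF xi False ij] by (simp add: level_dual_def mult.assoc)
    qed
    have "(\<integral>x. g x * cnj (?\<xi> x $$ (i, j)) \<partial>\<mu>)
        = (\<integral>x. level_char n x * cnj (?\<xi> x $$ (i, j)) - of_nat (index n) * indicator (S n) x * cnj (?\<xi> x $$ (i, j)) \<partial>\<mu>)"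
      by (simp add: g_def left_diff_distrib)
    also have "\<dots> = 0"
      using u ij iD iS D Sn
      by (subst Bochner_Integration.integral_diff) (auto intro!: integrable_times_rep)
    finally show "(\<integral>x. g x * cnj (?\<xi> x $$ (i, j)) \<partial>\<mu>) = 0" .
  qed
  have "fourier_null g \<sigma>" if s: "\<sigma> \<in> irreducible_reps G T" for \<sigma>
    using irreducible_representative[OF s] null_rep fourier_null_equiv[OF _ g] by metis
  then have null: "fourier_null g (coset_rep n)"
    using complete_reducibility[OF coset_rep_unitary_rep[of n]] g by blast
  obtain k where k: "k < index n" "x \<in> coset n (tr n k)" using transversal_obtain[OF x] by blast
  have const: "g y = g (tr n k)" if y: "y \<in> coset n (tr n k)" for y
  proof -
    have "level_char n y = level_char n (tr n k)"
      unfolding level_char_def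
      using trivial_on_coset[OF mem(2,3) tr_carrier[OF k(1)] y] by (intro sum.cong refl) simp
    then show ?thesis
      using coset_S_iff[OF tr_carrier[OF k(1)] y] by (simp add: g_def indicator_def)
  qed
  have "0 = (\<integral>y. g y * indicator (coset n (tr n k)) y \<partial>\<mu>)"
    using coset_integral_null[OF g null k(1)] ..
  also have "\<dots> = (\<integral>y. g (tr n k) * indicator (coset n (tr n k)) y \<partial>\<mu>)"
    using const by (intro Bochner_Integration.integral_cong) (auto simp: indicator_def)
  also have "\<dots> = g (tr n k) * of_real (measure \<mu> (coset n (tr n k)))"
    using integral_indicator_complex[OF coset_sets[OF tr_carrier[OF k(1)]]] by simp
  finally have "g (tr n k) = 0"
    using tr_carrier[OF k(1)] index_pos[of n] by (simp add: measure_coset measure_S)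
  then show ?thesis using const[OF k(2)] by (simp add: g_def)
qed

lemma fourier_coeff_coset_sum:
  assumes u: "integrable \<mu> u" and xi: "\<xi> \<in> unitary_reps G T" and tr: "trivial_on n \<xi>"
    and ij: "i < rep_dim G \<xi>" "j < rep_dim G \<xi>"
  shows "fourier_coeff G \<mu> u \<xi> $$ (i, j)
    = (\<Sum>k<index n. (\<integral>x. u x * indicator (coset n (tr n k)) x \<partial>\<mu>) * cnj (\<xi> (tr n k) $$ (j, i)))"
proof -
  have "fourier_coeff G \<mu> u \<xi> $$ (i, j) = (\<integral>x. u x * cnj (\<xi> x $$ (j, i)) \<partial>\<mu>)"
    by (rule fourier_coeff_index[OF xi ij])
  also have "\<dots> = (\<integral>x. (\<Sum>k<index n. u x * indicator (coset n (tr n k)) x * cnj (\<xi> (tr n k) $$ (j, i))) \<partial>\<mu>)"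
  proof (intro Bochner_Integration.integral_cong refl)
    fix x assume "x \<in> space \<mu>"
    then obtain k where k: "k < index n" "x \<in> coset n (tr n k)" using transversal_obtain[of x n] by auto
    have "(\<Sum>k<index n. u x * indicator (coset n (tr n k)) x * cnj (\<xi> (tr n k) $$ (j, i)))
        = (\<Sum>k<index n. indicator (coset n (tr n k)) x * (u x * cnj (\<xi> (tr n k) $$ (j, i))))"
      by (simp add: mult_ac)
    also have "\<dots> = u x * cnj (\<xi> (tr n k) $$ (j, i))" by (rule sum_transversal[OF k])
    also have "\<xi> (tr n k) = \<xi> x" using trivial_on_coset[OF xi tr tr_carrier[OF k(1)] k(2)] by simp
    finally show "u x * cnj (\<xi> x $$ (j, i))
        = (\<Sum>k<index n. u x * indicator (coset n (tr n k)) x * cnj (\<xi> (tr n k) $$ (j, i)))" by simp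
  qed
  also have "\<dots> = (\<Sum>k<index n. \<integral>x. u x * indicator (coset n (tr n k)) x * cnj (\<xi> (tr n k) $$ (j, i)) \<partial>\<mu>)"
    using u tr_carrier
    by (intro Bochner_Integration.integral_sum integrable_mult_left integrable_times_bounded[where B = 1])
      (auto simp: indicator_def)
  finally show ?thesis by simp
qed

text \<open>The left side is a quadratic form in the coset integrals with kernel
  \<open>level_char n (inv (tr n k) \<otimes> tr n l)\<close>. By \<open>level_char_eq\<close> the
  kernel is diagonal, since distinct transversal elements never differ by an element of
  \<open>S n\<close>.\<close>

lemma finite_plancherel:
  assumes u: "integrable \<mu> u"
  shows "(\<Sum>c\<in>level_dual n. real (dual_dim c) * (HS_norm (fourier_coeff G \<mu> u (representative c)))\<^sup>2)
    = real (index n) * (\<Sum>k<index n. (cmod (\<integral>x. u x * indicator (coset n (tr n k)) x \<partial>\<mu>))\<^sup>2)"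
proof -
  define a where "a k = (\<integral>x. u x * indicator (coset n (tr n k)) x \<partial>\<mu>)" for k
  have mem: "c \<in> unitary_dual G T" "representative c \<in> unitary_reps G T" "trivial_on n (representative c)"
    if "c \<in> level_dual n" for c
    using that representative_irreducible irreducible_unitary by (auto simp: level_dual_def)
  have tc: "inv (tr n k) \<otimes> tr n l \<in> carrier G" if "k < index n" "l < index n" for k l
    using that tr_carrier by simp
  have HS: "complex_of_real ((HS_norm (fourier_coeff G \<mu> u (representative c)))\<^sup>2)
      = (\<Sum>k<index n. \<Sum>l<index n. a k * cnj (a l) *
          (\<Sum>i<dual_dim c. representative c (inv (tr n k) \<otimes> tr n l) $$ (i, i)))"
    if c: "c \<in> level_dual n" for c
  proof -
    let ?\<xi> = "representative c" and ?d = "dual_dim c"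
    note m = mem[OF c]
    have dims: "dim_row (fourier_coeff G \<mu> u ?\<xi>) = ?d" "dim_col (fourier_coeff G \<mu> u ?\<xi>) = ?d"
      by (simp_all add: fourier_coeff_def)
    have "complex_of_real ((HS_norm (fourier_coeff G \<mu> u ?\<xi>))\<^sup>2)
        = (\<Sum>i<?d. \<Sum>j<?d. \<Sum>k<index n. \<Sum>l<index n.
            (a k * cnj (a l)) * (cnj (?\<xi> (tr n k) $$ (j, i)) * ?\<xi> (tr n l) $$ (j, i)))"
      unfolding HS_norm_square dims
    proof (intro sum.cong refl)
      fix i j assume "i \<in> {..<?d}" "j \<in> {..<?d}"
      then have "fourier_coeff G \<mu> u ?\<xi> $$ (i, j) = (\<Sum>k<index n. a k * cnj (?\<xi> (tr n k) $$ (j, i)))"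
        using fourier_coeff_coset_sum[OF u m(2,3)] by (simp add: a_def)
      then have "fourier_coeff G \<mu> u ?\<xi> $$ (i, j) * cnj (fourier_coeff G \<mu> u ?\<xi> $$ (i, j))
          = (\<Sum>k<index n. \<Sum>l<index n. (a k * cnj (?\<xi> (tr n k) $$ (j, i))) * cnj (a l * cnj (?\<xi> (tr n l) $$ (j, i))))"
        by (simp only: cnj_sum sum_product)
      then show "fourier_coeff G \<mu> u ?\<xi> $$ (i, j) * cnj (fourier_coeff G \<mu> u ?\<xi> $$ (i, j))
          = (\<Sum>k<index n. \<Sum>l<index n. (a k * cnj (a l)) * (cnj (?\<xi> (tr n k) $$ (j, i)) * ?\<xi> (tr n l) $$ (j, i)))"
        by (simp add: mult_ac)
    qed
    also have "\<dots> = (\<Sum>i<?d. \<Sum>k<index n. \<Sum>l<index n. \<Sum>j<?d.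
            (a k * cnj (a l)) * (cnj (?\<xi> (tr n k) $$ (j, i)) * ?\<xi> (tr n l) $$ (j, i)))"
      by (rule sum.cong[OF refl], rule sum_rotate3)
    also have "\<dots> = (\<Sum>k<index n. \<Sum>l<index n. \<Sum>i<?d. \<Sum>j<?d.
            (a k * cnj (a l)) * (cnj (?\<xi> (tr n k) $$ (j, i)) * ?\<xi> (tr n l) $$ (j, i)))"
      by (rule sum_rotate3)
    \<comment> \<open>The sums over \<open>i\<close> and \<open>j\<close> form the trace of the
      adjoint of \<open>?\<xi> (tr n k)\<close> times \<open>?\<xi> (tr n l)\<close>, and
      multiplicativity merges the two factors.\<close>
    also have "\<dots> = (\<Sum>k<index n. \<Sum>l<index n. a k * cnj (a l) *
          (\<Sum>i<?d. ?\<xi> (inv (tr n k) \<otimes> tr n l) $$ (i, i)))"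
    proof (intro sum.cong refl)
      fix k l assume "k \<in> {..<index n}" "l \<in> {..<index n}"
      then have kl: "tr n k \<in> carrier G" "tr n l \<in> carrier G" using tr_carrier by auto
      have "?\<xi> (inv (tr n k) \<otimes> tr n l) $$ (i, i) = (\<Sum>j<?d. cnj (?\<xi> (tr n k) $$ (j, i)) * ?\<xi> (tr n l) $$ (j, i))"
        if "i < ?d" for i
        using unitary_rep_mult_index[OF m(2) _ kl(2) that that, of "inv (tr n k)"] kl
          unitary_rep_inv_index[OF m(2) kl(1) that] by simp
      then show "(\<Sum>i<?d. \<Sum>j<?d. (a k * cnj (a l)) * (cnj (?\<xi> (tr n k) $$ (j, i)) * ?\<xi> (tr n l) $$ (j, i)))
          = a k * cnj (a l) * (\<Sum>i<?d. ?\<xi> (inv (tr n k) \<otimes> tr n l) $$ (i, i))"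
        by (simp add: sum_distrib_left)
    qed
    finally show ?thesis .
  qed
  have "complex_of_real (\<Sum>c\<in>level_dual n. real (dual_dim c) * (HS_norm (fourier_coeff G \<mu> u (representative c)))\<^sup>2)
      = (\<Sum>c\<in>level_dual n. of_nat (dual_dim c) * complex_of_real ((HS_norm (fourier_coeff G \<mu> u (representative c)))\<^sup>2))"
    by simp
  also have "\<dots> = (\<Sum>c\<in>level_dual n. \<Sum>k<index n. \<Sum>l<index n. a k * cnj (a l) *
      (of_nat (dual_dim c) * (\<Sum>i<dual_dim c. representative c (inv (tr n k) \<otimes> tr n l) $$ (i, i))))"
    by (intro sum.cong refl) (simp only: HS sum_distrib_left mult_ac)
  also have "\<dots> = (\<Sum>k<index n. \<Sum>l<index n. \<Sum>c\<in>level_dual n. a k * cnj (a l) *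
      (of_nat (dual_dim c) * (\<Sum>i<dual_dim c. representative c (inv (tr n k) \<otimes> tr n l) $$ (i, i))))"
    by (rule sum_rotate3)
  also have "\<dots> = (\<Sum>k<index n. \<Sum>l<index n. a k * cnj (a l) * level_char n (inv (tr n k) \<otimes> tr n l))"
    by (simp add: level_char_def sum_distrib_left)
  also have "\<dots> = (\<Sum>k<index n. \<Sum>l<index n. if l = k then of_nat (index n) * (a k * cnj (a k)) else 0)"
  proof (intro sum.cong refl)
    fix k l assume "k \<in> {..<index n}" "l \<in> {..<index n}"
    then have kl: "k < index n" "l < index n" by auto
    have "inv (tr n k) \<otimes> tr n l \<in> S n \<longleftrightarrow> l = k"
      using coset_tr_eq_iff[OF kl] tr_carrier[OF kl(1)] by auto
    then show "a k * cnj (a l) * level_char n (inv (tr n k) \<otimes> tr n l)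
        = (if l = k then of_nat (index n) * (a k * cnj (a k)) else 0)"
      unfolding level_char_eq[OF tc[OF kl]] by (simp add: indicator_def mult_ac)
  qed
  also have "\<dots> = complex_of_real (real (index n) * (\<Sum>k<index n. (cmod (a k))\<^sup>2))"
    by (simp add: sum_distrib_left complex_norm_square del: of_real_power)
  finally show ?thesis
    unfolding a_def using of_real_eq_iff by blast
qed

end

section \<open>Density of step functions\<close>

context vilenkin_haar
begin

lemma coset_mono: "m \<le> n \<Longrightarrow> coset n t \<subseteq> coset m t"
  using S_mono by (auto simp: coset_def)

lemma coset_subset: "coset n t \<subseteq> carrier G"
  by (auto simp: coset_def)

lemma coset_trans:
  assumes "s \<in> carrier G" "t \<in> coset n s" "x \<in> coset n t"
  shows "x \<in> coset n s"
proof -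
  have t: "t \<in> carrier G" "x \<in> carrier G" using assms by (auto simp: coset_def)
  show ?thesis
    using coset_left_mult[OF assms(1) one_closed t(1) assms(3)] assms(2) t by simp
qed

lemma coset_sym:
  assumes "s \<in> carrier G" "t \<in> coset n s"
  shows "s \<in> coset n t"
proof -
  have t: "t \<in> carrier G" "inv s \<otimes> t \<in> S n" using assms by (auto simp: coset_def)
  have "inv (inv s \<otimes> t) \<in> S n" using t S_inv by blast
  then show ?thesis using assms t by (simp add: coset_def inv_mult_group)
qed

definition step_fun :: "nat \<Rightarrow> ('a \<Rightarrow> complex) \<Rightarrow> bool" where
  "step_fun n s \<longleftrightarrow> (\<forall>t\<in>carrier G. \<forall>x\<in>coset n t. s x = s t)"

lemma step_fun_mono: "m \<le> n \<Longrightarrow> step_fun m s \<Longrightarrow> step_fun n s"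
  using coset_mono unfolding step_fun_def by blast

lemma step_fun_L2:
  assumes s: "step_fun n s"
  shows "s \<in> L2 \<mu>"
proof (rule L2_cong)
  show "(\<lambda>x. \<Sum>k<index n. s (tr n k) * indicator (coset n (tr n k)) x) \<in> L2 \<mu>"
    using tr_carrier by (intro L2_sum L2_scale indicator_L2 coset_sets) auto
  fix x assume "x \<in> carrier G"
  then obtain k where k: "k < index n" "x \<in> coset n (tr n k)" using transversal_obtain by blast
  have "(\<Sum>k<index n. s (tr n k) * indicator (coset n (tr n k)) x)
      = (\<Sum>k<index n. indicator (coset n (tr n k)) x * s (tr n k))" by (simp add: mult.commute)
  also have "\<dots> = s (tr n k)" by (rule sum_transversal[OF k])
  also have "\<dots> = s x" using s k tr_carrier[OF k(1)] by (simp add: step_fun_def)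
  finally show "(\<Sum>k<index n. s (tr n k) * indicator (coset n (tr n k)) x) = s x" .
qed

text \<open>Membership in the closure of the step functions. The distance is kept squared to avoid
  square roots; the triangle inequality then costs a factor \<open>2\<close>.\<close>

definition approximable :: "('a \<Rightarrow> complex) \<Rightarrow> bool" where
  "approximable u \<longleftrightarrow> u \<in> L2 \<mu> \<and>
    (\<forall>\<epsilon>>0. \<exists>n s. step_fun n s \<and> (\<integral>x. (cmod (u x - s x))\<^sup>2 \<partial>\<mu>) \<le> \<epsilon>)"

lemma approximable_step: "step_fun n s \<Longrightarrow> approximable s"
  unfolding approximable_def using step_fun_L2 by (auto intro!: exI[of _ n] exI[of _ s])

lemma approximable_add:
  assumes u: "approximable u" and v: "approximable v"
  shows "approximable (\<lambda>x. u x + v x)"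
  unfolding approximable_def
proof (intro conjI allI impI)
  have L: "u \<in> L2 \<mu>" "v \<in> L2 \<mu>" using u v by (auto simp: approximable_def)
  then show "(\<lambda>x. u x + v x) \<in> L2 \<mu>" by (rule L2_add)
  fix \<epsilon> :: real assume e: "\<epsilon> > 0"
  \<comment> \<open>A quarter for each function: the squared triangle inequality doubles both errors
    before they are added.\<close>
  obtain m s where s: "step_fun m s" "(\<integral>x. (cmod (u x - s x))\<^sup>2 \<partial>\<mu>) \<le> \<epsilon> / 4"
    using u e unfolding approximable_def by (meson divide_pos_pos zero_less_numeral)
  obtain n t where t: "step_fun n t" "(\<integral>x. (cmod (v x - t x))\<^sup>2 \<partial>\<mu>) \<le> \<epsilon> / 4"
    using v e unfolding approximable_def by (meson divide_pos_pos zero_less_numeral)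
  have "step_fun (max m n) s" "step_fun (max m n) t"
    using step_fun_mono s(1) t(1) by (meson max.cobounded1, meson max.cobounded2)
  then have "step_fun (max m n) (\<lambda>x. s x + t x)" by (simp add: step_fun_def)
  moreover have "(\<integral>x. (cmod (u x + v x - (s x + t x)))\<^sup>2 \<partial>\<mu>) \<le> \<epsilon>"
  proof -
    have "(\<integral>x. (cmod (u x + v x - (s x + t x)))\<^sup>2 \<partial>\<mu>) = (\<integral>x. (cmod ((u x - s x) + (v x - t x)))\<^sup>2 \<partial>\<mu>)"
      by (simp add: algebra_simps)
    also have "\<dots> \<le> 2 * (\<integral>x. (cmod (u x - s x))\<^sup>2 \<partial>\<mu>) + 2 * (\<integral>x. (cmod (v x - t x))\<^sup>2 \<partial>\<mu>)"
      by (intro integral_square_triangle L2_diff L step_fun_L2[OF s(1)] step_fun_L2[OF t(1)])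
    finally show ?thesis using s(2) t(2) by linarith
  qed
  ultimately show "\<exists>n w. step_fun n w \<and> (\<integral>x. (cmod (u x + v x - w x))\<^sup>2 \<partial>\<mu>) \<le> \<epsilon>" by blast
qed

lemma approximable_scale:
  assumes u: "approximable u"
  shows "approximable (\<lambda>x. c * u x)"
  unfolding approximable_def
proof (intro conjI allI impI)
  show "(\<lambda>x. c * u x) \<in> L2 \<mu>" using u L2_scale by (simp add: approximable_def)
  fix \<epsilon> :: real assume e: "\<epsilon> > 0"
  \<comment> \<open>The summand \<open>1\<close> in the denominator covers
    \<open>c = 0\<close>.\<close>
  define \<delta> where "\<delta> = \<epsilon> / ((cmod c)\<^sup>2 + 1)"
  have d: "\<delta> > 0" "(cmod c)\<^sup>2 * \<delta> \<le> \<epsilon>"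
    using e by (auto simp: \<delta>_def divide_simps add_nonneg_pos intro: mult_left_mono)
  obtain n s where s: "step_fun n s" "(\<integral>x. (cmod (u x - s x))\<^sup>2 \<partial>\<mu>) \<le> \<delta>"
    using u d(1) unfolding approximable_def by blast
  have "(\<integral>x. (cmod (c * u x - c * s x))\<^sup>2 \<partial>\<mu>) = (cmod c)\<^sup>2 * (\<integral>x. (cmod (u x - s x))\<^sup>2 \<partial>\<mu>)"
    by (simp add: right_diff_distrib[symmetric] norm_mult power_mult_distrib)
  also have "\<dots> \<le> (cmod c)\<^sup>2 * \<delta>" by (intro mult_left_mono s) auto
  also have "\<dots> \<le> \<epsilon>" by (rule d)
  finally have "(\<integral>x. (cmod (c * u x - c * s x))\<^sup>2 \<partial>\<mu>) \<le> \<epsilon>" .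
  moreover have "step_fun n (\<lambda>x. c * s x)" using s(1) by (simp add: step_fun_def)
  ultimately show "\<exists>n w. step_fun n w \<and> (\<integral>x. (cmod (c * u x - w x))\<^sup>2 \<partial>\<mu>) \<le> \<epsilon>" by blast
qed

lemma approximable_sum:
  assumes "finite I" "\<And>i. i \<in> I \<Longrightarrow> approximable (f i)"
  shows "approximable (\<lambda>x. \<Sum>i\<in>I. f i x)"
  using assms
proof (induction I)
  case empty
  have "step_fun 0 (\<lambda>_. 0)" by (simp add: step_fun_def)
  then show ?case using approximable_step by simp
next
  case (insert i I)
  then show ?case using approximable_add[of "f i"] by simp
qed

text \<open>Dominated convergence with majorant \<open>4 * (w x)\<^sup>2\<close>, as both
  \<open>u i\<close> and \<open>v\<close> are bounded by \<open>w\<close>. This closure property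
  carries approximability from open sets to measurable sets and from simple functions to all of
  \<open>L2 \<mu>\<close>.\<close>

lemma approximable_dominated:
  assumes u: "\<And>i. approximable (u i)" and v: "v \<in> borel_measurable \<mu>"
    and lim: "\<And>x. x \<in> carrier G \<Longrightarrow> (\<lambda>i. u i x) \<longlonglongrightarrow> v x"
    and w: "integrable \<mu> (\<lambda>x. (w x)\<^sup>2)"
    and bound: "\<And>i x. x \<in> carrier G \<Longrightarrow> cmod (u i x) \<le> w x"
  shows "approximable v"
  unfolding approximable_def
proof (intro conjI allI impI)
  note [measurable] = v
  have uL: "u i \<in> L2 \<mu>" for i using u by (simp add: approximable_def)
  have [measurable]: "u i \<in> borel_measurable \<mu>" for i using L2_measurable[OF uL] .
  have vb: "cmod (v x) \<le> w x" if "x \<in> carrier G" for x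
    using tendsto_norm[OF lim[OF that]] bound[OF that] by (intro LIMSEQ_le_const2) auto
  show vL: "v \<in> L2 \<mu>"
    unfolding L2_def
  proof (intro CollectI conjI v Bochner_Integration.integrable_bound[OF w])
    show "AE x in \<mu>. norm ((cmod (v x))\<^sup>2) \<le> norm ((w x)\<^sup>2)"
      using vb by (intro AE_I2) (auto intro: power_mono)
  qed measurable
  have "(\<lambda>i. \<integral>x. (cmod (v x - u i x))\<^sup>2 \<partial>\<mu>) \<longlonglongrightarrow> (\<integral>x. 0 \<partial>\<mu>)"
  proof (rule integral_dominated_convergence)
    show "integrable \<mu> (\<lambda>x. 4 * (w x)\<^sup>2)" using w by simp
    show "AE x in \<mu>. (\<lambda>i. (cmod (v x - u i x))\<^sup>2) \<longlonglongrightarrow> 0"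
    proof (rule AE_I2)
      fix x assume "x \<in> space \<mu>"
      then have "(\<lambda>i. (cmod (v x - u i x))\<^sup>2) \<longlonglongrightarrow> (cmod (v x - v x))\<^sup>2"
        using lim by (intro tendsto_intros) auto
      then show "(\<lambda>i. (cmod (v x - u i x))\<^sup>2) \<longlonglongrightarrow> 0" by simp
    qed
    show "AE x in \<mu>. norm ((cmod (v x - u i x))\<^sup>2) \<le> 4 * (w x)\<^sup>2" for i
    proof (rule AE_I2)
      fix x assume "x \<in> space \<mu>"
      then have x: "x \<in> carrier G" by simp
      have "cmod (v x - u i x) \<le> 2 * w x"
        using norm_triangle_ineq4[of "v x" "u i x"] vb[OF x] bound[OF x, of i] by linarith
      then have "(cmod (v x - u i x))\<^sup>2 \<le> (2 * w x)\<^sup>2" by (intro power_mono) auto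
      then show "norm ((cmod (v x - u i x))\<^sup>2) \<le> 4 * (w x)\<^sup>2" by (simp add: power_mult_distrib)
    qed
  qed measurable
  then have lim0: "(\<lambda>i. \<integral>x. (cmod (v x - u i x))\<^sup>2 \<partial>\<mu>) \<longlonglongrightarrow> 0" by simp
  fix \<epsilon> :: real assume e: "\<epsilon> > 0"
  have "\<forall>\<^sub>F i in sequentially. (\<integral>x. (cmod (v x - u i x))\<^sup>2 \<partial>\<mu>) < \<epsilon> / 4"
    using order_tendstoD(2)[OF lim0, of "\<epsilon> / 4"] e by simp
  then obtain i where i: "(\<integral>x. (cmod (v x - u i x))\<^sup>2 \<partial>\<mu>) < \<epsilon> / 4"
    using eventually_happens by force
  obtain n s where s: "step_fun n s" "(\<integral>x. (cmod (u i x - s x))\<^sup>2 \<partial>\<mu>) \<le> \<epsilon> / 4"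
    using u[of i] e unfolding approximable_def by (meson divide_pos_pos zero_less_numeral)
  have "(\<integral>x. (cmod (v x - s x))\<^sup>2 \<partial>\<mu>) = (\<integral>x. (cmod ((v x - u i x) + (u i x - s x)))\<^sup>2 \<partial>\<mu>)"
    by simp
  also have "\<dots> \<le> 2 * (\<integral>x. (cmod (v x - u i x))\<^sup>2 \<partial>\<mu>) + 2 * (\<integral>x. (cmod (u i x - s x))\<^sup>2 \<partial>\<mu>)"
    by (intro integral_square_triangle L2_diff vL uL step_fun_L2[OF s(1)])
  also have "\<dots> \<le> \<epsilon>" using i s(2) by linarith
  finally show "\<exists>n s. step_fun n s \<and> (\<integral>x. (cmod (v x - s x))\<^sup>2 \<partial>\<mu>) \<le> \<epsilon>" using s(1) by blast
qed

text \<open>An open set is the increasing union of the sets \<open>B n\<close> of points whose whole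
  level \<open>n\<close> coset lies inside it; every point of \<open>U\<close> is reached because
  the \<open>S n\<close> are a neighbourhood basis. Each \<open>B n\<close> is a union of
  cosets.\<close>

lemma approximable_open:
  assumes U: "openin T U"
  shows "approximable (indicator U)"
proof (rule approximable_dominated[where w = "\<lambda>_. 1"])
  define B where "B n = {x \<in> carrier G. coset n x \<subseteq> U}" for n
  have "step_fun n (indicator (B n))" for n
    unfolding step_fun_def
  proof (intro ballI)
    fix t x assume t: "t \<in> carrier G" and x: "x \<in> coset n t"
    then have "x \<in> carrier G" using coset_subset by blast
    moreover have "coset n x = coset n t"
      using coset_trans[OF t x] coset_trans[OF \<open>x \<in> carrier G\<close> coset_sym[OF t x]] by blast
    ultimately show "indicator (B n) x = indicator (B n) t" using t by (simp add: B_def indicator_def)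
  qed
  then show "approximable (indicator (B n))" for n by (rule approximable_step)
  show "indicator U \<in> borel_measurable \<mu>" using openin_sets[OF U] by simp
  fix x assume x: "x \<in> carrier G"
  have "\<forall>\<^sub>F n in sequentially. indicator (B n) x = (indicator U x :: complex)"
  proof (cases "x \<in> U")
    case True
    have "openin T {y \<in> topspace T. x \<otimes> y \<in> U}"
      by (rule openin_continuous_map_preimage[OF continuous_map_left_translate[OF x] U])
    then obtain n where n: "S n \<subseteq> {y \<in> topspace T. x \<otimes> y \<in> U}"
      using basis_S[of "{y \<in> topspace T. x \<otimes> y \<in> U}"] x True by (auto simp: topspace_eq)
    have "coset n x \<subseteq> U"
    proof
      fix y assume "y \<in> coset n x"
      then have y: "y \<in> carrier G" "inv x \<otimes> y \<in> S n" by (auto simp: coset_def)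
      then have "x \<otimes> (inv x \<otimes> y) \<in> U" using n by blast
      then show "y \<in> U" using x y by (simp add: m_assoc[symmetric])
    qed
    then have "x \<in> B m" if "m \<ge> n" for m using coset_mono[OF that, of x] x by (auto simp: B_def)
    then show ?thesis using True by (auto simp: eventually_sequentially intro!: exI[of _ n])
  next
    case False
    then have "x \<notin> B n" for n using self_coset[OF x] by (auto simp: B_def)
    then show ?thesis using False by simp
  qed
  then show "(\<lambda>n. indicator (B n) x :: complex) \<longlonglongrightarrow> indicator U x"
    by (rule tendsto_eventually)
  show "cmod (indicator (B n) x) \<le> 1" for n by (simp add: indicator_def)
qed simp

text \<open>Dynkin's theorem with the open sets as generator stable under intersection. Only
  disjoint unions occur, so the partial sums of indicators remain indicators and are dominated by
  \<open>1\<close>.\<close>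

lemma approximable_indicator:
  assumes "A \<in> sets \<mu>"
  shows "approximable (indicator A)"
proof -
  have "Int_stable {U. openin T U}" by (auto simp: Int_stable_def)
  moreover have "{U. openin T U} \<subseteq> Pow (carrier G)" using openin_subset_carrier by auto
  moreover have "A \<in> sigma_sets (carrier G) {U. openin T U}" using assms sets_haar by simp
  ultimately show ?thesis
  proof (induction rule: sigma_sets_induct_disjoint)
    case (basic A)
    then show ?case using approximable_open by simp
  next
    case empty
    show ?case by (rule approximable_open) simp
  next
    case (compl A)
    have "approximable (indicator (carrier G))"
      using approximable_open openin_topspace[of T] by (simp add: topspace_eq)
    then have "approximable (\<lambda>x. indicator (carrier G) x + (-1) * indicator A x)"
      using compl by (intro approximable_add approximable_scale)
    moreover have "A \<subseteq> carrier G"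
      using compl(1) sets.sets_into_space[of A \<mu>] sets_haar by simp
    then have "(\<lambda>x. indicator (carrier G) x + (-1) * indicator A x) = (indicator (carrier G - A) :: 'a \<Rightarrow> complex)"
      by (auto simp: indicator_def fun_eq_iff)
    ultimately show ?case by simp
  next
    case (union A)
    have A: "A i \<in> sets \<mu>" for i using union(2) sets_haar by auto
    show ?case
    proof (rule approximable_dominated[where w = "\<lambda>_. 1"])
      show "approximable (\<lambda>x. \<Sum>i<n. indicator (A i) x)" for n
        using union by (intro approximable_sum) auto
      show "indicator (\<Union>i. A i) \<in> borel_measurable \<mu>" using A by simp
      have eq: "(\<Sum>i<n. indicator (A i) x) = (indicator (\<Union>i<n. A i) x :: complex)" for n x
      proof -
        have "disjoint_family_on A {..<n}" using union(1) by (auto simp: disjoint_family_on_def)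
        then show ?thesis by (simp add: indicator_UN_disjoint)
      qed
      fix x
      show "(\<lambda>n. \<Sum>i<n. indicator (A i) x :: complex) \<longlonglongrightarrow> indicator (\<Union>i. A i) x"
        unfolding eq by (rule LIMSEQ_indicator_UN)
      show "cmod (\<Sum>i<n. indicator (A i) x) \<le> 1" for n
        unfolding eq by (simp add: indicator_def)
    qed simp
  qed
qed

text \<open>Simple functions converging pointwise to \<open>u\<close> can be chosen with modulus at
  most twice that of \<open>u\<close>, which supplies the square-integrable majorant.\<close>

lemma L2_approximable:
  assumes u: "u \<in> L2 \<mu>"
  shows "approximable u"
proof -
  note um = L2_measurable[OF u]
  obtain F where F: "\<And>i. simple_function \<mu> (F i)"
    and lim: "\<And>x. x \<in> space \<mu> \<Longrightarrow> (\<lambda>i. F i x) \<longlonglongrightarrow> u x"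
    and bound: "\<And>i x. x \<in> space \<mu> \<Longrightarrow> dist (F i x) 0 \<le> 2 * dist (u x) 0"
    using borel_measurable_implies_sequence_metric[OF um, of 0] by blast
  have "approximable (F i)" for i
  proof -
    let ?I = "F i ` space \<mu>"
    have fin: "finite ?I" using F[of i] by (simp add: simple_function_def)
    have app: "approximable (\<lambda>x. \<Sum>y\<in>?I. y * indicator (F i -` {y} \<inter> space \<mu>) x)"
      by (intro approximable_sum approximable_scale approximable_indicator fin simple_functionD(2)[OF F])
    have eq: "(\<Sum>y\<in>?I. y * indicator (F i -` {y} \<inter> space \<mu>) x) = F i x" if "x \<in> space \<mu>" for x
    proof -
      have "(\<Sum>y\<in>?I. y * indicator (F i -` {y} \<inter> space \<mu>) x) = (\<Sum>y\<in>?I. if y = F i x then y else 0)"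
        using that by (intro sum.cong refl) (auto simp: indicator_def)
      then show ?thesis using fin that by simp
    qed
    show ?thesis
    \<comment> \<open>Applied to a constant sequence, only to pass between two functions that agree
      on \<open>carrier G\<close>.\<close>
    proof (rule approximable_dominated[OF app])
      show "F i \<in> borel_measurable \<mu>" using F by (rule borel_measurable_simple_function)
      show "integrable \<mu> (\<lambda>x. (cmod (\<Sum>y\<in>?I. y * indicator (F i -` {y} \<inter> space \<mu>) x))\<^sup>2)"
        using app by (intro L2_square_integrable) (simp add: approximable_def)
    qed (use eq in auto)
  qed
  then show ?thesis
  proof (rule approximable_dominated)
    show "integrable \<mu> (\<lambda>x. (2 * cmod (u x))\<^sup>2)"
      using L2_square_integrable[OF u] by (simp add: power_mult_distrib)
  qed (use um lim bound in auto)
qed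

text \<open>The squared norm of the conditional expectation of \<open>u\<close> on level
  \<open>n\<close>: its value on a coset is \<open>index n\<close> times the integral of
  \<open>u\<close> there, and each coset has measure \<open>1 / index n\<close>.\<close>

definition level_energy :: "nat \<Rightarrow> ('a \<Rightarrow> complex) \<Rightarrow> real" where
  "level_energy n u = real (index n) * (\<Sum>k<index n. (cmod (\<integral>x. u x * indicator (coset n (tr n k)) x \<partial>\<mu>))\<^sup>2)"

text \<open>The last summand vanishes for the mean value \<open>z\<close> of \<open>u\<close> on the coset, its best constant
  approximation.\<close>

lemma coset_variance:
  assumes u: "u \<in> L2 \<mu>" and k: "k < index n"
  defines "C \<equiv> coset n (tr n k)"
  defines "a \<equiv> (\<integral>x. u x * indicator C x \<partial>\<mu>)"
  shows "(\<integral>x. indicator C x * (cmod (u x - z))\<^sup>2 \<partial>\<mu>)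
    = (\<integral>x. indicator C x * (cmod (u x))\<^sup>2 \<partial>\<mu>) - real (index n) * (cmod a)\<^sup>2
      + (cmod (z - of_nat (index n) * a))\<^sup>2 / real (index n)"
proof -
  have C: "C \<in> sets \<mu>" using tr_carrier[OF k] by (auto simp: C_def)
  have m: "real (index n) > 0" using index_pos by simp
  have muC: "measure \<mu> C = 1 / real (index n)"
    using tr_carrier[OF k] by (simp add: C_def measure_coset measure_S)
  have iu: "integrable \<mu> (\<lambda>x. u x * indicator C x)"
    using L2_integrable[OF u] C by (intro integrable_times_bounded[where B = 1]) (auto simp: indicator_def)
  have i1: "integrable \<mu> (\<lambda>x. indicator C x * (cmod (u x))\<^sup>2)"
    using integrable_mult_indicator[OF C L2_square_integrable[OF u]] by simp
  have i2: "integrable \<mu> (\<lambda>x. 2 * Re (cnj z * (u x * indicator C x)))"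
    by (intro integrable_mult_right integrable_Re iu)
  have i3: "integrable \<mu> (\<lambda>x. (cmod z)\<^sup>2 * indicator C x)"
    using integrable_indicator_real[OF C] by (intro integrable_mult_right)
  have sq: "(cmod (w - y))\<^sup>2 = (cmod w)\<^sup>2 - 2 * Re (cnj y * w) + (cmod y)\<^sup>2" for w y :: complex
    unfolding cmod_power2 by (simp add: power2_eq_square algebra_simps)
  have "(\<integral>x. indicator C x * (cmod (u x - z))\<^sup>2 \<partial>\<mu>) = (\<integral>x. indicator C x * (cmod (u x))\<^sup>2
      - 2 * Re (cnj z * (u x * indicator C x)) + (cmod z)\<^sup>2 * indicator C x \<partial>\<mu>)"
    by (intro Bochner_Integration.integral_cong refl) (auto simp: indicator_def sq)
  also have "\<dots> = (\<integral>x. indicator C x * (cmod (u x))\<^sup>2 \<partial>\<mu>)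
      - (\<integral>x. 2 * Re (cnj z * (u x * indicator C x)) \<partial>\<mu>) + (\<integral>x. (cmod z)\<^sup>2 * indicator C x \<partial>\<mu>)"
    using i1 i2 i3 by (simp only: Bochner_Integration.integral_add Bochner_Integration.integral_diff Bochner_Integration.integrable_diff)
  also have "(\<integral>x. 2 * Re (cnj z * (u x * indicator C x)) \<partial>\<mu>) = 2 * Re (cnj z * a)"
  proof -
    have "(\<integral>x. Re (cnj z * (u x * indicator C x)) \<partial>\<mu>) = Re (\<integral>x. cnj z * (u x * indicator C x) \<partial>\<mu>)"
      by (intro integral_Re integrable_mult_right iu)
    also have "(\<integral>x. cnj z * (u x * indicator C x) \<partial>\<mu>) = cnj z * a" unfolding a_def by (rule integral_mult_right_zero)
    finally show ?thesis by (simp only: integral_mult_right_zero)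
  qed
  also have "(\<integral>x. (cmod z)\<^sup>2 * indicator C x \<partial>\<mu>) = (cmod z)\<^sup>2 / real (index n)"
    using integral_indicator_real[OF C] muC by simp
  also have "(\<integral>x. indicator C x * (cmod (u x))\<^sup>2 \<partial>\<mu>) - 2 * Re (cnj z * a) + (cmod z)\<^sup>2 / real (index n)
      = (\<integral>x. indicator C x * (cmod (u x))\<^sup>2 \<partial>\<mu>) - real (index n) * (cmod a)\<^sup>2
      + (cmod (z - of_nat (index n) * a))\<^sup>2 / real (index n)"
  proof -
    have "(cmod (z - of_nat (index n) * a))\<^sup>2
        = (cmod z)\<^sup>2 - 2 * real (index n) * Re (cnj z * a) + (real (index n))\<^sup>2 * (cmod a)\<^sup>2"
      unfolding cmod_power2 by (simp add: power2_eq_square algebra_simps)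
    then show ?thesis using m by (simp add: field_simps power2_eq_square)
  qed
  finally show ?thesis .
qed

lemma integral_coset_sum:
  fixes g :: "'a \<Rightarrow> real"
  assumes g: "integrable \<mu> g"
  shows "(\<integral>x. g x \<partial>\<mu>) = (\<Sum>k<index n. \<integral>x. indicator (coset n (tr n k)) x * g x \<partial>\<mu>)"
proof -
  have "(\<integral>x. g x \<partial>\<mu>) = (\<integral>x. (\<Sum>k<index n. indicator (coset n (tr n k)) x * g x) \<partial>\<mu>)"
  proof (intro Bochner_Integration.integral_cong refl)
    fix x assume "x \<in> space \<mu>"
    then obtain k where "k < index n" "x \<in> coset n (tr n k)" using transversal_obtain[of x n] by auto
    then show "g x = (\<Sum>k<index n. indicator (coset n (tr n k)) x * g x)"
      using sum_transversal[of k n x "\<lambda>_. g x"] by simp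
  qed
  also have "\<dots> = (\<Sum>k<index n. \<integral>x. indicator (coset n (tr n k)) x * g x \<partial>\<mu>)"
    using integrable_mult_indicator[OF coset_sets g] tr_carrier
    by (intro Bochner_Integration.integral_sum) auto
  finally show ?thesis .
qed

text \<open>Bessel's inequality on one level, from nonnegativity of the variance around the coset
  mean.\<close>

lemma level_energy_le:
  assumes u: "u \<in> L2 \<mu>"
  shows "level_energy n u \<le> (\<integral>x. (cmod (u x))\<^sup>2 \<partial>\<mu>)"
proof -
  have "real (index n) * (cmod (\<integral>x. u x * indicator (coset n (tr n k)) x \<partial>\<mu>))\<^sup>2
      \<le> (\<integral>x. indicator (coset n (tr n k)) x * (cmod (u x))\<^sup>2 \<partial>\<mu>)" if k: "k < index n" for k
  proof -
    let ?a = "\<integral>x. u x * indicator (coset n (tr n k)) x \<partial>\<mu>"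
    have "0 \<le> (\<integral>x. indicator (coset n (tr n k)) x * (cmod (u x - of_nat (index n) * ?a))\<^sup>2 \<partial>\<mu>)"
      by (intro integral_nonneg_AE) simp
    then show ?thesis using coset_variance[OF u k, of "of_nat (index n) * ?a"] by simp
  qed
  then show ?thesis
    unfolding level_energy_def integral_coset_sum[OF L2_square_integrable[OF u], of n] sum_distrib_left
    by (intro sum_mono) auto
qed

text \<open>On each coset \<open>coset_variance\<close> is applied with \<open>z\<close> the
  constant value of \<open>s\<close>, and its nonnegative last summand is dropped.\<close>

lemma level_energy_step:
  assumes u: "u \<in> L2 \<mu>" and s: "step_fun n s"
  shows "(\<integral>x. (cmod (u x))\<^sup>2 \<partial>\<mu>) \<le> (\<integral>x. (cmod (u x - s x))\<^sup>2 \<partial>\<mu>) + level_energy n u"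
proof -
  have "(\<integral>x. indicator (coset n (tr n k)) x * (cmod (u x))\<^sup>2 \<partial>\<mu>)
      \<le> (\<integral>x. indicator (coset n (tr n k)) x * (cmod (u x - s x))\<^sup>2 \<partial>\<mu>)
        + real (index n) * (cmod (\<integral>x. u x * indicator (coset n (tr n k)) x \<partial>\<mu>))\<^sup>2" if k: "k < index n" for k
  proof -
    have "(\<integral>x. indicator (coset n (tr n k)) x * (cmod (u x - s x))\<^sup>2 \<partial>\<mu>)
        = (\<integral>x. indicator (coset n (tr n k)) x * (cmod (u x - s (tr n k)))\<^sup>2 \<partial>\<mu>)"
      using s tr_carrier[OF k]
      by (intro Bochner_Integration.integral_cong refl) (auto simp: indicator_def step_fun_def)
    then show ?thesis using coset_variance[OF u k, of "s (tr n k)"] by simp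
  qed
  then have "(\<Sum>k<index n. \<integral>x. indicator (coset n (tr n k)) x * (cmod (u x))\<^sup>2 \<partial>\<mu>)
      \<le> (\<Sum>k<index n. (\<integral>x. indicator (coset n (tr n k)) x * (cmod (u x - s x))\<^sup>2 \<partial>\<mu>)
        + real (index n) * (cmod (\<integral>x. u x * indicator (coset n (tr n k)) x \<partial>\<mu>))\<^sup>2)"
    by (intro sum_mono) auto
  then show ?thesis
    unfolding level_energy_def integral_coset_sum[OF L2_square_integrable[OF u], of n]
      integral_coset_sum[OF L2_square_integrable[OF L2_diff[OF u step_fun_L2[OF s]]], of n] sum_distrib_left
    by (simp add: sum.distrib)
qed

text \<open>The substitute for completeness of the Fourier system: a bound on all finite levels
  passes to the norm, because the level of a good step approximation already captures the norm up to
  \<open>\<epsilon>\<close>.\<close>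

lemma norm_le_level_energy:
  assumes u: "u \<in> L2 \<mu>" and B: "\<And>n. level_energy n u \<le> B"
  shows "(\<integral>x. (cmod (u x))\<^sup>2 \<partial>\<mu>) \<le> B"
proof (rule field_le_epsilon)
  fix \<epsilon> :: real assume "\<epsilon> > 0"
  then obtain n s where s: "step_fun n s" "(\<integral>x. (cmod (u x - s x))\<^sup>2 \<partial>\<mu>) \<le> \<epsilon>"
    using L2_approximable[OF u] unfolding approximable_def by blast
  show "(\<integral>x. (cmod (u x))\<^sup>2 \<partial>\<mu>) \<le> B + \<epsilon>"
    using level_energy_step[OF u s(1)] s(2) B[of n] by linarith
qed

end

section \<open>Lipschitz condition and Fourier tails\<close>

text \<open>Row by row: expanding the squares brings in the inner products of the rows of
  \<open>U\<close>, which are orthonormal.\<close>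

lemma HS_norm_mult_unitary:
  assumes A: "A \<in> carrier_mat n d" and U: "unitary_mat d U"
  shows "HS_norm (A * U) = HS_norm A"
proof -
  note Uc = unitary_mat_carrier[OF U]
  have "complex_of_real (\<Sum>j<d. (cmod ((A * U) $$ (i, j)))\<^sup>2) = complex_of_real (\<Sum>j<d. (cmod (A $$ (i, j)))\<^sup>2)"
    if i: "i < n" for i
  proof -
    have "complex_of_real (\<Sum>j<d. (cmod ((A * U) $$ (i, j)))\<^sup>2) = (\<Sum>j<d. (A * U) $$ (i, j) * cnj ((A * U) $$ (i, j)))"
      by (simp add: complex_norm_square del: of_real_power)
    also have "\<dots> = (\<Sum>j<d. \<Sum>k<d. \<Sum>l<d. (A $$ (i, k) * cnj (A $$ (i, l))) * (U $$ (k, j) * cnj (U $$ (l, j))))"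
    proof (intro sum.cong refl)
      fix j assume "j \<in> {..<d}"
      then have "(A * U) $$ (i, j) = (\<Sum>k<d. A $$ (i, k) * U $$ (k, j))"
        using A Uc i by (intro mat_mult_index) auto
      then have "(A * U) $$ (i, j) * cnj ((A * U) $$ (i, j))
          = (\<Sum>k<d. \<Sum>l<d. (A $$ (i, k) * U $$ (k, j)) * cnj (A $$ (i, l) * U $$ (l, j)))"
        by (simp only: cnj_sum sum_product)
      then show "(A * U) $$ (i, j) * cnj ((A * U) $$ (i, j))
          = (\<Sum>k<d. \<Sum>l<d. (A $$ (i, k) * cnj (A $$ (i, l))) * (U $$ (k, j) * cnj (U $$ (l, j))))"
        by (simp add: mult_ac)
    qed
    also have "\<dots> = (\<Sum>k<d. \<Sum>l<d. \<Sum>j<d. (A $$ (i, k) * cnj (A $$ (i, l))) * (U $$ (k, j) * cnj (U $$ (l, j))))"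
      by (rule sum_rotate3)
    also have "\<dots> = (\<Sum>k<d. \<Sum>l<d. if l = k then A $$ (i, k) * cnj (A $$ (i, k)) else 0)"
      using unitary_mat_rows[OF U]
      by (intro sum.cong refl) (simp add: sum_distrib_left[symmetric])
    also have "\<dots> = complex_of_real (\<Sum>k<d. (cmod (A $$ (i, k)))\<^sup>2)"
      by (simp add: complex_norm_square del: of_real_power)
    finally show ?thesis .
  qed
  then have "(\<Sum>j<d. (cmod ((A * U) $$ (i, j)))\<^sup>2) = (\<Sum>j<d. (cmod (A $$ (i, j)))\<^sup>2)" if "i < n" for i
    using that of_real_eq_iff by blast
  then show ?thesis using A Uc by (simp add: HS_norm_def)
qed

lemma HS_norm_diff_square:
  assumes A: "A \<in> carrier_mat n d" and B: "B \<in> carrier_mat n d"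
  shows "(HS_norm (A - B))\<^sup>2 = (HS_norm A)\<^sup>2 + (HS_norm B)\<^sup>2
    - 2 * Re (\<Sum>i<n. \<Sum>j<d. A $$ (i, j) * cnj (B $$ (i, j)))"
proof -
  have sq: "(cmod (w - y))\<^sup>2 = (cmod w)\<^sup>2 + (cmod y)\<^sup>2 - 2 * Re (w * cnj y)" for w y :: complex
    unfolding cmod_power2 by (simp add: power2_eq_square algebra_simps)
  have "(HS_norm (A - B))\<^sup>2 = (\<Sum>i<n. \<Sum>j<d. (cmod (A $$ (i, j) - B $$ (i, j)))\<^sup>2)"
    unfolding HS_norm_square_real using A B by (intro sum.cong) auto
  also have "\<dots> = (\<Sum>i<n. \<Sum>j<d. (cmod (A $$ (i, j)))\<^sup>2 + (cmod (B $$ (i, j)))\<^sup>2 - 2 * Re (A $$ (i, j) * cnj (B $$ (i, j))))"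
    by (simp only: sq)
  also have "\<dots> = (HS_norm A)\<^sup>2 + (HS_norm B)\<^sup>2 - 2 * Re (\<Sum>i<n. \<Sum>j<d. A $$ (i, j) * cnj (B $$ (i, j)))"
    unfolding HS_norm_square_real using A B
    by (simp add: sum.distrib sum_subtractf sum_distrib_left Re_sum)
  finally show ?thesis .
qed

lemma HS_norm_diff_le:
  assumes A: "A \<in> carrier_mat n d" and B: "B \<in> carrier_mat n d"
  shows "(HS_norm (A - B))\<^sup>2 \<le> 2 * (HS_norm A)\<^sup>2 + 2 * (HS_norm B)\<^sup>2"
proof -
  have "(HS_norm (A - B))\<^sup>2 = (\<Sum>i<n. \<Sum>j<d. (cmod (A $$ (i, j) + - B $$ (i, j)))\<^sup>2)"
    unfolding HS_norm_square_real using A B by (intro sum.cong) auto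
  also have "\<dots> \<le> (\<Sum>i<n. \<Sum>j<d. 2 * (cmod (A $$ (i, j)))\<^sup>2 + 2 * (cmod (- B $$ (i, j)))\<^sup>2)"
    by (intro sum_mono cmod_add_square_le)
  also have "\<dots> = 2 * (HS_norm A)\<^sup>2 + 2 * (HS_norm B)\<^sup>2"
    unfolding HS_norm_square_real using A B by (simp add: sum.distrib sum_distrib_left)
  finally show ?thesis .
qed

section \<open>Fourier energies of translates\<close>

context vilenkin_haar_A
begin

abbreviation fourier_energy :: "('a \<Rightarrow> complex) \<Rightarrow> ('a \<Rightarrow> complex mat) set \<Rightarrow> real" where
  "fourier_energy f c \<equiv> real (dual_dim c) * (HS_norm (fourier_coeff G \<mu> f (representative c)))\<^sup>2"

abbreviation shift_diff :: "('a \<Rightarrow> complex) \<Rightarrow> 'a \<Rightarrow> 'a \<Rightarrow> complex" where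
  "shift_diff f h \<equiv> \<lambda>x. f (h \<otimes> x) - f x"

lemma shift_diff_L2: "f \<in> L2 \<mu> \<Longrightarrow> h \<in> carrier G \<Longrightarrow> shift_diff f h \<in> L2 \<mu>"
  by (intro L2_diff L2_translate)

lemma level_energy_eq: "u \<in> L2 \<mu> \<Longrightarrow> level_energy n u = (\<Sum>c\<in>level_dual n. fourier_energy u c)"
  unfolding level_energy_def by (simp add: finite_plancherel L2_integrable)

definition tail_dual :: "nat \<Rightarrow> ('a \<Rightarrow> complex mat) set set" where
  "tail_dual k = {c \<in> unitary_dual G T. \<not> trivial_on k (representative c)}"

lemma fourier_tail_eq: "fourier_tail G T S \<mu> f k = (\<Sum>\<^sub>\<infinity>c\<in>tail_dual k. ennreal (fourier_energy f c))"
proof -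
  have "{c \<in> unitary_dual G T. rep_weight G T S (representative c) > vindex G S k} = tail_dual k"
    unfolding tail_dual_def using rep_weight_gt_iff representative_irreducible by blast
  then show ?thesis by (simp add: fourier_tail_def)
qed

text \<open>With \<open>fourier_tail_leI\<close> this reduces the tail to finite partial sums, so
  that only real-valued sums have to be estimated.\<close>

lemma finite_sum_le_fourier_tail:
  assumes "finite F" "F \<subseteq> tail_dual k"
  shows "ennreal (\<Sum>c\<in>F. fourier_energy f c) \<le> fourier_tail G T S \<mu> f k"
proof -
  have "ennreal (\<Sum>c\<in>F. fourier_energy f c) = (\<Sum>c\<in>F. ennreal (fourier_energy f c))"
    by (intro sum_ennreal[symmetric]) simp
  also have "\<dots> \<le> fourier_tail G T S \<mu> f k"
    unfolding fourier_tail_eq using assms by (subst nonneg_infsum_complete) (auto intro: SUP_upper)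
  finally show ?thesis .
qed

lemma fourier_tail_leI:
  assumes "\<And>F. finite F \<Longrightarrow> F \<subseteq> tail_dual k \<Longrightarrow> (\<Sum>c\<in>F. fourier_energy f c) \<le> B"
  shows "fourier_tail G T S \<mu> f k \<le> ennreal B"
  unfolding fourier_tail_eq
proof (rule infsum_le_finite_sums)
  fix F assume F: "finite F" "F \<subseteq> tail_dual k"
  have "(\<Sum>c\<in>F. ennreal (fourier_energy f c)) = ennreal (\<Sum>c\<in>F. fourier_energy f c)"
    by (intro sum_ennreal) simp
  also have "\<dots> \<le> ennreal B" using assms[OF F] by (rule ennreal_leI)
  finally show "(\<Sum>c\<in>F. ennreal (fourier_energy f c)) \<le> ennreal B" .
qed (rule nonneg_summable_on_complete, simp)

lemma dual_memD:
  assumes "c \<in> unitary_dual G T"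
  shows "representative c \<in> irreducible_reps G T" "representative c \<in> unitary_reps G T"
  using representative_irreducible[OF assms] irreducible_unitary by auto

lemma fourier_energy_shift_le:
  assumes f: "f \<in> L2 \<mu>" and h: "h \<in> carrier G" and c: "c \<in> unitary_dual G T"
  shows "fourier_energy (shift_diff f h) c \<le> 4 * fourier_energy f c"
proof -
  let ?A = "fourier_coeff G \<mu> f (representative c)"
  note u = dual_memD(2)[OF c]
  have A: "?A \<in> carrier_mat (dual_dim c) (dual_dim c)" by (rule fourier_coeff_carrier)
  have "(HS_norm (?A * representative c h - ?A))\<^sup>2 \<le> 2 * (HS_norm (?A * representative c h))\<^sup>2 + 2 * (HS_norm ?A)\<^sup>2"
    by (rule HS_norm_diff_le[OF mult_carrier_mat[OF A unitary_rep_carrier[OF u h]] A])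
  also have "\<dots> = 4 * (HS_norm ?A)\<^sup>2"
    by (simp add: HS_norm_mult_unitary[OF A unitary_rep_unitary[OF u h]])
  finally have "(HS_norm (fourier_coeff G \<mu> (shift_diff f h) (representative c)))\<^sup>2 \<le> 4 * (HS_norm ?A)\<^sup>2"
    unfolding fourier_coeff_translate_diff[OF f u h] .
  from mult_left_mono[OF this, of "real (dual_dim c)"] show ?thesis by simp
qed

lemma fourier_energy_shift_trivial:
  assumes f: "f \<in> L2 \<mu>" and h: "h \<in> S k" and c: "c \<in> unitary_dual G T" and tr: "trivial_on k (representative c)"
  shows "fourier_energy (shift_diff f h) c = 0"
proof -
  let ?A = "fourier_coeff G \<mu> f (representative c)"
  have A: "?A \<in> carrier_mat (dual_dim c) (dual_dim c)" by (rule fourier_coeff_carrier)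
  have "representative c h = 1\<^sub>m (dual_dim c)" using tr h by (simp add: trivial_on_def)
  then have "fourier_coeff G \<mu> (shift_diff f h) (representative c) = 0\<^sub>m (dual_dim c) (dual_dim c)"
    unfolding fourier_coeff_translate_diff[OF f dual_memD(2)[OF c] S_subset[OF h]] using A by simp
  then show ?thesis by (simp add: HS_norm_def)
qed

text \<open>On every level the classes trivial on \<open>S k\<close> drop out, and each remaining
  class gains at most a factor \<open>4\<close>. The bound does not depend on the level, so
  \<open>norm_le_level_energy\<close> applies.\<close>

lemma shift_norm_le_tail:
  assumes f: "f \<in> L2 \<mu>" and h: "h \<in> S k" and B: "B \<ge> 0" and tail: "fourier_tail G T S \<mu> f k \<le> ennreal B"
  shows "(\<integral>x. (cmod (shift_diff f h x))\<^sup>2 \<partial>\<mu>) \<le> 4 * B"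
proof (rule norm_le_level_energy[OF shift_diff_L2[OF f S_subset[OF h]]])
  fix n
  have mem: "c \<in> unitary_dual G T" if "c \<in> level_dual n" for c using that by (simp add: level_dual_def)
  have "level_energy n (shift_diff f h) = (\<Sum>c\<in>level_dual n. fourier_energy (shift_diff f h) c)"
    by (rule level_energy_eq[OF shift_diff_L2[OF f S_subset[OF h]]])
  also have "\<dots> = (\<Sum>c\<in>level_dual n \<inter> tail_dual k. fourier_energy (shift_diff f h) c)"
    using fourier_energy_shift_trivial[OF f h] mem finite_level_dual
    by (intro sum.mono_neutral_right) (auto simp: tail_dual_def)
  also have "\<dots> \<le> (\<Sum>c\<in>level_dual n \<inter> tail_dual k. 4 * fourier_energy f c)"
    using mem by (intro sum_mono fourier_energy_shift_le[OF f S_subset[OF h]]) auto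
  also have "\<dots> = 4 * (\<Sum>c\<in>level_dual n \<inter> tail_dual k. fourier_energy f c)"
    by (simp add: sum_distrib_left)
  also have "\<dots> \<le> 4 * B"
  proof -
    \<comment> \<open>The assumption \<open>B \<ge> 0\<close> lets the inequality return to the
      reals, since \<open>ennreal\<close> sends negative numbers to \<open>0\<close>.\<close>
    have "ennreal (\<Sum>c\<in>level_dual n \<inter> tail_dual k. fourier_energy f c) \<le> ennreal B"
      using finite_sum_le_fourier_tail[of "level_dual n \<inter> tail_dual k" k f] finite_level_dual tail
      by (meson finite_Int inf_le2 order_trans)
    then show ?thesis using B by simp
  qed
  finally show "level_energy n (shift_diff f h) \<le> 4 * B" .
qed

text \<open>Unitarity gives the squared norm of \<open>?A * ?\<xi> h - ?A\<close> as twice that of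
  \<open>?A\<close> minus twice the real part of their inner product. That cross term is linear in
  the entries of \<open>?\<xi> h\<close>, whose integrals over \<open>S k\<close> vanish by
  \<open>integral_S_null\<close>.\<close>

lemma integral_S_shift_energy:
  assumes f: "f \<in> L2 \<mu>" and c: "c \<in> tail_dual k"
  shows "integrable \<mu> (\<lambda>h. indicator (S k) h * fourier_energy (shift_diff f h) c)"
    and "(\<integral>h. indicator (S k) h * fourier_energy (shift_diff f h) c \<partial>\<mu>)
      = 2 * fourier_energy f c / real (index k)"
proof -
  let ?\<xi> = "representative c" and ?d = "dual_dim c"
  let ?A = "fourier_coeff G \<mu> f ?\<xi>"
  have cd: "c \<in> unitary_dual G T" and nt: "\<not> trivial_on k ?\<xi>" using c by (auto simp: tail_dual_def)
  note xi = dual_memD(1)[OF cd] and u = dual_memD(2)[OF cd]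
  have A: "?A \<in> carrier_mat ?d ?d" by (rule fourier_coeff_carrier)
  \<comment> \<open>The inner product of \<open>?A * ?\<xi> h\<close> with \<open>?A\<close>, cut
    off to \<open>S k\<close> and expanded into entries of \<open>?\<xi> h\<close>.\<close>
  define g where "g h = (\<Sum>i<?d. \<Sum>j<?d. \<Sum>l<?d.
      ?A $$ (i, l) * cnj (?A $$ (i, j)) * (indicator (S k) h * ?\<xi> h $$ (l, j)))" for h
  have int: "integrable \<mu> (\<lambda>h. indicator (S k) h * ?\<xi> h $$ (l, j))" if "l < ?d" "j < ?d" for l j
    using unitary_rep_entry_le_1[OF u] u that
    by (intro integrable_times_bounded[where B = 1] L2_integrable indicator_L2 S_sets) auto
  \<comment> \<open>Conjugated form of \<open>integral_S_null\<close>, which concerns the conjugate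
    entries.\<close>
  have null: "(\<integral>h. indicator (S k) h * ?\<xi> h $$ (l, j) \<partial>\<mu>) = 0" if "l < ?d" "j < ?d" for l j
  proof -
    have "cnj (\<integral>h. indicator (S k) h * ?\<xi> h $$ (l, j) \<partial>\<mu>) = (\<integral>h. cnj (indicator (S k) h * ?\<xi> h $$ (l, j)) \<partial>\<mu>)"
      by (rule Bochner_Integration.integral_cnj[symmetric])
    also have "\<dots> = (\<integral>h. indicator (S k) h * cnj (?\<xi> h $$ (l, j)) \<partial>\<mu>)"
      by (intro Bochner_Integration.integral_cong) (auto simp: indicator_def)
    also have "\<dots> = 0" by (rule integral_S_null[OF xi nt that])
    finally show ?thesis by simp
  qed
  have gi: "integrable \<mu> g"
    unfolding g_def using int by (intro Bochner_Integration.integrable_sum integrable_mult_right) auto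
  have g0: "(\<integral>h. g h \<partial>\<mu>) = 0"
  proof -
    have "(\<integral>h. g h \<partial>\<mu>) = (\<Sum>i<?d. \<integral>h. (\<Sum>j<?d. \<Sum>l<?d.
        ?A $$ (i, l) * cnj (?A $$ (i, j)) * (indicator (S k) h * ?\<xi> h $$ (l, j))) \<partial>\<mu>)"
      unfolding g_def using int
      by (intro Bochner_Integration.integral_sum Bochner_Integration.integrable_sum integrable_mult_right) auto
    also have "\<dots> = (\<Sum>i<?d. \<Sum>j<?d. \<integral>h. (\<Sum>l<?d.
        ?A $$ (i, l) * cnj (?A $$ (i, j)) * (indicator (S k) h * ?\<xi> h $$ (l, j))) \<partial>\<mu>)"
      using int by (intro sum.cong refl Bochner_Integration.integral_sum
          Bochner_Integration.integrable_sum integrable_mult_right) auto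
    also have "\<dots> = (\<Sum>i<?d. \<Sum>j<?d. \<Sum>l<?d. \<integral>h.
        ?A $$ (i, l) * cnj (?A $$ (i, j)) * (indicator (S k) h * ?\<xi> h $$ (l, j)) \<partial>\<mu>)"
      using int by (intro sum.cong refl Bochner_Integration.integral_sum integrable_mult_right) auto
    also have "\<dots> = 0"
      using null by (intro sum.neutral ballI) simp
    finally show ?thesis .
  qed
  have eq: "indicator (S k) h * fourier_energy (shift_diff f h) c
      = 2 * fourier_energy f c * indicator (S k) h - 2 * real ?d * Re (g h)" for h
  proof (cases "h \<in> S k")
    case True
    have h: "h \<in> carrier G" by (rule S_subset[OF True])
    note hc = unitary_rep_carrier[OF u h]
    have "(\<Sum>i<?d. \<Sum>j<?d. (?A * ?\<xi> h) $$ (i, j) * cnj (?A $$ (i, j))) = g h"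
    proof -
      have "(?A * ?\<xi> h) $$ (i, j) = (\<Sum>l<?d. ?A $$ (i, l) * ?\<xi> h $$ (l, j))" if "i < ?d" "j < ?d" for i j
        by (rule mat_mult_index[OF A hc that])
      then show ?thesis
        unfolding g_def using True
        by (intro sum.cong refl) (simp add: sum_distrib_right sum_distrib_left mult_ac)
    qed
    then have sq: "(HS_norm (?A * ?\<xi> h - ?A))\<^sup>2 = 2 * (HS_norm ?A)\<^sup>2 - 2 * Re (g h)"
      using HS_norm_diff_square[OF mult_carrier_mat[OF A hc] A]
        HS_norm_mult_unitary[OF A unitary_rep_unitary[OF u h]] by simp
    show ?thesis
      unfolding fourier_coeff_translate_diff[OF f u h] sq using True by (simp add: algebra_simps)
  next
    case False
    then show ?thesis by (simp add: g_def)
  qed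
  have i1: "integrable \<mu> (\<lambda>h. 2 * fourier_energy f c * indicator (S k) h)"
    by (intro integrable_mult_right integrable_indicator_real S_sets)
  have i2: "integrable \<mu> (\<lambda>h. 2 * real ?d * Re (g h))"
    by (intro integrable_mult_right integrable_Re gi)
  show "integrable \<mu> (\<lambda>h. indicator (S k) h * fourier_energy (shift_diff f h) c)"
    unfolding eq by (rule Bochner_Integration.integrable_diff[OF i1 i2])
  have "(\<integral>h. indicator (S k) h * fourier_energy (shift_diff f h) c \<partial>\<mu>)
      = (\<integral>h. 2 * fourier_energy f c * indicator (S k) h \<partial>\<mu>) - (\<integral>h. 2 * real ?d * Re (g h) \<partial>\<mu>)"
    unfolding eq by (rule Bochner_Integration.integral_diff[OF i1 i2])
  also have "(\<integral>h. 2 * fourier_energy f c * indicator (S k) h \<partial>\<mu>) = 2 * fourier_energy f c * measure \<mu> (S k)"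
    by (simp only: integral_mult_right_zero integral_indicator_real[OF S_sets])
  also have "(\<integral>h. 2 * real ?d * Re (g h) \<partial>\<mu>) = 2 * real ?d * Re (\<integral>h. g h \<partial>\<mu>)"
    by (simp only: integral_mult_right_zero integral_Re[OF gi])
  finally show "(\<integral>h. indicator (S k) h * fourier_energy (shift_diff f h) c \<partial>\<mu>)
      = 2 * fourier_energy f c / real (index k)"
    by (simp add: g0 measure_S)
qed

text \<open>Each class is trivial on some \<open>S n\<close>, and triviality persists deeper down,
  so the maximum of finitely many levels works. A finite part of the tail can then be compared with
  a single \<open>level_energy\<close>.\<close>

lemma finite_subset_level_dual:
  assumes "finite F" "F \<subseteq> unitary_dual G T"
  obtains n where "F \<subseteq> level_dual n"
proof -
  have "\<exists>n. F \<subseteq> level_dual n"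
    using assms
  proof (induction F)
    case (insert c F)
    then obtain m where m: "F \<subseteq> level_dual m" by auto
    obtain n where n: "trivial_on n (representative c)"
      using insert eventually_trivial[OF dual_memD(1)] by blast
    have "insert c F \<subseteq> level_dual (max m n)"
      using m n insert.prems trivial_on_mono[of m "max m n"] trivial_on_mono[of n "max m n"]
      by (auto simp: level_dual_def)
    then show ?case by blast
  qed simp
  then show ?thesis using that by blast
qed

text \<open>A finite part \<open>F\<close> of the tail sits in one level, where Bessel's inequality
  bounds the energies of every shift by \<open>B\<close>. Integrating over \<open>S k\<close>
  replaces the shifted energies by twice the energies of \<open>f\<close>, and the measure of
  \<open>S k\<close> cancels.\<close>

lemma tail_le_shift_norm:
  assumes f: "f \<in> L2 \<mu>"
    and B: "\<And>h. h \<in> S k \<Longrightarrow> (\<integral>x. (cmod (shift_diff f h x))\<^sup>2 \<partial>\<mu>) \<le> B"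
  shows "fourier_tail G T S \<mu> f k \<le> ennreal B"
proof (rule fourier_tail_leI)
  fix F assume F: "finite F" "F \<subseteq> tail_dual k"
  have "F \<subseteq> unitary_dual G T" using F(2) by (auto simp: tail_dual_def)
  then obtain n where n: "F \<subseteq> level_dual n" by (rule finite_subset_level_dual[OF F(1)])
  have le: "(\<Sum>c\<in>F. fourier_energy (shift_diff f h) c) \<le> B" if h: "h \<in> S k" for h
  proof -
    note L = shift_diff_L2[OF f S_subset[OF h]]
    have "(\<Sum>c\<in>F. fourier_energy (shift_diff f h) c) \<le> (\<Sum>c\<in>level_dual n. fourier_energy (shift_diff f h) c)"
      using n finite_level_dual by (intro sum_mono2) auto
    also have "\<dots> = level_energy n (shift_diff f h)" by (rule level_energy_eq[OF L, symmetric])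
    also have "\<dots> \<le> B" using level_energy_le[OF L, of n] B[OF h] by linarith
    finally show ?thesis .
  qed
  note int = integral_S_shift_energy[OF f]
  have "2 * (\<Sum>c\<in>F. fourier_energy f c) / real (index k) = (\<Sum>c\<in>F. 2 * fourier_energy f c / real (index k))"
    by (simp add: sum_distrib_left sum_divide_distrib)
  also have "\<dots> = (\<Sum>c\<in>F. \<integral>h. indicator (S k) h * fourier_energy (shift_diff f h) c \<partial>\<mu>)"
    using F(2) by (intro sum.cong refl int(2)[symmetric]) auto
  also have "\<dots> = (\<integral>h. (\<Sum>c\<in>F. indicator (S k) h * fourier_energy (shift_diff f h) c) \<partial>\<mu>)"
    using F(2) by (intro Bochner_Integration.integral_sum[symmetric] int(1)) auto
  also have "\<dots> \<le> (\<integral>h. B * indicator (S k) h \<partial>\<mu>)"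
  proof (rule integral_mono)
    show "integrable \<mu> (\<lambda>h. \<Sum>c\<in>F. indicator (S k) h * fourier_energy (shift_diff f h) c)"
      using F(2) by (intro Bochner_Integration.integrable_sum int(1)) auto
    show "integrable \<mu> (\<lambda>h. B * indicator (S k) h)"
      by (intro integrable_mult_right integrable_indicator_real S_sets)
    fix h
    show "(\<Sum>c\<in>F. indicator (S k) h * fourier_energy (shift_diff f h) c) \<le> B * indicator (S k) h"
      using le[of h] by (cases "h \<in> S k") auto
  qed
  also have "\<dots> = B / real (index k)"
    by (simp only: integral_mult_right_zero integral_indicator_real[OF S_sets] measure_S) simp
  finally have "2 * (\<Sum>c\<in>F. fourier_energy f c) \<le> B"
    using index_pos[of k] by (simp add: divide_le_cancel)
  \<comment> \<open>The averaging in fact yields the bound \<open>B / 2\<close>; the factor is given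
    away.\<close>
  moreover have "0 \<le> (\<Sum>c\<in>F. fourier_energy f c)" by (intro sum_nonneg) simp
  ultimately show "(\<Sum>c\<in>F. fourier_energy f c) \<le> B" by linarith
qed

text \<open>The sets on which \<open>vabs\<close> is small are the subgroups themselves: on
  \<open>carrier G\<close>, \<open>vabs\<close> is below \<open>1 / index K\<close> exactly on
  \<open>S (Suc K)\<close>. The Landau condition thus becomes a bound on some
  \<open>S K\<close>.\<close>

lemma eventually_vabs_to_0:
  "eventually P (vabs_to_0 G S \<mu>) \<longleftrightarrow> (\<exists>K. \<forall>h\<in>S K. P h)"
proof
  assume "eventually P (vabs_to_0 G S \<mu>)"
  then obtain e where e: "e > 0" "\<And>h. h \<in> carrier G \<Longrightarrow> \<bar>vabs G S \<mu> h\<bar> < e \<Longrightarrow> P h"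
    unfolding vabs_to_0_def eventually_inf_principal eventually_filtercomap eventually_nhds_metric
    by (auto simp: dist_real_def)
  obtain K where K: "1 / e < real K" using reals_Archimedean2 by blast
  \<comment> \<open>A strictly increasing sequence of naturals dominates the identity, so
    \<open>1 / index K\<close> falls below \<open>e\<close>.\<close>
  have "K \<le> index K" using strict_mono_index by (rule strict_mono_imp_increasing)
  then have "1 / e < real (index K)" using K by linarith
  then have "1 < real (index K) * e" using e(1) by (simp add: pos_divide_less_eq)
  then have lt: "1 / real (index K) < e" using index_pos[of K] by (simp add: pos_divide_less_eq mult.commute)
  have "P h" if h: "h \<in> S K" for h
  proof (cases "h = \<one>")
    case True
    then show ?thesis using e vabs_one by simp
  next
    case False
    then obtain k where k: "h \<in> S k - S (Suc k)" using exists_level S_subset[OF h] by blast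
    then have "K \<le> k" using h S_mono[of "Suc k" K] using not_less_eq_eq by blast
    then have "index K \<le> index k" by (simp add: strict_mono_less_eq[OF strict_mono_index])
    then have "1 / real (index k) \<le> 1 / real (index K)" using index_pos[of K] by (intro divide_left_mono) auto
    then show ?thesis using e(2)[OF S_subset[OF h]] vabs_level[OF k] lt by simp
  qed
  then show "\<exists>K. \<forall>h\<in>S K. P h" by blast
next
  assume "\<exists>K. \<forall>h\<in>S K. P h"
  then obtain K where K: "\<And>h. h \<in> S K \<Longrightarrow> P h" by blast
  \<comment> \<open>The strict inequality puts \<open>h\<close> one level deeper than required,
    which does no harm.\<close>
  have "P h" if h: "h \<in> carrier G" and v: "\<bar>vabs G S \<mu> h\<bar> < 1 / real (index K)" for h
  proof (cases "h = \<one>")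
    case True
    then show ?thesis using K by simp
  next
    case False
    then obtain k where k: "h \<in> S k - S (Suc k)" using exists_level h by blast
    then have "1 / real (index k) < 1 / real (index K)" using v vabs_level[OF k] by simp
    then have "K < k" using index_pos[of k] index_pos[of K] index_less_iff[of K k] by (simp add: field_simps)
    then show ?thesis using K k S_mono[of K k] by auto
  qed
  moreover have "1 / real (index K) > 0" using index_pos[of K] by simp
  ultimately show "eventually P (vabs_to_0 G S \<mu>)"
    unfolding vabs_to_0_def eventually_inf_principal eventually_filtercomap eventually_nhds_metric
    by (intro exI[of _ "\<lambda>x. \<bar>x\<bar> < 1 / real (index K)"] conjI exI[of _ "1 / real (index K)"]) (auto simp: dist_real_def)
qed

lemma L2_norm_fun_square: "(L2_norm_fun \<mu> u)\<^sup>2 = (\<integral>x. (cmod (u x))\<^sup>2 \<partial>\<mu>)"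
  unfolding L2_norm_fun_def by (intro real_sqrt_pow2 integral_nonneg_AE AE_I2) simp

lemma powr_index: "(1 / real (index k)) powr \<alpha> = real (index k) powr - \<alpha>"
  using index_pos[of k] by (simp add: powr_divide powr_minus_divide)

lemma powr_square: "x > 0 \<Longrightarrow> (x powr - \<alpha>)\<^sup>2 = x powr (- 2 * \<alpha>)" for x :: real
  by (simp add: power2_eq_square powr_add[symmetric])

theorem Lip2_iff_fourier_tail:
  assumes \<alpha>: "0 < \<alpha>" and f: "f \<in> L2 \<mu>"
  shows "f \<in> Lip2 G S \<mu> \<alpha> \<longleftrightarrow>
    (\<exists>C::real. \<forall>\<^sub>F k in sequentially. fourier_tail G T S \<mu> f k \<le> ennreal (C * vindex G S k powr (- 2 * \<alpha>)))"
proof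
  assume "f \<in> Lip2 G S \<mu> \<alpha>"
  then have big: "(\<lambda>h. L2_norm_fun \<mu> (shift_diff f h)) \<in> O[vabs_to_0 G S \<mu>](\<lambda>h. vabs G S \<mu> h powr \<alpha>)"
    by (simp add: Lip2_def)
  obtain c where c: "c > 0"
    and ev: "eventually (\<lambda>h. norm (L2_norm_fun \<mu> (shift_diff f h)) \<le> c * norm (vabs G S \<mu> h powr \<alpha>)) (vabs_to_0 G S \<mu>)"
    by (rule landau_o.bigE[OF big])
  obtain K where K: "\<And>h. h \<in> S K \<Longrightarrow> \<bar>L2_norm_fun \<mu> (shift_diff f h)\<bar> \<le> c * vabs G S \<mu> h powr \<alpha>"
    using ev unfolding eventually_vabs_to_0 by auto
  \<comment> \<open>The constant is squared because the tail is measured by squared norms.\<close>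
  have "fourier_tail G T S \<mu> f k \<le> ennreal (c\<^sup>2 * vindex G S k powr (- 2 * \<alpha>))" if k: "k \<ge> K" for k
  proof (rule tail_le_shift_norm[OF f])
    fix h assume h: "h \<in> S k"
    \<comment> \<open>The averaging needs one bound for all of \<open>S k\<close>, including deeper
      levels, where \<open>vabs\<close> is smaller, and the identity, where the power is
      \<open>0\<close>.\<close>
    have "vabs G S \<mu> h powr \<alpha> \<le> (1 / real (index k)) powr \<alpha>"
    proof (cases "h = \<one>")
      case False
      then obtain l where l: "h \<in> S l - S (Suc l)" using exists_level S_subset[OF h] by blast
      then have "k \<le> l" using h S_mono[of "Suc l" k] using not_less_eq_eq by blast
      then have "index k \<le> index l" by (simp add: strict_mono_less_eq[OF strict_mono_index])
      then have "1 / real (index l) \<le> 1 / real (index k)" using index_pos[of k] by (intro divide_left_mono) auto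
      then show ?thesis unfolding vabs_level[OF l] using \<alpha> by (intro powr_mono2) auto
    qed (simp add: vabs_one)
    then have "c * vabs G S \<mu> h powr \<alpha> \<le> c * real (index k) powr - \<alpha>"
      unfolding powr_index using c by (intro mult_left_mono) auto
    moreover have "h \<in> S K" using S_mono[OF k] h by blast
    ultimately have "\<bar>L2_norm_fun \<mu> (shift_diff f h)\<bar> \<le> c * real (index k) powr - \<alpha>"
      using K[of h] by linarith
    then have "\<bar>L2_norm_fun \<mu> (shift_diff f h)\<bar>\<^sup>2 \<le> (c * real (index k) powr - \<alpha>)\<^sup>2"
      by (intro power_mono) auto
    then show "(\<integral>x. (cmod (shift_diff f h x))\<^sup>2 \<partial>\<mu>) \<le> c\<^sup>2 * vindex G S k powr (- 2 * \<alpha>)"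
      using powr_square[of "real (index k)" \<alpha>] index_pos[of k]
      by (simp add: L2_norm_fun_square power_mult_distrib)
  qed
  then show "\<exists>C. \<forall>\<^sub>F k in sequentially. fourier_tail G T S \<mu> f k \<le> ennreal (C * vindex G S k powr (- 2 * \<alpha>))"
    unfolding eventually_sequentially by blast
next
  assume "\<exists>C. \<forall>\<^sub>F k in sequentially. fourier_tail G T S \<mu> f k \<le> ennreal (C * vindex G S k powr (- 2 * \<alpha>))"
  then obtain C0 K where C0: "\<And>k. k \<ge> K \<Longrightarrow> fourier_tail G T S \<mu> f k \<le> ennreal (C0 * vindex G S k powr (- 2 * \<alpha>))"
    unfolding eventually_sequentially by blast
  \<comment> \<open>A negative \<open>C0\<close> is possible, as \<open>ennreal\<close> truncates it
    to \<open>0\<close>; the square root taken below needs a nonnegative constant.\<close>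
  define C where "C = max C0 0"
  have C: "C \<ge> 0" "fourier_tail G T S \<mu> f k \<le> ennreal (C * vindex G S k powr (- 2 * \<alpha>))" if "k \<ge> K" for k
  proof -
    show "C \<ge> 0" by (simp add: C_def)
    have "C0 * vindex G S k powr (- 2 * \<alpha>) \<le> C * vindex G S k powr (- 2 * \<alpha>)"
      by (intro mult_right_mono) (auto simp: C_def)
    then show "fourier_tail G T S \<mu> f k \<le> ennreal (C * vindex G S k powr (- 2 * \<alpha>))"
      using C0[OF that] ennreal_leI order_trans by blast
  qed
  have C': "C \<ge> 0" by (simp add: C_def)
  \<comment> \<open>The constant is the square root of \<open>4 * C\<close>, with the factor
    \<open>4\<close> from \<open>shift_norm_le_tail\<close>.\<close>
  have "norm (L2_norm_fun \<mu> (shift_diff f h)) \<le> (2 * sqrt C) * norm (vabs G S \<mu> h powr \<alpha>)" if h: "h \<in> S K" for h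
  proof (cases "h = \<one>")
    case True
    have "(\<integral>x. (cmod (f (\<one> \<otimes> x) - f x))\<^sup>2 \<partial>\<mu>) = (\<integral>x. 0 \<partial>\<mu>)"
      by (intro Bochner_Integration.integral_cong) auto
    then show ?thesis using True C' by (simp add: L2_norm_fun_def)
  next
    case False
    \<comment> \<open>The tail is taken at the exact level of \<open>h\<close>, where
      \<open>vabs\<close> equals \<open>1 / index k\<close>, so the decay in \<open>k\<close>
      becomes the decay in \<open>h\<close>.\<close>
    then obtain k where k: "h \<in> S k - S (Suc k)" using exists_level S_subset[OF h] by blast
    then have "K \<le> k" using h S_mono[of "Suc k" K] using not_less_eq_eq by blast
    have "(L2_norm_fun \<mu> (shift_diff f h))\<^sup>2 \<le> 4 * (C * vindex G S k powr (- 2 * \<alpha>))"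
      unfolding L2_norm_fun_square using k C[OF \<open>K \<le> k\<close>] by (intro shift_norm_le_tail[OF f]) auto
    also have "\<dots> = (2 * sqrt C * (real (index k) powr - \<alpha>))\<^sup>2"
      using powr_square[of "real (index k)" \<alpha>] index_pos[of k] C' by (simp add: power_mult_distrib)
    finally have "\<bar>L2_norm_fun \<mu> (shift_diff f h)\<bar> \<le> \<bar>2 * sqrt C * (real (index k) powr - \<alpha>)\<bar>"
      by (rule abs_le_square_iff[THEN iffD2])
    then show ?thesis using C' by (simp add: vabs_level[OF k] powr_index abs_mult)
  qed
  then have "eventually (\<lambda>h. norm (L2_norm_fun \<mu> (shift_diff f h)) \<le> (2 * sqrt C) * norm (vabs G S \<mu> h powr \<alpha>)) (vabs_to_0 G S \<mu>)"
    unfolding eventually_vabs_to_0 by blast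
  then have "(\<lambda>h. L2_norm_fun \<mu> (shift_diff f h)) \<in> O[vabs_to_0 G S \<mu>](\<lambda>h. vabs G S \<mu> h powr \<alpha>)"
    by (rule bigoI)
  then show "f \<in> Lip2 G S \<mu> \<alpha>" using f by (simp add: Lip2_def)
qed

end

theorem theorem1p6:
  fixes G :: "('a, 'b) monoid_scheme" and T :: "'a topology" and S :: "nat \<Rightarrow> 'a set"
    and \<mu> :: "'a measure" and \<alpha> :: real and f :: "'a \<Rightarrow> complex"
  assumes "compact_vilenkin_group G T S"
    and "normalized_haar_measure G T \<mu>"
    and "condition_A G T S \<mu>"
    and "0 < \<alpha>" and "\<alpha> \<le> 1"
    and "f \<in> L2 \<mu>"
  shows "f \<in> Lip2 G S \<mu> \<alpha> \<longleftrightarrow>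
    (\<exists>C::real. \<forall>\<^sub>F k in sequentially.
       fourier_tail G T S \<mu> f k \<le> ennreal (C * vindex G S k powr (- 2 * \<alpha>)))"
proof -
  interpret compact_vilenkin_group G T S by fact
  interpret vilenkin_haar_A G T S \<mu>
    by unfold_locales (fact assms)+
  show ?thesis using assms(4,6) by (rule Lip2_iff_fourier_tail)
qed

end
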